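(* Let $(\psi_{s},\mu_{s})\in X_d\times\mathbb{R}$ be a solution of the Ginzburg--Landau equations $\mathcal{GL}(\psi_s;\mu_s)=0$ with $\psi_s\neq 0$, and let $\psi_0\in L^2(\Omega_d;\mathbb{C})$ be such that $\langle\psi_0,\psi_s\rangle_{L^2}\neq 0$. Then $$\dim\ker\mathcal{J}_p(\psi_s,0;\mu_s)<\dim\ker\mathcal{J}(\psi_s;\mu_s).$$
   Context: $\Omega_d=(-d/2,d/2)^2$, $d>0$, is the open planar square of side $d$, and $\langle\varphi,\psi\rangle_{L^2}=\int_{\Omega_d}\overline{\varphi}\,\psi$ is the inner product of $L^2(\Omega_d;\mathbb{C})$. For $\mu\in\mathbb{R}$ the magnetic vector potential is $\mathbf{A}=\mathbf{A}(x,y;\mu)=\tfrac12(-\mu y,\mu x)^T$. $X_d$ is the natural energy space over $\Omega_d$ associated with the Gibbs energy, i.e. the space of complex-valued functions $\psi$ on $\Omega_d$ for which the ($\psi$-dependent part of the) energy integral $\int_{\Omega_d}\big(-|\psi|^2+\tfrac12|\psi|^4+|-\mathrm{i}\nabla\psi-\mathbf{A}\psi|^2\big)$ is well-defined, and $Y_d$ is its dual space. Both are regarded as real vector spaces, and dimensions are over $\mathbb{R}$. The Ginzburg--Landau operator (extreme type-II limit) $\mathcal{GL}(\cdot;\mu):X_d\to Y_d$ is $$\mathcal{GL}(\psi;\mu)=\begin{cases}(-\mathrm{i}\nabla-\mathbf{A}(\mu))^2\psi-\psi(1-|\psi|^2)&\text{on }\Omega_d,\\ \mathbf{n}\cdot(-\mathrm{i}\nabla-\mathbf{A}(\mu))\psi&\text{on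 }\partial\Omega_d,\end{cases}$$ with $\mathbf{n}$ the normal on $\partial\Omega_d$ and the boundary conditions given in the sense of traces. Its Jacobian operator, obtained by linearizing $\mathcal{GL}(\cdot;\mu)$ at $\psi$, is the real-linear map $\mathcal{J}(\psi;\mu):X_d\to Y_d$, $$\mathcal{J}(\psi;\mu)\varphi=\big((-\mathrm{i}\nabla-\mathbf{A})^2-1+2|\psi|^2\big)\varphi+\psi^2\overline{\varphi}.$$ Given the reference state $\psi_0$, the extended problem for $(\psi,\eta)\in X_d\times\mathbb{R}$ is $\mathcal{GL}(\psi;\mu)-\mathrm{i}\eta\psi=0$, $\operatorname{Im}\langle\psi_0,\psi\rangle_{L^2}=0$. Its Jacobian operator is the real-linear map $\mathcal{J}_p(\psi,\eta;\mu):X_d\times\mathbb{R}\to Y_d\times\mathbb{R}$, $$\mathcal{J}_p(\psi,\eta;\mu)\begin{pmatrix}\varphi\\ \nu\end{pmatrix}=\begin{pmatrix}(\mathcal{J}(\psi;\mu)-\mathrm{i}\eta)\varphi-\mathrm{i}\psi\nu\\ \operatorname{Im}\langle\psi_0,\varphi\rangle_{L^2}\end{pmatrix}.$$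
   Formalization: The hypothesis ⟨ψ_0,ψ_s⟩≠0 is replaced by Re⟨ψ_0,ψ_s⟩≠0, which follows from it under the phase condition Im⟨ψ_0,ψ_s⟩=0; without this the claim fails, e.g. for μ_s=0, ψ_s=1, ψ_0=i, where both kernels have dimension 1. *)

theory Defs
  imports "HOL-Analysis.Analysis" "HOL-Library.Extended_Nat"
begin

definition ae_eq :: "(real \<times> real \<Rightarrow> complex) \<Rightarrow> (real \<times> real \<Rightarrow> complex) \<Rightarrow> bool" where
  "ae_eq f g \<longleftrightarrow> f \<in> borel_measurable lborel \<and> g \<in> borel_measurable lborel
     \<and> (AE p in lborel. f p = g p)"

quotient_type aefun = "real \<times> real \<Rightarrow> complex" / partial: ae_eq
proof (rule part_equivpI)
  show "\<exists>f. ae_eq f f"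
    by (rule exI[of _ "\<lambda>_. 0"]) (simp add: ae_eq_def)
  show "symp ae_eq"
    by (auto simp: symp_def ae_eq_def)
  show "transp ae_eq"
    unfolding transp_def ae_eq_def by (auto elim: AE_mp)
qed

instantiation aefun :: real_vector
begin

lift_definition zero_aefun :: aefun is "\<lambda>_. 0"
  by (simp add: ae_eq_def)

lift_definition plus_aefun :: "aefun \<Rightarrow> aefun \<Rightarrow> aefun" is "\<lambda>f g p. f p + g p"
  by (auto simp: ae_eq_def)

lift_definition minus_aefun :: "aefun \<Rightarrow> aefun \<Rightarrow> aefun" is "\<lambda>f g p. f p - g p"
  by (auto simp: ae_eq_def)

lift_definition uminus_aefun :: "aefun \<Rightarrow> aefun" is "\<lambda>f p. - f p"
  by (auto simp: ae_eq_def)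

lift_definition scaleR_aefun :: "real \<Rightarrow> aefun \<Rightarrow> aefun" is "\<lambda>r f p. r *\<^sub>R f p"
  by (auto simp: ae_eq_def)

instance
  by standard (transfer, auto simp: ae_eq_def algebra_simps)+

end

text \<open>
  A class of functions on the open square is represented by its extension by zero to the plane.
  All notions below evaluate a class through the representative \<open>rep_aefun u\<close>; they involve it
  only under integrals and in almost-everywhere statements, so the choice is immaterial.
\<close>

definition square :: "real \<Rightarrow> (real \<times> real) set" where
  "square d = {- d / 2 <..< d / 2} \<times> {- d / 2 <..< d / 2}"

definition lives_on_square :: "real \<Rightarrow> aefun \<Rightarrow> bool" where
  "lives_on_square d u \<longleftrightarrow> (AE p in lborel. p \<notin> square d \<longrightarrow> rep_aefun u p = 0)"

definition L2_space :: "real \<Rightarrow> aefun set" where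
  "L2_space d = {u. lives_on_square d u
     \<and> set_integrable lborel (square d) (\<lambda>p. (cmod (rep_aefun u p))\<^sup>2)}"

definition L2_inner :: "real \<Rightarrow> aefun \<Rightarrow> aefun \<Rightarrow> complex" where
  "L2_inner d f g = (LINT p:square d|lborel. cnj (rep_aefun f p) * rep_aefun g p)"

primrec Ck :: "nat \<Rightarrow> (real \<times> real \<Rightarrow> real) \<Rightarrow> bool" where
  "Ck 0 f \<longleftrightarrow> continuous_on UNIV f"
| "Ck (Suc k) f \<longleftrightarrow> (\<exists>f1 f2. Ck k f1 \<and> Ck k f2 \<and>
     (\<forall>p. (f has_derivative (\<lambda>h. f1 p * fst h + f2 p * snd h)) (at p)))"

definition test_function :: "real \<Rightarrow> (real \<times> real \<Rightarrow> real) \<Rightarrow> bool" where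
  "test_function d f \<longleftrightarrow> (\<forall>k. Ck k f)
     \<and> (\<exists>K. compact K \<and> K \<subseteq> square d \<and> (\<forall>p. p \<notin> K \<longrightarrow> f p = 0))"

definition locally_integrable :: "real \<Rightarrow> aefun \<Rightarrow> bool" where
  "locally_integrable d u \<longleftrightarrow>
     (\<forall>K. compact K \<and> K \<subseteq> square d \<longrightarrow> set_integrable lborel K (rep_aefun u))"

definition has_weak_deriv :: "real \<Rightarrow> real \<times> real \<Rightarrow> aefun \<Rightarrow> aefun \<Rightarrow> bool" where
  "has_weak_deriv d e u g \<longleftrightarrow>
     lives_on_square d u \<and> lives_on_square d g \<and> locally_integrable d u \<and> locally_integrable d g \<and>
     (\<forall>f. test_function d f \<longrightarrow>
        (LINT p:square d|lborel. rep_aefun u p * of_real (frechet_derivative f (at p) e))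
        = - (LINT p:square d|lborel. rep_aefun g p * of_real (f p)))"

definition weakly_differentiable :: "real \<Rightarrow> aefun \<Rightarrow> bool" where
  "weakly_differentiable d u \<longleftrightarrow>
     (\<exists>g1. has_weak_deriv d (1, 0) u g1) \<and> (\<exists>g2. has_weak_deriv d (0, 1) u g2)"

text \<open>Weak derivatives are unique as classes; the value is meaningful when one exists.\<close>

definition weak_deriv :: "real \<Rightarrow> real \<times> real \<Rightarrow> aefun \<Rightarrow> aefun" where
  "weak_deriv d e u = (THE g. has_weak_deriv d e u g)"

definition vector_potential :: "real \<Rightarrow> real \<times> real \<Rightarrow> real \<times> real" where
  "vector_potential \<mu> p = (- (\<mu> * snd p) / 2, \<mu> * fst p / 2)"

definition cov_grad :: "real \<Rightarrow> real \<Rightarrow> aefun \<Rightarrow> real \<times> real \<Rightarrow> complex \<times> complex" where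
  "cov_grad d \<mu> u p =
     (- \<i> * rep_aefun (weak_deriv d (1, 0) u) p
        - of_real (fst (vector_potential \<mu> p)) * rep_aefun u p,
      - \<i> * rep_aefun (weak_deriv d (0, 1) u) p
        - of_real (snd (vector_potential \<mu> p)) * rep_aefun u p)"

definition gibbs_density :: "real \<Rightarrow> real \<Rightarrow> aefun \<Rightarrow> real \<times> real \<Rightarrow> real" where
  "gibbs_density d \<mu> u p =
     - (cmod (rep_aefun u p))\<^sup>2 + (cmod (rep_aefun u p)) ^ 4 / 2 + (norm (cov_grad d \<mu> u p))\<^sup>2"

text \<open>
  The energy space \<open>X\<^sub>d\<close>. As \<open>- t + t\<^sup>2 / 2 \<ge> - 1 / 2\<close> and the square is bounded, integrability
  of the density is integrability of each of its terms; as \<open>A(\<mu>)\<close> is bounded on the square, the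
  condition then does not depend on \<open>\<mu>\<close>.
\<close>

definition energy_space :: "real \<Rightarrow> aefun set" where
  "energy_space d = {u. lives_on_square d u \<and> weakly_differentiable d u
     \<and> (\<forall>\<mu>. set_integrable lborel (square d) (gibbs_density d \<mu> u))}"

text \<open>
  Elements of the dual \<open>Y\<^sub>d\<close> are given as functionals of \<open>\<xi> \<in> X\<^sub>d\<close>, in the antilinear pairing
  that extends \<open>\<langle>\<xi>, f\<rangle>\<close> for \<open>f \<in> L\<^sup>2\<close>. In particular
  \<open>(- \<i> \<nabla> - A)\<^sup>2 \<psi>\<close> together with the natural boundary condition \<open>n \<cdot> (- \<i> \<nabla> - A) \<psi> = 0\<close>
  is the functional \<open>magnetic_form d \<mu> \<psi>\<close>: integrating by parts, it vanishes against all
  \<open>\<xi>\<close> (not only those with zero trace) exactly when both hold. For \<open>\<xi> \<in> X\<^sub>d\<close> all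
  integrands below are integrable, since they are products of functions in \<open>L\<^sup>2\<close> or in \<open>L\<^sup>4\<close>.
\<close>

type_synonym functional = "aefun \<Rightarrow> complex"

definition magnetic_form :: "real \<Rightarrow> real \<Rightarrow> aefun \<Rightarrow> functional" where
  "magnetic_form d \<mu> \<psi> \<xi> = (LINT p:square d|lborel.
      cnj (fst (cov_grad d \<mu> \<xi> p)) * fst (cov_grad d \<mu> \<psi> p)
    + cnj (snd (cov_grad d \<mu> \<xi> p)) * snd (cov_grad d \<mu> \<psi> p))"

definition dual_zero :: "real \<Rightarrow> functional" where
  "dual_zero d = (\<lambda>\<xi>\<in>energy_space d. 0)"

definition GL :: "real \<Rightarrow> aefun \<Rightarrow> real \<Rightarrow> functional" where
  "GL d \<psi> \<mu> = (\<lambda>\<xi>\<in>energy_space d. magnetic_form d \<mu> \<psi> \<xi>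
     - (LINT p:square d|lborel. cnj (rep_aefun \<xi> p) *
          (rep_aefun \<psi> p * (1 - of_real ((cmod (rep_aefun \<psi> p))\<^sup>2)))))"

definition Jac :: "real \<Rightarrow> aefun \<Rightarrow> real \<Rightarrow> aefun \<Rightarrow> functional" where
  "Jac d \<psi> \<mu> \<phi> = (\<lambda>\<xi>\<in>energy_space d. magnetic_form d \<mu> \<phi> \<xi>
     + (LINT p:square d|lborel. cnj (rep_aefun \<xi> p) *
          ((- 1 + 2 * of_real ((cmod (rep_aefun \<psi> p))\<^sup>2)) * rep_aefun \<phi> p
           + (rep_aefun \<psi> p)\<^sup>2 * cnj (rep_aefun \<phi> p))))"

definition Jac_ext ::
  "real \<Rightarrow> aefun \<Rightarrow> aefun \<Rightarrow> real \<Rightarrow> real \<Rightarrow> aefun \<times> real \<Rightarrow> functional \<times> real" where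
  "Jac_ext d \<psi>0 \<psi> \<eta> \<mu> = (\<lambda>(\<phi>, \<nu>).
     (\<lambda>\<xi>\<in>energy_space d. Jac d \<psi> \<mu> \<phi> \<xi>
        - \<i> * of_real \<eta> * L2_inner d \<xi> \<phi> - \<i> * of_real \<nu> * L2_inner d \<xi> \<psi>,
      Im (L2_inner d \<psi>0 \<phi>)))"

definition ker_Jac :: "real \<Rightarrow> aefun \<Rightarrow> real \<Rightarrow> aefun set" where
  "ker_Jac d \<psi> \<mu> = {\<phi> \<in> energy_space d. Jac d \<psi> \<mu> \<phi> = dual_zero d}"

definition ker_Jac_ext :: "real \<Rightarrow> aefun \<Rightarrow> aefun \<Rightarrow> real \<Rightarrow> real \<Rightarrow> (aefun \<times> real) set" where
  "ker_Jac_ext d \<psi>0 \<psi> \<eta> \<mu> =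
     {z \<in> energy_space d \<times> UNIV. Jac_ext d \<psi>0 \<psi> \<eta> \<mu> z = (dual_zero d, 0)}"

text \<open>The constant \<open>dim\<close> returns a default value on infinite-dimensional subspaces, which the
  following avoids.\<close>

definition edim :: "'a::real_vector set \<Rightarrow> enat" where
  "edim V = (if \<exists>B. finite B \<and> V \<subseteq> span B then enat (dim V) else \<infinity>)"

end

theory Submission
  imports Defs
begin

text \<open>
  The kernel of \<open>J\<close> is finite-dimensional: testing \<open>J \<phi> = 0\<close> with \<open>\<phi>\<close> and using
  \<open>2 |\<psi>|\<^sup>2 |\<phi>|\<^sup>2 + Re (\<psi>\<^sup>2 (cnj \<phi>)\<^sup>2) \<ge> 0\<close> bounds the \<open>L\<^sup>2\<close> norm of the gradient of \<open>\<phi>\<close> by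
  that of \<open>\<phi>\<close>. If the weighted means of \<open>\<phi>\<close> over the cells of a fine grid all vanish, the Poincare
  inequality on each cell gives the reverse bound with a small constant, so \<open>\<phi> = 0\<close>; hence the finitely
  many cell means are injective on the kernel. This elementary argument replaces Rellich compactness.

  Gauge invariance gives \<open>J (\<i> \<psi>) = \<i> GL \<psi> = 0\<close>. If \<open>(\<phi>, \<nu>)\<close> lies in the kernel of the extended
  Jacobian, then pairing \<open>J \<phi> = \<i> \<nu> \<psi>\<close> with \<open>\<i> \<psi>\<close> and using that \<open>J\<close> is symmetric for the real part
  of the pairing gives \<open>\<nu> \<parallel>\<psi>\<parallel>\<^sup>2 = 0\<close>, so \<open>\<nu> = 0\<close>. The extended kernel is thus the part of the kernel
  of \<open>J\<close> on which \<open>Im \<langle>\<psi>\<^sub>0, \<phi>\<rangle> = 0\<close>, and this excludes \<open>\<i> \<psi>\<close>.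
\<close>

subsection \<open>Smooth bumps on the line\<close>

text \<open>The Poincare inequality has to be proved for weak derivatives, which can be tested only
  against smooth functions supported inside the open square. Hence the cell means carry smooth
  weights r, s of mass one instead of being plain averages. On a cell, a test function b(x) k(y)
  splits as (b - \<beta> r) k + \<beta> r (k - \<kappa> s) + \<beta> \<kappa> r s, where \<beta> and
  \<kappa> are the masses of b and k. The first two terms are partial derivatives of test functions,
  because a bump of mass zero has a compactly supported antiderivative; the last term sees only the
  weighted mean. Fubini turns this into an almost-everywhere formula for the function in terms of
  its gradient, with kernels bounded by one, and Cauchy-Schwarz yields a constant of order h^2. All
  weights are rescalings of one fixed bump, so the factor in front of h^2 is the same for all cells
  and all grids, and a fine enough grid beats the gradient bound on the kernel.\<close>

primrec smooth_upto :: "nat \<Rightarrow> (real \<Rightarrow> real) \<Rightarrow> bool" where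
  "smooth_upto 0 f \<longleftrightarrow> continuous_on UNIV f"
| "smooth_upto (Suc n) f \<longleftrightarrow>
     (\<exists>f'. smooth_upto n f' \<and> (\<forall>x. (f has_real_derivative f' x) (at x)))"

lemma smooth_upto_continuous: "smooth_upto n f \<Longrightarrow> continuous_on UNIV f"
  by (cases n) (auto intro!: continuous_at_imp_continuous_on intro: DERIV_isCont)

lemma smooth_upto_SucD: "smooth_upto (Suc n) f \<Longrightarrow> smooth_upto n f"
proof (induction n arbitrary: f)
  case 0
  then show ?case using smooth_upto_continuous smooth_upto.simps(1) by blast
next
  case (Suc n)
  then obtain f' where "smooth_upto (Suc n) f'" "\<forall>x. (f has_real_derivative f' x) (at x)"
    by (metis smooth_upto.simps(2))
  with Suc.IH show ?case by auto
qed

lemma smooth_upto_const: "smooth_upto n (\<lambda>_. c)"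
proof (induction n arbitrary: c)
  case (Suc n)
  have "\<forall>x. ((\<lambda>_. c) has_real_derivative 0) (at x)" by simp
  with Suc show ?case by (metis smooth_upto.simps(2))
qed simp

lemma smooth_upto_add:
  "smooth_upto n f \<Longrightarrow> smooth_upto n g \<Longrightarrow> smooth_upto n (\<lambda>x. f x + g x)"
proof (induction n arbitrary: f g)
  case 0 then show ?case by (simp add: continuous_on_add)
next
  case (Suc n)
  then obtain f' g' where "smooth_upto n f'" "\<forall>x. (f has_real_derivative f' x) (at x)"
     "smooth_upto n g'" "\<forall>x. (g has_real_derivative g' x) (at x)"
    by auto
  with Suc.IH show ?case by (auto intro!: exI[of _ "\<lambda>x. f' x + g' x"] DERIV_add)
qed

lemma smooth_upto_mult:
  "smooth_upto n f \<Longrightarrow> smooth_upto n g \<Longrightarrow> smooth_upto n (\<lambda>x. f x * g x)"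
proof (induction n arbitrary: f g)
  case 0 then show ?case by (simp add: continuous_on_mult)
next
  case (Suc n)
  then obtain f' g' where *: "smooth_upto n f'" "\<forall>x. (f has_real_derivative f' x) (at x)"
     "smooth_upto n g'" "\<forall>x. (g has_real_derivative g' x) (at x)"
    by auto
  \<comment> \<open>The product rule leaves one factor undifferentiated, and the induction
    hypothesis wants that factor at order \<open>n\<close>.\<close>
  have "smooth_upto n f" "smooth_upto n g" using Suc.prems smooth_upto_SucD by blast+
  then have "smooth_upto n (\<lambda>x. f' x * g x + g' x * f x)"
    by (intro smooth_upto_add Suc.IH *)
  then show ?case using * by (auto intro!: exI[of _ "\<lambda>x. f' x * g x + g' x * f x"] DERIV_mult)
qed

lemma smooth_upto_affine:
  "smooth_upto n f \<Longrightarrow> smooth_upto n (\<lambda>x. f (m * x + c))"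
proof (induction n arbitrary: f)
  case 0
  then show ?case
    by (auto intro!: continuous_on_compose2[of UNIV f UNIV "\<lambda>x. m * x + c"] continuous_intros)
next
  case (Suc n)
  then obtain f' where *: "smooth_upto n f'" "\<forall>x. (f has_real_derivative f' x) (at x)"
    by auto
  have "((\<lambda>x. f (m * x + c)) has_real_derivative f' (m * x + c) * m) (at x)" for x
    by (rule DERIV_chain2) (use * in \<open>auto intro!: derivative_eq_intros\<close>)
  moreover have "smooth_upto n (\<lambda>x. f' (m * x + c) * m)"
    by (intro smooth_upto_mult smooth_upto_const Suc.IH *)
  ultimately show ?case by auto
qed

text \<open>The powers of 1 / x are carried along because differentiation maps this family into its
  own span, so a single induction over all \<open>m\<close> gives smoothness of every order. The
  rate \<open>c\<close> stays free: sending it to 0 makes bumps approach indicators.\<close>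

definition flat_exp :: "real \<Rightarrow> nat \<Rightarrow> real \<Rightarrow> real" where
  "flat_exp c m x = (if x > 0 then exp (- c / x) * (1 / x) ^ m else 0)"

text \<open>With y = c / x tending to infinity from the right, this is the decay of y^m / exp y; on
  the left the function vanishes.\<close>

lemma flat_exp_tendsto_0:
  assumes "c > 0"
  shows "(flat_exp c m \<longlongrightarrow> 0) (at 0)"
proof -
  have 1: "LIM x at_right 0. c / x :> at_top"
    using filterlim_tendsto_pos_mult_at_top[OF tendsto_const assms filterlim_inverse_at_top_right]
    by (simp add: divide_inverse)
  have "((\<lambda>x. (1 / c ^ m) * ((c / x) ^ m / exp (c / x))) \<longlongrightarrow> (1 / c ^ m) * 0) (at_right 0)"
    by (intro tendsto_mult tendsto_const filterlim_compose[OF tendsto_power_div_exp_0 1])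
  moreover have "eventually (\<lambda>x. (1 / c ^ m) * ((c / x) ^ m / exp (c / x)) = flat_exp c m x) (at_right 0)"
    using assms by (auto simp: eventually_at_filter flat_exp_def power_divide exp_minus field_simps)
  ultimately have "(flat_exp c m \<longlongrightarrow> 0) (at_right 0)"
    by (auto elim: Lim_transform_eventually)
  moreover have "(flat_exp c m \<longlongrightarrow> 0) (at_left 0)"
    by (rule Lim_transform_eventually[OF tendsto_const])
       (auto simp: eventually_at_filter flat_exp_def)
  ultimately show ?thesis by (simp add: filterlim_at_split)
qed

lemma flat_exp_deriv:
  assumes "c > 0"
  shows "(flat_exp c m has_real_derivative c * flat_exp c (m + 2) x - m * flat_exp c (m + 1) x) (at x)"
proof -
  consider "x > 0" | "x < 0" | "x = 0" by linarith
  then show ?thesis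
  proof cases
    case 1
    have "((\<lambda>x. exp (- c / x) * (1 / x) ^ m) has_real_derivative
        c * flat_exp c (m + 2) x - m * flat_exp c (m + 1) x) (at x)"
    proof -
      have "((\<lambda>x. (1 / x) ^ m) has_real_derivative real m * (- ((1 / x) ^ 2) * (1 / x) ^ (m - Suc 0))) (at x)"
        using 1 by (intro DERIV_power) (auto intro!: derivative_eq_intros simp: power2_eq_square)
      \<comment> \<open>The truncated exponent is harmless at m = 0, where the factor
        \<open>real m\<close> vanishes.\<close>
      moreover have "real m * (- (q ^ 2) * q ^ (m - Suc 0)) = - (real m * q ^ (m + 1))" for q :: real
        by (cases m) (auto simp: power2_eq_square algebra_simps)
      ultimately have P: "((\<lambda>x. (1 / x) ^ m) has_real_derivative - (real m * (1 / x) ^ (m + 1))) (at x)"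
        by metis
      have E: "((\<lambda>x. exp (- c / x)) has_real_derivative exp (- c / x) * (c * (1 / x) ^ 2)) (at x)"
        using 1 by (auto intro!: derivative_eq_intros simp: power2_eq_square)
      show ?thesis
        by (rule DERIV_cong[OF DERIV_mult[OF E P]])
          (use 1 in \<open>simp add: flat_exp_def power_add power2_eq_square algebra_simps\<close>)
    qed
    then show ?thesis
      using 1 by (rule_tac has_field_derivative_transform_within_open[where S="{0<..}"])
        (auto simp: flat_exp_def)
  next
    case 2
    have "((\<lambda>x. 0) has_real_derivative c * flat_exp c (m + 2) x - m * flat_exp c (m + 1) x) (at x)"
      using 2 by (simp add: flat_exp_def)
    then show ?thesis
      using 2 by (rule_tac has_field_derivative_transform_within_open[where S="{..<0}"])
        (auto simp: flat_exp_def)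
  next
    case 3
    \<comment> \<open>At 0 the difference quotient is again a member of the family, with
      \<open>m\<close> raised by one, so its limit is already known to be 0.\<close>
    have "flat_exp c (m + 1) h = (flat_exp c m (0 + h) - flat_exp c m 0) / h" if "h \<noteq> 0" for h
      using that by (simp add: flat_exp_def)
    then have "((\<lambda>h. (flat_exp c m (0 + h) - flat_exp c m 0) / h) \<longlongrightarrow> 0) (at 0)"
      by (intro Lim_transform_eventually[OF flat_exp_tendsto_0[OF assms, of "m+1"]])
        (simp add: eventually_at_filter)
    then show ?thesis using 3 by (simp add: DERIV_def flat_exp_def)
  qed
qed

lemma smooth_upto_flat_exp:
  assumes "c > 0"
  shows "smooth_upto n (flat_exp c m)"
proof (induction n arbitrary: m)
  case 0
  then show ?case
    using flat_exp_deriv[OF assms] by (auto intro!: continuous_at_imp_continuous_on DERIV_isCont)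
next
  case (Suc n)
  have "smooth_upto n (\<lambda>x. c * flat_exp c (m + 2) x + (- m) * flat_exp c (m + 1) x)"
    by (intro smooth_upto_add smooth_upto_mult smooth_upto_const Suc)
  then show ?case using flat_exp_deriv[OF assms] by (auto simp del: of_nat_add)
qed

definition bump :: "real \<Rightarrow> real \<Rightarrow> real \<Rightarrow> real \<Rightarrow> real" where
  "bump c l r x = flat_exp c 0 (x - l) * flat_exp c 0 (r - x)"

text \<open>The support must stay away from the endpoints, as for a test function on an open set.
  The witnessing interval may be empty, in which case \<open>f\<close> is the zero function.\<close>

definition smooth_bump_on :: "real \<Rightarrow> real \<Rightarrow> (real \<Rightarrow> real) \<Rightarrow> bool" where
  "smooth_bump_on l r f \<longleftrightarrow> (\<forall>n. smooth_upto n f) \<and>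
     (\<exists>l' r'. l < l' \<and> r' < r \<and> (\<forall>x. x \<notin> {l'..r'} \<longrightarrow> f x = 0))"

lemma smooth_bump_onI:
  assumes "\<And>n. smooth_upto n f" "l < l'" "r' < r" "\<And>x. x \<notin> {l'..r'} \<Longrightarrow> f x = 0"
  shows "smooth_bump_on l r f"
  unfolding smooth_bump_on_def using assms(1) assms(2-4)
  by (intro conjI allI exI[of _ l'] exI[of _ r']) simp_all

lemma smooth_bump_onE:
  assumes "smooth_bump_on l r f"
  obtains l' r' where "\<And>n. smooth_upto n f" "l < l'" "r' < r" "\<And>x. x \<notin> {l'..r'} \<Longrightarrow> f x = 0"
  using assms unfolding smooth_bump_on_def by (elim conjE exE) simp

lemma bump_smooth:
  assumes "c > 0" "l < l'" "r' < r"
  shows "smooth_bump_on l r (bump c l' r')"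
proof -
  have "smooth_upto n (\<lambda>x. flat_exp c 0 (1 * x + - l') * flat_exp c 0 ((-1) * x + r'))" for n
    by (intro smooth_upto_mult smooth_upto_affine smooth_upto_flat_exp assms)
  then have "smooth_upto n (bump c l' r')" for n
    by (simp add: bump_def[abs_def])
  then show ?thesis using assms(2,3)
    by (rule smooth_bump_onI) (auto simp: bump_def flat_exp_def)
qed

lemma bump_outside: "x \<notin> {l..r} \<Longrightarrow> bump c l r x = 0"
  by (auto simp: bump_def flat_exp_def)

lemma bump_nonneg: "bump c l r x \<ge> 0"
  by (simp add: bump_def flat_exp_def)

lemma bump_le_1: "c > 0 \<Longrightarrow> bump c l r x \<le> 1"
  by (auto simp: bump_def flat_exp_def intro!: mult_le_one)

lemma bump_pos: "c > 0 \<Longrightarrow> l < x \<Longrightarrow> x < r \<Longrightarrow> bump c l r x > 0"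
  by (simp add: bump_def flat_exp_def)

text \<open>Each exponential factor tends to 1 where it is not cut off to 0. The cut-off includes
  both endpoints, hence the open interval.\<close>

lemma bump_tendsto_indicator:
  "(\<lambda>n. bump (1 / Suc n) l r x) \<longlonglongrightarrow> indicator {l<..<r} x"
proof -
  have *: "(\<lambda>n. exp (- (1 / real (Suc n)) / y)) \<longlonglongrightarrow> 1" for y
  proof -
    have "(\<lambda>n. exp (- (inverse (real (Suc n))) / y)) \<longlonglongrightarrow> exp (- 0 / y)"
      unfolding divide_inverse by (intro tendsto_intros LIMSEQ_inverse_real_of_nat)
    then show ?thesis by (simp add: inverse_eq_divide)
  qed
  show ?thesis
    using tendsto_mult[OF *[of "x - l"] *[of "r - x"]]
    by (auto simp: bump_def flat_exp_def indicator_def)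
qed

lemma smooth_bump_on_bound:
  assumes "smooth_bump_on l r f"
  obtains M where "\<And>x. \<bar>f x\<bar> \<le> M" "M \<ge> 0"
proof -
  obtain l' r' where *: "\<And>n. smooth_upto n f" "\<And>x. x \<notin> {l'..r'} \<Longrightarrow> f x = 0"
    using assms by (elim smooth_bump_onE) (rule that; assumption)
  have cont: "continuous_on UNIV f" using *(1) by (rule smooth_upto_continuous)
  have "compact (f ` {l'..r'})"
    by (intro compact_continuous_image continuous_on_subset[OF cont]) auto
  then obtain M where "\<forall>y\<in>f ` {l'..r'}. norm y \<le> M" by (meson compact_imp_bounded bounded_iff)
  then have "\<bar>f x\<bar> \<le> max M 0" for x
    using *(2)[of x] by (cases "x \<in> {l'..r'}") (auto simp: le_max_iff_disj)
  then show ?thesis by (intro that[of "max M 0"]) auto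
qed

lemma smooth_bump_on_continuous: "smooth_bump_on l r f \<Longrightarrow> continuous_on UNIV f"
  by (elim smooth_bump_onE) (rule smooth_upto_continuous[of 0])

lemma smooth_bump_on_measurable:
  "smooth_bump_on l r f \<Longrightarrow> f \<in> borel_measurable borel"
  by (intro borel_measurable_continuous_onI smooth_bump_on_continuous)

lemma smooth_bump_on_outside: "smooth_bump_on l r f \<Longrightarrow> x \<notin> {l<..<r} \<Longrightarrow> f x = 0"
  by (elim smooth_bump_onE) fastforce

lemma smooth_bump_on_integrable:
  assumes "smooth_bump_on l r f"
  shows "integrable lborel f"
proof -
  obtain M where M: "\<And>x. \<bar>f x\<bar> \<le> M" using smooth_bump_on_bound[OF assms] by blast
  have "integrable lborel (\<lambda>x. indicator {l<..<r} x * M)"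
    by (intro integrable_mult_left integrable_real_indicator)
      (use emeasure_bounded_finite[of "{l<..<r}"] in auto)
  then show ?thesis
    using smooth_bump_on_measurable[OF assms] assms
    by (rule_tac Bochner_Integration.integrable_bound[where f="\<lambda>x. indicator {l<..<r} x * M"])
       (auto simp: indicator_def M abs_of_nonneg order_trans[OF abs_ge_zero M] smooth_bump_on_outside)
qed

lemma smooth_bump_on_affine_comb:
  assumes "smooth_bump_on l r f" "smooth_bump_on l r g"
  shows "smooth_bump_on l r (\<lambda>x. \<alpha> * f x + \<beta> * g x)"
proof -
  obtain l1 r1 where f: "\<And>n. smooth_upto n f" "l < l1" "r1 < r" "\<And>x. x \<notin> {l1..r1} \<Longrightarrow> f x = 0"
    using assms(1) by (elim smooth_bump_onE) (rule that; assumption)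
  obtain l2 r2 where g: "\<And>n. smooth_upto n g" "l < l2" "r2 < r" "\<And>x. x \<notin> {l2..r2} \<Longrightarrow> g x = 0"
    using assms(2) by (elim smooth_bump_onE) (rule that; assumption)
  show ?thesis
  proof (rule smooth_bump_onI)
    show "smooth_upto n (\<lambda>x. \<alpha> * f x + \<beta> * g x)" for n
      by (intro smooth_upto_add smooth_upto_mult smooth_upto_const f g)
    show "\<alpha> * f x + \<beta> * g x = 0" if "x \<notin> {min l1 l2..max r1 r2}" for x
      using that f(4)[of x] g(4)[of x] by (auto simp: min_le_iff_disj le_max_iff_disj)
  qed (use f g in auto)
qed

lemma smooth_bump_on_deriv:
  assumes "smooth_bump_on l r f"
  obtains f' where "smooth_bump_on l r f'" "\<And>x. (f has_real_derivative f' x) (at x)"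
proof -
  obtain l' r' where *: "l < l'" "r' < r" "\<And>x. x \<notin> {l'..r'} \<Longrightarrow> f x = 0"
    and sm: "\<And>n. smooth_upto n f"
    using assms by (elim smooth_bump_onE) (rule that; assumption)
  have "\<exists>f'. smooth_upto n f' \<and> (\<forall>x. (f has_real_derivative f' x) (at x))" for n
    using sm[of "Suc n"] by simp
  then obtain F where F: "\<And>n. smooth_upto n (F n)" "\<And>n x. (f has_real_derivative F n x) (at x)"
    by metis
  \<comment> \<open>Every order supplies its own derivative; uniqueness makes them one function,
    which is therefore smooth of every order.\<close>
  have "F n = F 0" for n using DERIV_unique[OF F(2) F(2)] by (rule ext)
  with F(1) have smF: "smooth_upto n (F 0)" for n by metis
  have F0: "F 0 x = 0" if "x \<notin> {l'..r'}" for x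
  proof -
    have "open (- {l'..r'})" by (simp add: open_Compl)
    then have "(f has_real_derivative 0) (at x)"
      using that *(3) by (rule_tac has_field_derivative_transform_within_open[of "\<lambda>x. 0" _ _ "- {l'..r'}"]) auto
    then show ?thesis using DERIV_unique[OF F(2)] by simp
  qed
  have "smooth_bump_on l r (F 0)" by (rule smooth_bump_onI[OF smF *(1,2) F0])
  with that F(2) show ?thesis by blast
qed

text \<open>To the left of the support the antiderivative is 0, to the right it equals the total
  mass, so mass zero is exactly what keeps the support compact. The indicator form of the integral
  is the one that occurs in \<open>kern\<close>.\<close>

lemma smooth_bump_on_antiderivative:
  assumes "smooth_bump_on l r f" "integral\<^sup>L lborel f = 0"
  shows "smooth_bump_on l r (\<lambda>x. \<integral>t. f t * indicator {t. t < x} t \<partial>lborel)"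
    and "((\<lambda>x. \<integral>t. f t * indicator {t. t < x} t \<partial>lborel) has_real_derivative f x) (at x)"
proof -
  let ?B = "\<lambda>x. \<integral>t. f t * indicator {t. t < x} t \<partial>lborel"
  obtain l' r' where *: "l < l'" "r' < r" "\<And>x. x \<notin> {l'..r'} \<Longrightarrow> f x = 0"
    and sm: "\<And>n. smooth_upto n f"
    using assms(1) by (elim smooth_bump_onE) (rule that; assumption)
  have cont: "continuous_on UNIV f" using assms(1) by (rule smooth_bump_on_continuous)
  have B: "?B x = integral {l'..x} f" for x
  proof -
    have "?B x = (LINT t:{l'..x}|lborel. f t)"
      unfolding set_lebesgue_integral_def
    proof (rule integral_cong_AE)
      show "AE t in lborel. f t * indicator {t. t < x} t = indicat_real {l'..x} t *\<^sub>R f t"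
        using AE_lborel_singleton[of x] by eventually_elim (use *(3) in \<open>auto simp: indicator_def\<close>)
    qed (use smooth_bump_on_measurable[OF assms(1)] in simp_all)
    also have "\<dots> = integral {l'..x} f"
      by (intro set_borel_integral_eq_integral)
         (auto intro!: borel_integrable_atLeastAtMost' continuous_on_subset[OF cont])
    finally show ?thesis .
  qed
  show deriv: "(?B has_real_derivative f x) (at x)" for x
  proof -
    \<comment> \<open>A base point to the left of both the support and x: moving it there does not
      change the integral, and x becomes an interior point, so the derivative is two-sided.\<close>
    define a where "a = min l' x - 1"
    have "integral {l'..y} f = integral {a..y} f" for y
    proof -
      have "(\<lambda>t. if t \<in> {l'..y} then f t else 0) = (\<lambda>t. if t \<in> {a..y} then f t else 0)"
        by (rule ext) (use *(3) in \<open>auto simp: a_def\<close>)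
      then show ?thesis by (metis integral_restrict_UNIV)
    qed
    then have eq: "?B = (\<lambda>y. integral {a..y} f)" using B by auto
    have "((\<lambda>y. integral {a..y} f) has_real_derivative f x) (at x within {a..x+1})"
      by (rule integral_has_real_derivative) (auto simp: a_def intro: continuous_on_subset[OF cont])
    moreover have "at x within {a..x+1} = at x"
      by (rule at_within_interior) (auto simp: a_def interior_atLeastAtMost_real)
    ultimately show ?thesis unfolding eq by simp
  qed
  have smB: "smooth_upto n ?B" for n
  proof (rule smooth_upto_SucD)
    show "smooth_upto (Suc n) ?B"
      unfolding smooth_upto.simps(2) using sm deriv by (intro exI[of _ f]) simp
  qed
  have B0: "?B x = 0" if "x \<notin> {l'..r'}" for x
  proof (cases "x < l'")
    case True
    then show ?thesis by (simp add: B)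
  next
    case False
    with that have "x > r'" by auto
    then have "?B x = integral\<^sup>L lborel f"
      by (intro Bochner_Integration.integral_cong) (auto simp: indicator_def *(3))
    then show ?thesis using assms by simp
  qed
  show "smooth_bump_on l r ?B" by (rule smooth_bump_onI[OF smB *(1,2) B0])
qed

section \<open>Tensor products of bumps as test functions in the plane\<close>

lemma has_derivative_compose_fst_snd:
  assumes "(b has_real_derivative b') (at (fst p))" "(k has_real_derivative k') (at (snd p))"
  shows "((\<lambda>p. b (fst p)) has_derivative (\<lambda>h. b' * fst h)) (at p)"
    "((\<lambda>p. k (snd p)) has_derivative (\<lambda>h. k' * snd h)) (at p)"
  using has_derivative_compose[OF has_derivative_fst[OF has_derivative_ident] assms(1)[unfolded has_field_derivative_def]]
    has_derivative_compose[OF has_derivative_snd[OF has_derivative_ident] assms(2)[unfolded has_field_derivative_def]]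
  by simp_all

text \<open>A partial derivative of a tensor product is a tensor product again, so the induction
  closes; \<open>smooth_upto\<close> mirrors the recursion of \<open>Ck\<close> for this
  purpose.\<close>

lemma Ck_tensor: "smooth_upto n b \<Longrightarrow> smooth_upto n k \<Longrightarrow> Ck n (\<lambda>p. b (fst p) * k (snd p))"
proof (induction n arbitrary: b k)
  case 0
  then show ?case
    by (auto intro!: continuous_on_mult continuous_on_compose2[of UNIV b UNIV fst]
        continuous_on_compose2[of UNIV k UNIV snd] continuous_intros)
next
  case (Suc n)
  then obtain b' k' where *: "smooth_upto n b'" "\<And>x. (b has_real_derivative b' x) (at x)"
     "smooth_upto n k'" "\<And>x. (k has_real_derivative k' x) (at x)"
    by auto
  have "Ck n (\<lambda>p. b' (fst p) * k (snd p))" "Ck n (\<lambda>p. b (fst p) * k' (snd p))"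
    using Suc * smooth_upto_SucD by blast+
  moreover have "((\<lambda>p. b (fst p) * k (snd p)) has_derivative
     (\<lambda>h. b' (fst p) * k (snd p) * fst h + b (fst p) * k' (snd p) * snd h)) (at p)" for p
    using has_derivative_mult[OF has_derivative_compose_fst_snd[OF *(2) *(4)]]
    by (simp add: algebra_simps)
  ultimately show ?case by auto
qed

lemma test_function_tensor:
  assumes "smooth_bump_on l1 r1 b" "smooth_bump_on l2 r2 k"
    and "{l1<..<r1} \<times> {l2<..<r2} \<subseteq> square d"
  shows "test_function d (\<lambda>p. b (fst p) * k (snd p))"
proof -
  obtain x1 y1 where b: "\<And>n. smooth_upto n b" "l1 < x1" "y1 < r1" "\<And>x. x \<notin> {x1..y1} \<Longrightarrow> b x = 0"
    using assms(1) by (elim smooth_bump_onE) (rule that; assumption)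
  obtain x2 y2 where k: "\<And>n. smooth_upto n k" "l2 < x2" "y2 < r2" "\<And>x. x \<notin> {x2..y2} \<Longrightarrow> k x = 0"
    using assms(2) by (elim smooth_bump_onE) (rule that; assumption)
  have "compact ({x1..y1} \<times> {x2..y2})" by (intro compact_Times compact_Icc)
  moreover have "{x1..y1} \<times> {x2..y2} \<subseteq> square d"
    by (rule order_trans[OF _ assms(3)]) (use b k in auto)
  moreover have "\<forall>p. p \<notin> {x1..y1} \<times> {x2..y2} \<longrightarrow> b (fst p) * k (snd p) = 0"
    using b k by (auto simp: mem_Times_iff)
  moreover have "\<forall>n. Ck n (\<lambda>p. b (fst p) * k (snd p))"
    using b(1) k(1) Ck_tensor by blast
  ultimately show ?thesis unfolding test_function_def by blast
qed

lemma frechet_derivative_tensor: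
  assumes "\<And>x. (b has_real_derivative b' x) (at x)" "\<And>x. (k has_real_derivative k' x) (at x)"
  shows "frechet_derivative (\<lambda>p. b (fst p) * k (snd p)) (at p) h
       = b' (fst p) * k (snd p) * fst h + b (fst p) * k' (snd p) * snd h"
  using frechet_derivative_at[OF has_derivative_mult[OF has_derivative_compose_fst_snd[OF assms]], of p, symmetric]
  by (simp add: algebra_simps)

subsection \<open>The fundamental lemma of the calculus of variations on rectangles\<close>

text \<open>A Dynkin argument: boxes form an intersection-stable generator of the Borel sets, so the
  integral vanishes over every Borel set, and then \<open>u\<close> and 0 are equal as
  densities.\<close>

lemma AE_zero_if_box_integrals_zero:
  fixes u :: "'a::euclidean_space \<Rightarrow> 'b::{banach, second_countable_topology}"
  assumes u: "integrable lborel u" and box: "\<And>a b. (LINT x:box a b|lborel. u x) = 0"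
  shows "AE x in lborel. u x = 0"
proof -
  have si: "set_integrable lborel A u" if "A \<in> sets borel" for A
    using that u unfolding set_integrable_def by (intro integrable_mult_indicator) auto
  \<comment> \<open>The complement step of the Dynkin induction needs the integral over the whole
    space, obtained as a limit over growing boxes.\<close>
  have U: "integral\<^sup>L lborel u = 0"
  proof -
    let ?B = "\<lambda>n. box (- real n *\<^sub>R (One::'a)) (real n *\<^sub>R One)"
    have "(\<lambda>n. LINT x:?B n|lborel. u x) \<longlonglongrightarrow> (LINT x|lborel. u x)"
      unfolding set_lebesgue_integral_def
    proof (rule integral_dominated_convergence[where w="\<lambda>x. norm (u x)"])
      show "AE x in lborel. (\<lambda>n. indicat_real (?B n) x *\<^sub>R u x) \<longlonglongrightarrow> u x"
      proof (intro AE_I2 tendsto_eventually)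
        fix x :: 'a
        obtain N where N: "x \<in> ?B N" using UN_box_eq_UNIV[where 'a='a] by auto
        have "x \<in> ?B n" if "n \<ge> N" for n
        proof -
          have "?B N \<subseteq> ?B n"
            using that by (intro subset_box_imp) auto
          then show ?thesis using N by blast
        qed
        then show "\<forall>\<^sub>F n in sequentially. indicat_real (?B n) x *\<^sub>R u x = u x"
          by (intro eventually_sequentiallyI[of N]) auto
      qed
    qed (use u in \<open>auto simp: indicator_def\<close>)
    then show ?thesis using box by (simp add: LIMSEQ_const_iff)
  qed
  have zero: "(LINT x:A|lborel. u x) = 0" if "A \<in> sets borel" for A
  proof -
    let ?G = "range (\<lambda>(a, b). box a b :: 'a set)"
    have sets: "sigma_sets UNIV ?G = sets borel"
      by (subst borel_eq_box) (simp add: sets_measure_of)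
    have "Int_stable ?G"
      by (auto simp: Int_stable_def Int_interval) (auto simp: box_Int_box)
    moreover have "?G \<subseteq> Pow UNIV" by simp
    moreover have "A \<in> sigma_sets UNIV ?G" using that sets by simp
    ultimately show ?thesis
    proof (induction rule: sigma_sets_induct_disjoint)
      case (compl A)
      then have "A \<in> sets borel" using sets by simp
      then have "(LINT x:UNIV|lborel. u x) = (LINT x:A|lborel. u x) + (LINT x:UNIV - A|lborel. u x)"
        using si by (subst set_integral_Un[symmetric]) (auto intro!: arg_cong2[of _ _ _ _ "set_lebesgue_integral lborel"])
      with compl U show ?case by (simp add: set_lebesgue_integral_def)
    next
      case (union A)
      then have *: "A i \<in> sets lborel" for i using sets by auto
      have "(LINT x:(\<Union>(range A))|lborel. u x) = (\<Sum>i. (LINT x:A i|lborel. u x))"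
        using union * by (intro lebesgue_integral_countable_add si) (auto simp: disjoint_family_on_def)
      with union show ?case by simp
    qed (use box in \<open>auto simp: set_lebesgue_integral_def\<close>)
  qed
  show ?thesis
    by (rule sigma_finite_measure.density_unique_banach[OF lborel.sigma_finite_measure_axioms, of u "\<lambda>_. 0"]) (use u zero in \<open>auto simp: set_lebesgue_integral_def\<close>)
qed

section \<open>Measurability, integrability and null sets in the plane\<close>

lemma borel_measurable_fst_snd [measurable]:
  "(fst :: real \<times> real \<Rightarrow> real) \<in> borel_measurable borel"
  "(snd :: real \<times> real \<Rightarrow> real) \<in> borel_measurable borel"
  by (intro borel_measurable_continuous_onI continuous_intros)+

lemma integrable_tensor:
  fixes f g :: "real \<Rightarrow> 'a::{real_normed_algebra, banach, second_countable_topology}"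
  assumes "integrable lborel f" "integrable lborel g"
  shows "integrable lborel (\<lambda>p. f (fst p) * g (snd p))"
proof -
  have [measurable]: "f \<in> borel_measurable borel" "g \<in> borel_measurable borel"
    using assms by auto
  have "integrable (lborel \<Otimes>\<^sub>M lborel) (\<lambda>p. norm (f (fst p)) * norm (g (snd p)))"
    using assms by (intro lborel_pair.Fubini_integrable) auto
  then show ?thesis unfolding lborel_prod
    by (rule Bochner_Integration.integrable_bound) (auto simp: norm_mult_ineq)
qed

lemma integrable_prod_bound:
  fixes f :: "real \<times> real \<Rightarrow> complex"
  assumes "integrable lborel r" "integrable lborel s" "f \<in> borel_measurable borel"
    and "\<And>x y. norm (f (x, y)) \<le> r x * s y"
  shows "integrable lborel f"
proof (rule Bochner_Integration.integrable_bound[OF integrable_tensor[OF assms(1,2)]])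
  show "AE p in lborel. norm (f p) \<le> norm (r (fst p) * s (snd p) :: real)"
    using assms(4) by (intro AE_I2) (metis abs_ge_self order_trans prod.collapse real_norm_def)
qed (use assms(3) in simp)

lemma integral_bound_norm:
  fixes F :: "real \<Rightarrow> complex"
  assumes "integrable lborel G" "F \<in> borel_measurable borel" "\<And>t. norm (F t) \<le> G t"
  shows "norm (integral\<^sup>L lborel F) \<le> integral\<^sup>L lborel G"
proof -
  have "integrable lborel F"
    by (rule Bochner_Integration.integrable_bound[OF assms(1)])
      (use assms in \<open>auto intro!: AE_I2 order_trans[OF _ abs_ge_self]\<close>)
  then have "norm (integral\<^sup>L lborel F) \<le> (\<integral>t. norm (F t) \<partial>lborel)" by simp
  also have "\<dots> \<le> integral\<^sup>L lborel G"
    using \<open>integrable lborel F\<close> assms by (intro integral_mono) auto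
  finally show ?thesis .
qed

lemma integrable_indicator_Ioo: "integrable lborel (indicat_real {c<..<d::real})"
  using emeasure_bounded_finite[of "{c<..<d}"] by (intro integrable_real_indicator) auto

lemma AE_lborel_snd:
  assumes "AE y in lborel. P y"
  shows "AE p in lborel. P (snd p :: real)"
proof -
  obtain N where N: "N \<in> null_sets lborel" "{y. \<not> P y} \<subseteq> N"
    using assms by (auto elim!: AE_E simp: null_sets_def)
  have "UNIV \<times> N \<in> null_sets (lborel \<Otimes>\<^sub>M lborel)"
    using N by (intro lborel.times_in_null_sets2) auto
  then show ?thesis unfolding lborel_prod
    by (rule AE_I') (use N in auto)
qed

lemma AE_lborel_fst:
  assumes "AE x in lborel. P x"
  shows "AE p in lborel. P (fst p :: real)"
proof -
  obtain N where N: "N \<in> null_sets lborel" "{x. \<not> P x} \<subseteq> N"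
    using assms by (auto elim!: AE_E simp: null_sets_def)
  have "N \<times> UNIV \<in> null_sets (lborel \<Otimes>\<^sub>M lborel)"
    using N by (intro lborel.times_in_null_sets1) auto
  then show ?thesis unfolding lborel_prod
    by (rule AE_I') (use N in auto)
qed

text \<open>Tensor products of bumps suffice as test functions: as their rate tends to 0 they
  converge, dominated by the indicator of a closed rectangle, to the indicator of an open one, and
  rectangles determine the function.\<close>

lemma fundamental_lemma_rectangle:
  fixes u :: "real \<times> real \<Rightarrow> complex"
  assumes [measurable]: "u \<in> borel_measurable borel"
    and int: "\<And>l1 r1 l2 r2. a1 < l1 \<Longrightarrow> r1 < b1 \<Longrightarrow> a2 < l2 \<Longrightarrow> r2 < b2 \<Longrightarrow>
       set_integrable lborel ({l1..r1} \<times> {l2..r2}) u"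
    and test: "\<And>b k. smooth_bump_on a1 b1 b \<Longrightarrow> smooth_bump_on a2 b2 k \<Longrightarrow>
       (LINT p|lborel. u p * of_real (b (fst p) * k (snd p))) = 0"
  shows "AE p in lborel. p \<in> {a1<..<b1} \<times> {a2<..<b2} \<longrightarrow> u p = 0"
proof -
  let ?R = "\<lambda>l1 r1 l2 r2. {l1<..<r1::real} \<times> {l2<..<r2::real}"
  have zero: "(LINT p:?R l1 r1 l2 r2|lborel. u p) = 0"
    if *: "a1 < l1" "r1 < b1" "a2 < l2" "r2 < b2" for l1 r1 l2 r2
  proof -
    let ?w = "\<lambda>p. norm (indicat_real ({l1..r1} \<times> {l2..r2}) p *\<^sub>R u p)"
    let ?s = "\<lambda>n p. u p * of_real (bump (1 / Suc n) l1 r1 (fst p) * bump (1 / Suc n) l2 r2 (snd p))"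
    have sb: "smooth_bump_on a1 b1 (bump (1 / Suc n) l1 r1)" "smooth_bump_on a2 b2 (bump (1 / Suc n) l2 r2)" for n
      using * by (auto intro!: bump_smooth)
    note [measurable] = sb[THEN smooth_bump_on_measurable]
    have "(\<lambda>n. LINT p|lborel. ?s n p) \<longlonglongrightarrow> (LINT p|lborel. indicat_real (?R l1 r1 l2 r2) p *\<^sub>R u p)"
    proof (rule integral_dominated_convergence[where w="?w"])
      show "AE p in lborel. (\<lambda>n. ?s n p) \<longlonglongrightarrow> indicat_real (?R l1 r1 l2 r2) p *\<^sub>R u p"
      proof (rule AE_I2)
        fix p :: "real \<times> real"
        have "(\<lambda>n. ?s n p) \<longlonglongrightarrow> u p * of_real (indicator {l1<..<r1} (fst p) * indicator {l2<..<r2} (snd p))"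
          by (intro tendsto_intros bump_tendsto_indicator)
        moreover have "u p * of_real (indicator {l1<..<r1} (fst p) * indicator {l2<..<r2} (snd p)) =
           indicat_real (?R l1 r1 l2 r2) p *\<^sub>R u p"
          by (cases p) (auto simp: indicator_def)
        ultimately show "(\<lambda>n. ?s n p) \<longlonglongrightarrow> indicat_real (?R l1 r1 l2 r2) p *\<^sub>R u p" by simp
      qed
      show "integrable lborel ?w" using int[OF *] unfolding set_integrable_def by (rule integrable_norm)
      show "AE p in lborel. norm (?s n p) \<le> ?w p" for n
      proof (rule AE_I2)
        fix p :: "real \<times> real"
        have "\<bar>bump (1 / Suc n) l1 r1 (fst p) * bump (1 / Suc n) l2 r2 (snd p)\<bar> \<le> indicat_real ({l1..r1} \<times> {l2..r2}) p"
        proof (cases "p \<in> {l1..r1} \<times> {l2..r2}")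
          case True
          then show ?thesis
            using mult_le_one[OF bump_le_1 bump_nonneg bump_le_1, of "1 / Suc n" "1 / Suc n" l1 r1 "fst p" l2 r2 "snd p"]
            by (simp add: abs_of_nonneg bump_nonneg)
        next
          case False
          then show ?thesis by (cases p) (auto simp: bump_def flat_exp_def)
        qed
        then show "norm (?s n p) \<le> ?w p"
          by (simp add: norm_mult mult.commute mult_left_mono del: of_real_mult)
      qed
      have "indicat_real (?R l1 r1 l2 r2) \<in> borel_measurable lborel"
        by (intro borel_measurable_indicator) (simp add: borel_Times)
      then show "(\<lambda>p. indicat_real (?R l1 r1 l2 r2) p *\<^sub>R u p) \<in> borel_measurable lborel"
        by measurable
      show "?s n \<in> borel_measurable lborel" for n by measurable
    qed
    moreover have "(LINT p|lborel. ?s n p) = 0" for n by (rule test[OF sb])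
    ultimately show ?thesis unfolding set_lebesgue_integral_def by (simp add: LIMSEQ_const_iff)
  qed
  \<comment> \<open>Integrability holds only on closed rectangles strictly inside, so the rectangle
    is exhausted by slightly smaller ones.\<close>
  define \<epsilon> where "\<epsilon> n = 1 / real (Suc n)" for n
  let ?B = "\<lambda>n. ?R (a1 + \<epsilon> n) (b1 - \<epsilon> n) (a2 + \<epsilon> n) (b2 - \<epsilon> n)"
  have \<epsilon>: "\<epsilon> n > 0" for n by (simp add: \<epsilon>_def)
  have "AE p in lborel. indicat_real (?B n) p *\<^sub>R u p = 0" for n
  proof (rule AE_zero_if_box_integrals_zero)
    have "set_integrable lborel (?B n) u"
      by (rule set_integrable_subset[OF int[of "a1 + \<epsilon> n" "b1 - \<epsilon> n" "a2 + \<epsilon> n" "b2 - \<epsilon> n"]])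
        (use \<epsilon>[of n] in \<open>auto intro!: borel_Times\<close>)
    then show "integrable lborel (\<lambda>p. indicat_real (?B n) p *\<^sub>R u p)"
      unfolding set_integrable_def .
    fix a b :: "real \<times> real"
    \<comment> \<open>A box meets the smaller rectangle in an open rectangle, possibly empty, that
      still lies strictly inside the large one.\<close>
    let ?l1 = "max (fst a) (a1 + \<epsilon> n)" and ?r1 = "min (fst b) (b1 - \<epsilon> n)"
    let ?l2 = "max (snd a) (a2 + \<epsilon> n)" and ?r2 = "min (snd b) (b2 - \<epsilon> n)"
    have "(LINT p:box a b|lborel. indicat_real (?B n) p *\<^sub>R u p) = (LINT p:?R ?l1 ?r1 ?l2 ?r2|lborel. u p)"
      unfolding set_lebesgue_integral_def
      by (intro Bochner_Integration.integral_cong)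
        (auto simp: indicator_def box_prod box_real split: prod.splits)
    also have "\<dots> = 0" by (rule zero) (use \<epsilon>[of n] in auto)
    finally show "(LINT p:box a b|lborel. indicat_real (?B n) p *\<^sub>R u p) = 0" .
  qed
  then have "AE p in lborel. \<forall>n. indicat_real (?B n) p *\<^sub>R u p = 0" by (rule AE_all_countable[THEN iffD2, rule_format])
  then show ?thesis
  proof eventually_elim
    case (elim p)
    show ?case
    proof
      assume p: "p \<in> ?R a1 b1 a2 b2"
      define m where "m = min (min (fst p - a1) (b1 - fst p)) (min (snd p - a2) (b2 - snd p))"
      have "m > 0" using p by (auto simp: m_def)
      then obtain n where "\<epsilon> n < m" unfolding \<epsilon>_def using nat_approx_posE by metis
      then have "p \<in> ?B n" by (cases p) (auto simp: m_def)
      with elim show "u p = 0" by (auto dest!: spec[of _ n])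
    qed
  qed
qed

subsection \<open>The Poincare inequality on a small square\<close>

text \<open>If \<open>f\<close> is not integrable, the left side is 0 by the default value of the
  Bochner integral.\<close>

lemma norm_integral_le_nn_integral:
  fixes f :: "'a \<Rightarrow> 'b::{banach, second_countable_topology}"
  shows "ennreal (norm (integral\<^sup>L M f)) \<le> (\<integral>\<^sup>+x. ennreal (norm (f x)) \<partial>M)"
  by (cases "integrable M f") (auto intro: integral_norm_bound_ennreal simp: not_integrable_integral_eq)

lemma Cauchy_Schwarz_indicator:
  fixes f :: "real \<Rightarrow> ennreal"
  assumes [measurable]: "f \<in> borel_measurable borel"
    and "\<And>t. t \<notin> {a<..<a+h} \<Longrightarrow> f t = 0" "h > 0"
  shows "(\<integral>\<^sup>+t. f t \<partial>lborel)\<^sup>2 \<le> ennreal h * (\<integral>\<^sup>+t. (f t)\<^sup>2 \<partial>lborel)"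
proof -
  have "(\<integral>\<^sup>+t. f t \<partial>lborel) = (\<integral>\<^sup>+t. indicator {a<..<a+h} t * f t \<partial>lborel)"
    using assms(2) by (intro nn_integral_cong) (auto simp: indicator_def)
  also have "\<dots>\<^sup>2 \<le> (\<integral>\<^sup>+t. (indicator {a<..<a+h} t)\<^sup>2 \<partial>lborel) * (\<integral>\<^sup>+t. (f t)\<^sup>2 \<partial>lborel)"
    by (rule Cauchy_Schwarz_nn_integral) auto
  also have "(\<integral>\<^sup>+t. (indicator {a<..<a+h} t)\<^sup>2 \<partial>lborel) = (\<integral>\<^sup>+t. indicator {a<..<a+h} t \<partial>lborel)"
    by (intro nn_integral_cong) (auto simp: indicator_def)
  finally show ?thesis using assms(3) by simp
qed

lemma ennreal_norm_square: "(ennreal (norm x))\<^sup>2 = ennreal ((norm x)\<^sup>2)"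
  by (simp add: ennreal_power)

text \<open>Integrating the partial derivatives of a function against this kernel, which is bounded by one
  when \<open>\<rho>\<close> has mass one, recovers the function up to its \<open>\<rho>\<close>-weighted mean.\<close>

definition kern :: "(real \<Rightarrow> real) \<Rightarrow> real \<Rightarrow> real \<Rightarrow> real" where
  "kern \<rho> s t = (if s < t then 1 else 0) - (\<integral>r. \<rho> r * indicator {r. r < t} r \<partial>lborel)"

text \<open>A bump of mass one on an interval of length \<open>h\<close> has height of order 1 / h.
  Writing the bound as \<open>M / h\<close> isolates a scale-free \<open>M\<close>, which can be
  shared by all cells.\<close>

locale cell_bump =
  fixes a h M :: real and \<rho> :: "real \<Rightarrow> real"
  assumes h: "h > 0" and \<rho>: "smooth_bump_on a (a + h) \<rho>" and \<rho>_nonneg: "\<rho> x \<ge> 0"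
    and mass: "integral\<^sup>L lborel \<rho> = 1" and bound: "\<rho> x \<le> M / h"
begin

lemma \<rho>_measurable [measurable]: "\<rho> \<in> borel_measurable borel"
  using \<rho> by (rule smooth_bump_on_measurable)

lemma \<rho>_integrable: "integrable lborel \<rho>"
  using \<rho> by (rule smooth_bump_on_integrable)

lemma kern_measurable [measurable]:
  "(\<lambda>p. kern \<rho> (fst p) (snd p)) \<in> borel_measurable borel"
  "kern \<rho> s \<in> borel_measurable borel"
  "(\<lambda>s. kern \<rho> s t) \<in> borel_measurable borel"
proof -
  have "(\<lambda>t. \<integral>r. \<rho> r * (if r < t then 1 else 0) \<partial>lborel) \<in> borel_measurable borel"
    by measurable
  then have [measurable]: "(\<lambda>t. \<integral>r. \<rho> r * indicator {r. r < t} r \<partial>lborel) \<in> borel_measurable borel"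
    by (simp add: indicator_def of_bool_def)
  show "(\<lambda>p. kern \<rho> (fst p) (snd p)) \<in> borel_measurable borel" "kern \<rho> s \<in> borel_measurable borel"
    "(\<lambda>s. kern \<rho> s t) \<in> borel_measurable borel"
    unfolding kern_def[abs_def] by measurable
qed

text \<open>Both terms of \<open>kern\<close> lie in [0, 1]: the second is a partial integral of a
  nonnegative function of mass one.\<close>

lemma kern_le_1: "\<bar>kern \<rho> s t\<bar> \<le> 1"
proof -
  have i: "integrable lborel (\<lambda>r. \<rho> r * indicator {r. r < t} r)"
    by (intro integrable_real_mult_indicator \<rho>_integrable) auto
  have "(\<integral>r. \<rho> r * indicator {r. r < t} r \<partial>lborel) \<le> (\<integral>r. \<rho> r \<partial>lborel)"
    by (intro integral_mono i \<rho>_integrable) (auto simp: indicator_def \<rho>_nonneg)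
  moreover have "(\<integral>r. \<rho> r * indicator {r. r < t} r \<partial>lborel) \<ge> 0"
    by (intro integral_nonneg_AE) (auto simp: \<rho>_nonneg)
  ultimately show ?thesis using mass by (auto simp: kern_def)
qed

text \<open>Subtracting the right multiple of the weight leaves mass zero, so the antiderivative is
  again a bump. Written with \<open>kern\<close> it depends on \<open>b\<close> through a plain
  integral, which Fubini can later move onto the derivative of \<open>u\<close>.\<close>

lemma centred_antiderivative:
  assumes b: "smooth_bump_on a (a + h) b"
  defines "f \<equiv> \<lambda>x. b x - integral\<^sup>L lborel b * \<rho> x" and "B \<equiv> \<lambda>t. \<integral>s. b s * kern \<rho> s t \<partial>lborel"
  shows "smooth_bump_on a (a + h) B" and "(B has_real_derivative f x) (at x)"
proof -
  have ib: "integrable lborel b" using b by (rule smooth_bump_on_integrable)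
  have f: "smooth_bump_on a (a + h) f"
    using smooth_bump_on_affine_comb[OF b \<rho>, of 1 "- integral\<^sup>L lborel b"] by (simp add: f_def)
  have f0: "integral\<^sup>L lborel f = 0"
    unfolding f_def using ib \<rho>_integrable mass by simp
  have "B t = (\<integral>s. f s * indicator {s. s < t} s \<partial>lborel)" for t
  proof -
    let ?R = "\<integral>r. \<rho> r * indicator {r. r < t} r \<partial>lborel"
    have i: "integrable lborel (\<lambda>s. b s * indicator {s. s < t} s)"
      "integrable lborel (\<lambda>s. \<rho> s * indicator {s. s < t} s)"
      by (intro integrable_real_mult_indicator ib \<rho>_integrable; simp)+
    have "B t = (\<integral>s. b s * indicator {s. s < t} s - b s * ?R \<partial>lborel)"
      unfolding B_def kern_def
      by (intro Bochner_Integration.integral_cong) (auto simp: algebra_simps indicator_def)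
    also have "\<dots> = (\<integral>s. b s * indicator {s. s < t} s \<partial>lborel) - integral\<^sup>L lborel b * ?R"
      using i ib by simp
    also have "\<dots> = (\<integral>s. b s * indicator {s. s < t} s - integral\<^sup>L lborel b * (\<rho> s * indicator {s. s < t} s) \<partial>lborel)"
      using i by simp
    also have "\<dots> = (\<integral>s. f s * indicator {s. s < t} s \<partial>lborel)"
      unfolding f_def by (intro Bochner_Integration.integral_cong) (auto simp: algebra_simps)
    finally show ?thesis .
  qed
  then have B: "B = (\<lambda>t. \<integral>s. f s * indicator {s. s < t} s \<partial>lborel)" by (rule ext)
  show "smooth_bump_on a (a + h) B" and "(B has_real_derivative f x) (at x)"
    unfolding B using smooth_bump_on_antiderivative[OF f f0] by blast+
qed

end

text \<open>Here \<open>u\<close> is a function cut off to one cell and \<open>g\<^sub>1\<close>,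
  \<open>g\<^sub>2\<close> are its cut-off weak partial derivatives. The weak identities are
  demanded only for bumps supported inside the cell, so the jump of \<open>u\<close> across the
  boundary does not enter.\<close>

locale poincare_cell =
  X: cell_bump a\<^sub>1 h M \<rho>\<^sub>1 + Y: cell_bump a\<^sub>2 h M \<rho>\<^sub>2 for a\<^sub>1 a\<^sub>2 h M \<rho>\<^sub>1 \<rho>\<^sub>2 +
  fixes u g\<^sub>1 g\<^sub>2 :: "real \<times> real \<Rightarrow> complex"
  assumes int: "integrable lborel u" "integrable lborel g\<^sub>1" "integrable lborel g\<^sub>2"
    and outside: "\<And>x y. \<not> (a\<^sub>1 < x \<and> x < a\<^sub>1 + h \<and> a\<^sub>2 < y \<and> y < a\<^sub>2 + h) \<Longrightarrow>
       u (x, y) = 0 \<and> g\<^sub>1 (x, y) = 0 \<and> g\<^sub>2 (x, y) = 0"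
    and weak1: "\<And>b b' k. smooth_bump_on a\<^sub>1 (a\<^sub>1 + h) b \<Longrightarrow> (\<And>x. (b has_real_derivative b' x) (at x)) \<Longrightarrow>
       smooth_bump_on a\<^sub>2 (a\<^sub>2 + h) k \<Longrightarrow>
       (\<integral>p. u p * of_real (b' (fst p) * k (snd p)) \<partial>lborel) = - (\<integral>p. g\<^sub>1 p * of_real (b (fst p) * k (snd p)) \<partial>lborel)"
    and weak2: "\<And>b k k'. smooth_bump_on a\<^sub>1 (a\<^sub>1 + h) b \<Longrightarrow> smooth_bump_on a\<^sub>2 (a\<^sub>2 + h) k \<Longrightarrow>
       (\<And>y. (k has_real_derivative k' y) (at y)) \<Longrightarrow>
       (\<integral>p. u p * of_real (b (fst p) * k' (snd p)) \<partial>lborel) = - (\<integral>p. g\<^sub>2 p * of_real (b (fst p) * k (snd p)) \<partial>lborel)"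
    and mean: "(\<integral>p. u p * of_real (\<rho>\<^sub>1 (fst p) * \<rho>\<^sub>2 (snd p)) \<partial>lborel) = 0"
begin

lemma measurable_u_g [measurable]:
  "u \<in> borel_measurable borel" "g\<^sub>1 \<in> borel_measurable borel" "g\<^sub>2 \<in> borel_measurable borel"
  using int by auto

lemma integrable_times_tensor:
  assumes "integrable lborel f" "smooth_bump_on l r b" "smooth_bump_on l' r' k"
  shows "integrable lborel (\<lambda>p::real \<times> real. (f p :: complex) * of_real (b (fst p) * k (snd p)))"
proof -
  note [measurable] = smooth_bump_on_measurable[OF assms(2)] smooth_bump_on_measurable[OF assms(3)]
  have [measurable]: "f \<in> borel_measurable borel" using assms(1) by auto
  obtain Mb where Mb: "\<And>x. \<bar>b x\<bar> \<le> Mb" "Mb \<ge> 0" by (rule smooth_bump_on_bound[OF assms(2)]) (rule that; assumption)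
  obtain Mk where Mk: "\<And>x. \<bar>k x\<bar> \<le> Mk" "Mk \<ge> 0" by (rule smooth_bump_on_bound[OF assms(3)]) (rule that; assumption)
  have "integrable lborel (\<lambda>p. (Mb * Mk) * norm (f p))" using assms(1) by auto
  then show ?thesis
  proof (rule Bochner_Integration.integrable_bound)
    show "AE p in lborel. norm (f p * of_real (b (fst p) * k (snd p))) \<le> norm ((Mb * Mk) * norm (f p))"
    proof (rule AE_I2)
      fix p
      have "\<bar>b (fst p) * k (snd p)\<bar> \<le> Mb * Mk"
        unfolding abs_mult by (intro mult_mono Mb Mk) auto
      from mult_left_mono[OF this, of "norm (f p)"]
      show "norm (f p * of_real (b (fst p) * k (snd p))) \<le> norm ((Mb * Mk) * norm (f p))"
        using Mb(2) Mk(2) by (simp add: norm_mult abs_mult mult_ac)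
    qed
  qed measurable
qed

text \<open>For smooth \<open>u\<close>, integration by parts identifies \<open>W1\<close> as
  \<open>u\<close> minus its weighted mean in the first variable. That mean, a function of the
  second variable alone, has derivative \<open>m2\<close>, and \<open>W2\<close> recovers it in the
  same way because its own weighted mean is zero.\<close>

definition W1 :: "real \<Rightarrow> real \<Rightarrow> complex" where
  "W1 x y = - (\<integral>t. g\<^sub>1 (t, y) * of_real (kern \<rho>\<^sub>1 x t) \<partial>lborel)"

definition m2 :: "real \<Rightarrow> complex" where
  "m2 s = (\<integral>t. g\<^sub>2 (t, s) * of_real (\<rho>\<^sub>1 t) \<partial>lborel)"

definition W2 :: "real \<Rightarrow> complex" where
  "W2 y = - (\<integral>s. m2 s * of_real (kern \<rho>\<^sub>2 y s) \<partial>lborel)"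

text \<open>The product b k equals \<open>?f1\<close> k + \<open>?\<beta>\<close> \<rho>1
  \<open>?f2\<close> + \<open>?\<beta>\<close> \<open>?\<kappa>\<close> \<rho>1 \<rho>2. The first
  two summands are partial derivatives of test functions, and \<open>mean\<close> removes the
  third.\<close>

lemma weak_formula:
  assumes b: "smooth_bump_on a\<^sub>1 (a\<^sub>1 + h) b" and k: "smooth_bump_on a\<^sub>2 (a\<^sub>2 + h) k"
  defines "B \<equiv> \<lambda>t. \<integral>s. b s * kern \<rho>\<^sub>1 s t \<partial>lborel" and "C \<equiv> \<lambda>t. \<integral>s. k s * kern \<rho>\<^sub>2 s t \<partial>lborel"
  shows "(\<integral>p. u p * of_real (b (fst p) * k (snd p)) \<partial>lborel) =
    - (\<integral>p. g\<^sub>1 p * of_real (B (fst p) * k (snd p)) \<partial>lborel)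
    - of_real (integral\<^sup>L lborel b) * (\<integral>p. g\<^sub>2 p * of_real (\<rho>\<^sub>1 (fst p) * C (snd p)) \<partial>lborel)"
proof -
  let ?\<beta> = "integral\<^sup>L lborel b" and ?\<kappa> = "integral\<^sup>L lborel k"
  let ?f1 = "\<lambda>x. b x - ?\<beta> * \<rho>\<^sub>1 x" and ?f2 = "\<lambda>x. k x - ?\<kappa> * \<rho>\<^sub>2 x"
  have f1: "smooth_bump_on a\<^sub>1 (a\<^sub>1 + h) ?f1"
    using smooth_bump_on_affine_comb[OF b X.\<rho>, of 1 "- ?\<beta>"] by simp
  have f2: "smooth_bump_on a\<^sub>2 (a\<^sub>2 + h) ?f2"
    using smooth_bump_on_affine_comb[OF k Y.\<rho>, of 1 "- ?\<kappa>"] by simp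
  note i = integrable_times_tensor[OF int(1) f1 k] integrable_times_tensor[OF int(1) X.\<rho> f2]
    integrable_times_tensor[OF int(1) X.\<rho> Y.\<rho>]
  have "(\<integral>p. u p * of_real (b (fst p) * k (snd p)) \<partial>lborel) =
     (\<integral>p. u p * of_real (?f1 (fst p) * k (snd p)) + (of_real ?\<beta> * (u p * of_real (\<rho>\<^sub>1 (fst p) * ?f2 (snd p)))
       + of_real (?\<beta> * ?\<kappa>) * (u p * of_real (\<rho>\<^sub>1 (fst p) * \<rho>\<^sub>2 (snd p)))) \<partial>lborel)"
    by (intro Bochner_Integration.integral_cong) (auto simp: algebra_simps)
  also have "\<dots> = (\<integral>p. u p * of_real (?f1 (fst p) * k (snd p)) \<partial>lborel) +
      (of_real ?\<beta> * (\<integral>p. u p * of_real (\<rho>\<^sub>1 (fst p) * ?f2 (snd p)) \<partial>lborel)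
       + of_real (?\<beta> * ?\<kappa>) * (\<integral>p. u p * of_real (\<rho>\<^sub>1 (fst p) * \<rho>\<^sub>2 (snd p)) \<partial>lborel))"
    by (subst Bochner_Integration.integral_add, (intro i Bochner_Integration.integrable_add integrable_mult_right)+,
        subst Bochner_Integration.integral_add, (intro i integrable_mult_right)+, simp)
  also have "(\<integral>p. u p * of_real (?f1 (fst p) * k (snd p)) \<partial>lborel) = - (\<integral>p. g\<^sub>1 p * of_real (B (fst p) * k (snd p)) \<partial>lborel)"
    unfolding B_def by (rule weak1[OF X.centred_antiderivative[OF b] k])
  also have "(\<integral>p. u p * of_real (\<rho>\<^sub>1 (fst p) * ?f2 (snd p)) \<partial>lborel) = - (\<integral>p. g\<^sub>2 p * of_real (\<rho>\<^sub>1 (fst p) * C (snd p)) \<partial>lborel)"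
    unfolding C_def by (rule weak2[OF X.\<rho> Y.centred_antiderivative[OF k]])
  finally show ?thesis using mean by simp
qed

lemma W1_measurable [measurable]: "(\<lambda>p. W1 (fst p) (snd p)) \<in> borel_measurable borel"
proof -
  have "(\<lambda>(p, t). g\<^sub>1 (t, snd p) * of_real (kern \<rho>\<^sub>1 (fst p) t)) \<in> borel_measurable ((borel \<Otimes>\<^sub>M borel) \<Otimes>\<^sub>M lborel)"
  proof -
    have "(\<lambda>q. g\<^sub>1 (snd q, snd (fst q)) * of_real ((\<lambda>p. kern \<rho>\<^sub>1 (fst p) (snd p)) (fst (fst q), snd q)))
       \<in> borel_measurable ((borel \<Otimes>\<^sub>M borel) \<Otimes>\<^sub>M lborel)"
      by measurable
    then show ?thesis by (simp add: case_prod_beta)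
  qed
  then have "(\<lambda>p. \<integral>t. g\<^sub>1 (t, snd p) * of_real (kern \<rho>\<^sub>1 (fst p) t) \<partial>lborel) \<in> borel_measurable (borel \<Otimes>\<^sub>M borel)"
    by measurable
  then show ?thesis unfolding W1_def borel_prod by measurable
qed

lemma m2_measurable [measurable]: "m2 \<in> borel_measurable borel"
  unfolding m2_def by measurable

lemma W2_measurable [measurable]: "W2 \<in> borel_measurable borel"
proof -
  have "(\<lambda>y. \<integral>s. m2 s * of_real ((\<lambda>p. kern \<rho>\<^sub>2 (fst p) (snd p)) (y, s)) \<partial>lborel) \<in> borel_measurable borel"
    by measurable
  then show ?thesis unfolding W2_def by simp
qed

end

section \<open>Reconstruction from the gradient on a cell, and the resulting bound\<close>

context poincare_cell
begin

lemma kern_norm_bound: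
  "norm (z * of_real (kern \<rho>\<^sub>1 x t) :: complex) \<le> norm z" "norm (z * of_real (kern \<rho>\<^sub>2 x t) :: complex) \<le> norm z"
  using mult_left_mono[OF X.kern_le_1, of "norm z" x t] mult_left_mono[OF Y.kern_le_1, of "norm z" x t]
  by (simp_all add: norm_mult)

lemma g_sections:
  "integrable lborel (\<lambda>y. \<integral>t. norm (g\<^sub>1 (t, y)) \<partial>lborel)"
  "AE y in lborel. integrable lborel (\<lambda>t. g\<^sub>1 (t, y))"
  using lborel_pair.integrable_snd[of "\<lambda>x y. norm (g\<^sub>1 (x, y))"]
    lborel_pair.AE_integrable_snd[of "\<lambda>x y. g\<^sub>1 (x, y)"]
    int integrable_norm[OF int(2)]
  by (simp_all add: lborel_prod case_prod_unfold)

abbreviation cell :: "(real \<times> real) set" where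
  "cell \<equiv> {a\<^sub>1<..<a\<^sub>1 + h} \<times> {a\<^sub>2<..<a\<^sub>2 + h}"

lemma cell_sets [measurable]: "cell \<in> sets borel"
  by (intro borel_Times) auto

lemma W1_bound:
  assumes "integrable lborel (\<lambda>t. g\<^sub>1 (t, y))"
  shows "norm (W1 x y) \<le> (\<integral>t. norm (g\<^sub>1 (t, y)) \<partial>lborel)"
  unfolding W1_def norm_minus_cancel using assms
  by (intro integral_bound_norm kern_norm_bound) (auto intro!: integrable_norm)

lemma integrable_W1: "integrable lborel (\<lambda>p. indicat_real cell p *\<^sub>R W1 (fst p) (snd p))"
proof (rule Bochner_Integration.integrable_bound)
  show "integrable lborel (\<lambda>p. indicat_real {a\<^sub>1<..<a\<^sub>1 + h} (fst p) * (\<integral>t. norm (g\<^sub>1 (t, snd p)) \<partial>lborel))"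
    by (rule integrable_tensor[OF integrable_indicator_Ioo g_sections(1)])
  show "AE p in lborel. norm (indicat_real cell p *\<^sub>R W1 (fst p) (snd p))
       \<le> norm (indicat_real {a\<^sub>1<..<a\<^sub>1 + h} (fst p) * (\<integral>t. norm (g\<^sub>1 (t, snd p)) \<partial>lborel))"
    using AE_lborel_snd[OF g_sections(2)]
  proof eventually_elim
    case (elim p)
    from W1_bound[OF this, of "fst p"] show ?case
      by (cases p) (auto simp: indicator_def intro: order_trans[OF _ abs_ge_self])
  qed
qed measurable

lemma integrable_m2: "integrable lborel m2"
proof -
  have "integrable lborel (\<lambda>p. g\<^sub>2 p * of_real (\<rho>\<^sub>1 (fst p)))"
  proof (rule Bochner_Integration.integrable_bound)
    show "integrable lborel (\<lambda>p. (M / h) * norm (g\<^sub>2 p))" using int by auto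
    show "AE p in lborel. norm (g\<^sub>2 p * of_real (\<rho>\<^sub>1 (fst p))) \<le> norm ((M / h) * norm (g\<^sub>2 p))"
    proof (rule AE_I2)
      fix p
      have "norm (g\<^sub>2 p * of_real (\<rho>\<^sub>1 (fst p))) = \<rho>\<^sub>1 (fst p) * norm (g\<^sub>2 p)"
        using X.\<rho>_nonneg[of "fst p"] by (simp add: norm_mult)
      also have "\<dots> \<le> (M / h) * norm (g\<^sub>2 p)" by (intro mult_right_mono X.bound) auto
      also have "\<dots> \<le> norm ((M / h) * norm (g\<^sub>2 p))" by (metis abs_ge_self real_norm_def)
      finally show "norm (g\<^sub>2 p * of_real (\<rho>\<^sub>1 (fst p))) \<le> norm ((M / h) * norm (g\<^sub>2 p))" .
    qed
  qed measurable
  then show ?thesis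
    using lborel_pair.integrable_snd[of "\<lambda>x y. g\<^sub>2 (x, y) * of_real (\<rho>\<^sub>1 x)"]
    unfolding m2_def[abs_def] by (simp add: lborel_prod case_prod_unfold)
qed

lemma W2_bound: "norm (W2 y) \<le> (\<integral>t. norm (m2 t) \<partial>lborel)"
  unfolding W2_def norm_minus_cancel
  by (intro integral_bound_norm kern_norm_bound) (auto intro!: integrable_norm integrable_m2)

lemma integrable_W2: "integrable lborel (\<lambda>p. indicat_real cell p *\<^sub>R W2 (snd p))"
proof (rule Bochner_Integration.integrable_bound)
  show "integrable lborel (\<lambda>p. (\<integral>t. norm (m2 t) \<partial>lborel) * (indicat_real {a\<^sub>1<..<a\<^sub>1 + h} (fst p) * indicat_real {a\<^sub>2<..<a\<^sub>2 + h} (snd p)))"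
    by (intro integrable_mult_right integrable_tensor integrable_indicator_Ioo)
  show "AE p in lborel. norm (indicat_real cell p *\<^sub>R W2 (snd p))
      \<le> norm ((\<integral>t. norm (m2 t) \<partial>lborel) * (indicat_real {a\<^sub>1<..<a\<^sub>1 + h} (fst p) * indicat_real {a\<^sub>2<..<a\<^sub>2 + h} (snd p)))"
    using W2_bound by (intro AE_I2) (auto simp: indicator_def intro: order_trans[OF _ abs_ge_self])
qed measurable

text \<open>For fixed y, exchanging the integrals over x and t lets b be integrated against
  \<open>kern\<close>, which produces \<open>B\<close>. The exchange needs an integrable section of
  \<open>g\<^sub>1\<close>, available for almost every y only, so the outer integrals are compared
  almost everywhere.\<close>

lemma test_W1:
  assumes b: "smooth_bump_on a\<^sub>1 (a\<^sub>1 + h) b" and k: "smooth_bump_on a\<^sub>2 (a\<^sub>2 + h) k"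
  defines "B \<equiv> \<lambda>t. \<integral>s. b s * kern \<rho>\<^sub>1 s t \<partial>lborel"
  shows "(\<integral>p. (indicat_real cell p *\<^sub>R W1 (fst p) (snd p)) * of_real (b (fst p) * k (snd p)) \<partial>lborel)
      = - (\<integral>p. g\<^sub>1 p * of_real (B (fst p) * k (snd p)) \<partial>lborel)"
proof -
  note [measurable] = smooth_bump_on_measurable[OF b] smooth_bump_on_measurable[OF k]
  note Bsm = X.centred_antiderivative(1)[OF b, folded B_def]
  let ?F = "\<lambda>p. (indicat_real cell p *\<^sub>R W1 (fst p) (snd p)) * of_real (b (fst p) * k (snd p))"
  have iF: "integrable lborel ?F" by (rule integrable_times_tensor[OF integrable_W1 b k])
  have iG: "integrable lborel (\<lambda>p. g\<^sub>1 p * of_real (B (fst p) * k (snd p)))"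
    by (rule integrable_times_tensor[OF int(2) Bsm k])
  have inner: "(\<integral>x. ?F (x, y) \<partial>lborel) = - (\<integral>t. g\<^sub>1 (t, y) * of_real (B t * k y) \<partial>lborel)"
    if y: "integrable lborel (\<lambda>t. g\<^sub>1 (t, y))" for y
  proof -
    have "?F (x, y) = of_real (b x * k y) * W1 x y" for x
      using smooth_bump_on_outside[OF b, of x] smooth_bump_on_outside[OF k, of y]
      by (auto simp: indicator_def)
    then have "(\<integral>x. ?F (x, y) \<partial>lborel) = of_real (k y) * (\<integral>x. of_real (b x) * W1 x y \<partial>lborel)"
      by (simp add: mult_ac flip: integral_mult_right_zero)
    also have "\<dots> = of_real (k y) * - (\<integral>x. \<integral>t. of_real (b x) * (g\<^sub>1 (t, y) * of_real (kern \<rho>\<^sub>1 x t)) \<partial>lborel \<partial>lborel)"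
      by (simp add: W1_def)
    also have "(\<integral>x. \<integral>t. of_real (b x) * (g\<^sub>1 (t, y) * of_real (kern \<rho>\<^sub>1 x t)) \<partial>lborel \<partial>lborel)
       = (\<integral>t. \<integral>x. of_real (b x) * (g\<^sub>1 (t, y) * of_real (kern \<rho>\<^sub>1 x t)) \<partial>lborel \<partial>lborel)"
    proof (rule lborel_pair.Fubini_integral[symmetric])
      have "integrable lborel (\<lambda>p. of_real (b (fst p)) * (g\<^sub>1 (snd p, y) * of_real (kern \<rho>\<^sub>1 (fst p) (snd p))))"
      proof (rule integrable_prod_bound)
        show "integrable lborel (\<lambda>x. \<bar>b x\<bar>)" using smooth_bump_on_integrable[OF b] by (rule integrable_abs)
        show "integrable lborel (\<lambda>t. norm (g\<^sub>1 (t, y)))" using y by (rule integrable_norm)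
        show "norm (complex_of_real (b (fst (x, t))) * (g\<^sub>1 (snd (x, t), y) * of_real (kern \<rho>\<^sub>1 (fst (x, t)) (snd (x, t))))) \<le> \<bar>b x\<bar> * norm (g\<^sub>1 (t, y))" for x t
          using mult_left_mono[OF kern_norm_bound(1)[of "g\<^sub>1 (t, y)" x t], of "\<bar>b x\<bar>"] by (simp add: norm_mult)
      qed measurable
      then show "integrable (lborel \<Otimes>\<^sub>M lborel) (\<lambda>(x, t). of_real (b x) * (g\<^sub>1 (t, y) * of_real (kern \<rho>\<^sub>1 x t)))"
        by (simp add: lborel_prod case_prod_unfold)
    qed
    also have "\<dots> = (\<integral>t. g\<^sub>1 (t, y) * of_real (B t) \<partial>lborel)"
    proof (rule Bochner_Integration.integral_cong[OF refl])
      fix t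
      have "(\<integral>x. of_real (b x) * (g\<^sub>1 (t, y) * of_real (kern \<rho>\<^sub>1 x t)) \<partial>lborel) = (\<integral>x. g\<^sub>1 (t, y) * of_real (b x * kern \<rho>\<^sub>1 x t) \<partial>lborel)"
        by (simp add: mult_ac)
      also have "\<dots> = g\<^sub>1 (t, y) * of_real (B t)"
        unfolding B_def by (simp del: of_real_mult)
      finally show "(\<integral>x. of_real (b x) * (g\<^sub>1 (t, y) * of_real (kern \<rho>\<^sub>1 x t)) \<partial>lborel) = g\<^sub>1 (t, y) * of_real (B t)" .
    qed
    also have "of_real (k y) * - (\<integral>t. g\<^sub>1 (t, y) * of_real (B t) \<partial>lborel) = - (\<integral>t. g\<^sub>1 (t, y) * of_real (B t * k y) \<partial>lborel)"
      by (simp add: mult_ac flip: integral_mult_right_zero)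
    finally show ?thesis .
  qed
  have "integral\<^sup>L lborel ?F = (\<integral>y. \<integral>x. ?F (x, y) \<partial>lborel \<partial>lborel)"
    using lborel_pair.integral_snd[of "\<lambda>x y. ?F (x, y)"] iF by (simp add: lborel_prod case_prod_unfold)
  also have "\<dots> = (\<integral>y. - (\<integral>t. g\<^sub>1 (t, y) * of_real (B t * k y) \<partial>lborel) \<partial>lborel)"
  proof (rule integral_cong_AE)
    note [measurable] = smooth_bump_on_measurable[OF Bsm]
    show "(\<lambda>y. \<integral>x. ?F (x, y) \<partial>lborel) \<in> borel_measurable lborel"
      using lborel_pair.integrable_snd[of "\<lambda>x y. ?F (x, y)"] iF
      by (intro borel_measurable_integrable) (simp add: lborel_prod case_prod_unfold)
    show "(\<lambda>y. - (\<integral>t. g\<^sub>1 (t, y) * of_real (B t * k y) \<partial>lborel)) \<in> borel_measurable lborel"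
      using lborel_pair.integrable_snd[of "\<lambda>x y. g\<^sub>1 (x, y) * of_real (B x * k y)"] iG
      by (intro borel_measurable_uminus borel_measurable_integrable) (simp add: lborel_prod case_prod_unfold)
    show "AE y in lborel. (\<integral>x. ?F (x, y) \<partial>lborel) = - (\<integral>t. g\<^sub>1 (t, y) * of_real (B t * k y) \<partial>lborel)"
      using g_sections(2) by eventually_elim (rule inner)
  qed
  also have "\<dots> = - (\<integral>p. g\<^sub>1 p * of_real (B (fst p) * k (snd p)) \<partial>lborel)"
    using lborel_pair.integral_snd[of "\<lambda>x y. g\<^sub>1 (x, y) * of_real (B x * k y)"] iG by (simp add: lborel_prod case_prod_unfold)
  finally show ?thesis .
qed

text \<open>The same exchange in the second variable. Since \<open>W2\<close> does not depend on x,
  the first factor contributes only its mass.\<close>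

lemma test_W2:
  assumes b: "smooth_bump_on a\<^sub>1 (a\<^sub>1 + h) b" and k: "smooth_bump_on a\<^sub>2 (a\<^sub>2 + h) k"
  defines "C \<equiv> \<lambda>t. \<integral>s. k s * kern \<rho>\<^sub>2 s t \<partial>lborel"
  shows "(\<integral>p. (indicat_real cell p *\<^sub>R W2 (snd p)) * of_real (b (fst p) * k (snd p)) \<partial>lborel)
      = - of_real (integral\<^sup>L lborel b) * (\<integral>p. g\<^sub>2 p * of_real (\<rho>\<^sub>1 (fst p) * C (snd p)) \<partial>lborel)"
proof -
  note [measurable] = smooth_bump_on_measurable[OF b] smooth_bump_on_measurable[OF k]
  note Csm = Y.centred_antiderivative(1)[OF k, folded C_def]
  let ?F = "\<lambda>p. (indicat_real cell p *\<^sub>R W2 (snd p)) * of_real (b (fst p) * k (snd p))"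
  have iF: "integrable lborel ?F" by (rule integrable_times_tensor[OF integrable_W2 b k])
  have iG: "integrable lborel (\<lambda>p. g\<^sub>2 p * of_real (\<rho>\<^sub>1 (fst p) * C (snd p)))"
    by (rule integrable_times_tensor[OF int(3) X.\<rho> Csm])
  have F: "?F (x, y) = of_real (b x) * (of_real (k y) * W2 y)" for x y
    using smooth_bump_on_outside[OF b, of x] smooth_bump_on_outside[OF k, of y]
    by (auto simp: indicator_def)
  have "(\<integral>y. of_real (k y) * W2 y \<partial>lborel) = - (\<integral>y. \<integral>s. of_real (k y) * (m2 s * of_real (kern \<rho>\<^sub>2 y s)) \<partial>lborel \<partial>lborel)"
    by (simp add: W2_def)
  also have "(\<integral>y. \<integral>s. of_real (k y) * (m2 s * of_real (kern \<rho>\<^sub>2 y s)) \<partial>lborel \<partial>lborel)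
       = (\<integral>s. \<integral>y. of_real (k y) * (m2 s * of_real (kern \<rho>\<^sub>2 y s)) \<partial>lborel \<partial>lborel)"
  proof (rule lborel_pair.Fubini_integral[symmetric])
    have "integrable lborel (\<lambda>p. of_real (k (fst p)) * (m2 (snd p) * of_real (kern \<rho>\<^sub>2 (fst p) (snd p))))"
    proof (rule integrable_prod_bound)
      show "integrable lborel (\<lambda>x. \<bar>k x\<bar>)" using smooth_bump_on_integrable[OF k] by (rule integrable_abs)
      show "integrable lborel (\<lambda>s. norm (m2 s))" using integrable_m2 by (rule integrable_norm)
      show "norm (complex_of_real (k (fst (x, t))) * (m2 (snd (x, t)) * of_real (kern \<rho>\<^sub>2 (fst (x, t)) (snd (x, t))))) \<le> \<bar>k x\<bar> * norm (m2 t)" for x t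
        using mult_left_mono[OF kern_norm_bound(2)[of "m2 t" x t], of "\<bar>k x\<bar>"] by (simp add: norm_mult)
    qed measurable
    then show "integrable (lborel \<Otimes>\<^sub>M lborel) (\<lambda>(y, s). of_real (k y) * (m2 s * of_real (kern \<rho>\<^sub>2 y s)))"
      by (simp add: lborel_prod case_prod_unfold)
  qed
  also have "\<dots> = (\<integral>s. m2 s * of_real (C s) \<partial>lborel)"
  proof (rule Bochner_Integration.integral_cong[OF refl])
    fix s
    have "(\<integral>y. of_real (k y) * (m2 s * of_real (kern \<rho>\<^sub>2 y s)) \<partial>lborel) = (\<integral>y. m2 s * of_real (k y * kern \<rho>\<^sub>2 y s) \<partial>lborel)"
      by (simp add: mult_ac)
    also have "\<dots> = m2 s * of_real (C s)"
      unfolding C_def by (simp del: of_real_mult)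
    finally show "(\<integral>y. of_real (k y) * (m2 s * of_real (kern \<rho>\<^sub>2 y s)) \<partial>lborel) = m2 s * of_real (C s)" .
  qed
  also have "(\<integral>s. m2 s * of_real (C s) \<partial>lborel) = (\<integral>s. \<integral>t. g\<^sub>2 (t, s) * of_real (\<rho>\<^sub>1 t * C s) \<partial>lborel \<partial>lborel)"
    by (simp add: m2_def mult_ac flip: integral_mult_right_zero)
  also have "\<dots> = (\<integral>p. g\<^sub>2 p * of_real (\<rho>\<^sub>1 (fst p) * C (snd p)) \<partial>lborel)"
    using lborel_pair.integral_snd[of "\<lambda>x y. g\<^sub>2 (x, y) * of_real (\<rho>\<^sub>1 x * C y)"] iG by (simp add: lborel_prod case_prod_unfold)
  finally have *: "(\<integral>y. of_real (k y) * W2 y \<partial>lborel) = - (\<integral>p. g\<^sub>2 p * of_real (\<rho>\<^sub>1 (fst p) * C (snd p)) \<partial>lborel)" .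
  have "integral\<^sup>L lborel ?F = (\<integral>y. \<integral>x. ?F (x, y) \<partial>lborel \<partial>lborel)"
    using lborel_pair.integral_snd[of "\<lambda>x y. ?F (x, y)"] iF by (simp add: lborel_prod case_prod_unfold)
  also have "\<dots> = (\<integral>y. \<integral>x. of_real (b x) * (of_real (k y) * W2 y) \<partial>lborel \<partial>lborel)"
    by (simp only: F)
  also have "\<dots> = of_real (integral\<^sup>L lborel b) * (\<integral>y. of_real (k y) * W2 y \<partial>lborel)"
    by simp
  finally show ?thesis using * by simp
qed

text \<open>By \<open>weak_formula\<close>, \<open>u\<close> and W1 + W2 act alike on all tensor
  bumps, so the fundamental lemma identifies them on the cell.\<close>

lemma representation: "AE p in lborel. p \<in> cell \<longrightarrow> u p = W1 (fst p) (snd p) + W2 (snd p)"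
proof -
  let ?v = "\<lambda>p. u p - indicat_real cell p *\<^sub>R W1 (fst p) (snd p) - indicat_real cell p *\<^sub>R W2 (snd p)"
  have iv: "integrable lborel ?v"
    by (intro Bochner_Integration.integrable_diff int integrable_W1 integrable_W2)
  have "AE p in lborel. p \<in> cell \<longrightarrow> ?v p = 0"
  proof (rule fundamental_lemma_rectangle)
    show "?v \<in> borel_measurable borel" by measurable
    show "set_integrable lborel ({l1..r1} \<times> {l2..r2}) ?v" for l1 r1 l2 r2
      unfolding set_integrable_def using iv by (intro integrable_mult_indicator) (auto simp: borel_Times)
    fix b k assume b: "smooth_bump_on a\<^sub>1 (a\<^sub>1 + h) b" and k: "smooth_bump_on a\<^sub>2 (a\<^sub>2 + h) k"
    note i = integrable_times_tensor[OF int(1) b k] integrable_times_tensor[OF integrable_W1 b k]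
      integrable_times_tensor[OF integrable_W2 b k]
    have "(\<integral>p. ?v p * of_real (b (fst p) * k (snd p)) \<partial>lborel) =
       (\<integral>p. u p * of_real (b (fst p) * k (snd p)) \<partial>lborel)
       - (\<integral>p. (indicat_real cell p *\<^sub>R W1 (fst p) (snd p)) * of_real (b (fst p) * k (snd p)) \<partial>lborel)
       - (\<integral>p. (indicat_real cell p *\<^sub>R W2 (snd p)) * of_real (b (fst p) * k (snd p)) \<partial>lborel)"
      unfolding left_diff_distrib
      by (subst Bochner_Integration.integral_diff, (intro i Bochner_Integration.integrable_diff)+,
          subst Bochner_Integration.integral_diff, (intro i)+, simp)
    then show "(\<integral>p. ?v p * of_real (b (fst p) * k (snd p)) \<partial>lborel) = 0"
      using weak_formula[OF b k] test_W1[OF b k] test_W2[OF b k] by simp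
  qed
  then show ?thesis by eventually_elim (auto simp: indicator_def algebra_simps)
qed

text \<open>One factor h comes from Cauchy-Schwarz in t on an interval of length h, the other from
  integrating over x a bound that does not depend on x.\<close>

lemma W1_norm:
  "(\<integral>\<^sup>+p. indicator cell p * ennreal ((norm (W1 (fst p) (snd p)))\<^sup>2) \<partial>lborel)
     \<le> ennreal (h\<^sup>2) * (\<integral>\<^sup>+p. ennreal ((norm (g\<^sub>1 p))\<^sup>2) \<partial>lborel)"
proof -
  let ?\<Gamma> = "\<lambda>y. \<integral>\<^sup>+t. ennreal ((norm (g\<^sub>1 (t, y)))\<^sup>2) \<partial>lborel"
  have pt: "ennreal ((norm (W1 x y))\<^sup>2) \<le> ennreal h * ?\<Gamma> y" for x y
  proof -
    have "ennreal (norm (W1 x y)) \<le> (\<integral>\<^sup>+t. ennreal (norm (g\<^sub>1 (t, y) * of_real (kern \<rho>\<^sub>1 x t))) \<partial>lborel)"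
      unfolding W1_def norm_minus_cancel by (rule norm_integral_le_nn_integral)
    also have "\<dots> \<le> (\<integral>\<^sup>+t. ennreal (norm (g\<^sub>1 (t, y))) \<partial>lborel)"
      by (intro nn_integral_mono ennreal_leI kern_norm_bound)
    finally have "(ennreal (norm (W1 x y)))\<^sup>2 \<le> (\<integral>\<^sup>+t. ennreal (norm (g\<^sub>1 (t, y))) \<partial>lborel)\<^sup>2"
      by (rule power_mono) simp
    also have "\<dots> \<le> ennreal h * (\<integral>\<^sup>+t. (ennreal (norm (g\<^sub>1 (t, y))))\<^sup>2 \<partial>lborel)"
      by (rule Cauchy_Schwarz_indicator[of _ "a\<^sub>1"]) (use outside X.h in auto)
    finally show ?thesis by (simp add: ennreal_norm_square)
  qed
  have "(\<integral>\<^sup>+p. indicator cell p * ennreal ((norm (W1 (fst p) (snd p)))\<^sup>2) \<partial>lborel)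
     \<le> (\<integral>\<^sup>+p. indicator {a\<^sub>1<..<a\<^sub>1 + h} (fst p) * (ennreal h * ?\<Gamma> (snd p)) \<partial>(lborel \<Otimes>\<^sub>M lborel))"
    unfolding lborel_prod using pt by (intro nn_integral_mono) (auto simp: indicator_def)
  also have "\<dots> = (\<integral>\<^sup>+y. \<integral>\<^sup>+x. indicator {a\<^sub>1<..<a\<^sub>1 + h} x * (ennreal h * ?\<Gamma> y) \<partial>lborel \<partial>lborel)"
    by (subst lborel_pair.nn_integral_snd[symmetric]) auto
  also have "\<dots> = (\<integral>\<^sup>+y. ennreal h * (ennreal h * ?\<Gamma> y) \<partial>lborel)"
    using X.h by (intro nn_integral_cong) (simp add: nn_integral_multc)
  also have "\<dots> = ennreal h * ennreal h * (\<integral>\<^sup>+y. ?\<Gamma> y \<partial>lborel)"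
    by (simp add: nn_integral_cmult mult.assoc)
  also have "(\<integral>\<^sup>+y. ?\<Gamma> y \<partial>lborel) = (\<integral>\<^sup>+p. ennreal ((norm (g\<^sub>1 p))\<^sup>2) \<partial>lborel)"
    using lborel_pair.nn_integral_snd[of "\<lambda>p. ennreal ((norm (g\<^sub>1 p))\<^sup>2)"] by (simp add: lborel_prod)
  finally show ?thesis using X.h by (simp add: power2_eq_square ennreal_mult)
qed

text \<open>Height at most M / h and mass one bound the squared weight by M / h in integral.
  Cauchy-Schwarz in the second variable contributes h and the area of the cell h^2, so altogether M
  h^2.\<close>

lemma W2_norm:
  "(\<integral>\<^sup>+p. indicator cell p * ennreal ((norm (W2 (snd p)))\<^sup>2) \<partial>lborel)
     \<le> ennreal (M * h\<^sup>2) * (\<integral>\<^sup>+p. ennreal ((norm (g\<^sub>2 p))\<^sup>2) \<partial>lborel)"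
proof -
  let ?\<Gamma> = "\<lambda>y. \<integral>\<^sup>+t. ennreal ((norm (g\<^sub>2 (t, y)))\<^sup>2) \<partial>lborel"
  have M: "M \<ge> 0" using order_trans[OF X.\<rho>_nonneg[of 0] X.bound[of 0]] X.h by (simp add: zero_le_divide_iff)
  have "(\<integral>\<^sup>+t. (ennreal (\<rho>\<^sub>1 t))\<^sup>2 \<partial>lborel) \<le> (\<integral>\<^sup>+t. ennreal (M / h) * ennreal (\<rho>\<^sub>1 t) \<partial>lborel)"
    unfolding power2_eq_square by (intro nn_integral_mono mult_right_mono ennreal_leI X.bound) auto
  also have "\<dots> = ennreal (M / h) * ennreal (\<integral>t. \<rho>\<^sub>1 t \<partial>lborel)"
    by (subst nn_integral_cmult) (auto simp: nn_integral_eq_integral[OF X.\<rho>_integrable] X.\<rho>_nonneg)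
  finally have \<rho>sq: "(\<integral>\<^sup>+t. (ennreal (\<rho>\<^sub>1 t))\<^sup>2 \<partial>lborel) \<le> ennreal (M / h)" using X.mass by simp
  have m2: "(ennreal (norm (m2 s)))\<^sup>2 \<le> ennreal (M / h) * ?\<Gamma> s" for s
  proof -
    have "ennreal (norm (m2 s)) \<le> (\<integral>\<^sup>+t. ennreal (norm (g\<^sub>2 (t, s) * of_real (\<rho>\<^sub>1 t))) \<partial>lborel)"
      unfolding m2_def by (rule norm_integral_le_nn_integral)
    also have "\<dots> = (\<integral>\<^sup>+t. ennreal (\<rho>\<^sub>1 t) * ennreal (norm (g\<^sub>2 (t, s))) \<partial>lborel)"
      using X.\<rho>_nonneg by (intro nn_integral_cong) (simp add: norm_mult mult.commute flip: ennreal_mult)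
    finally have "(ennreal (norm (m2 s)))\<^sup>2 \<le> (\<integral>\<^sup>+t. ennreal (\<rho>\<^sub>1 t) * ennreal (norm (g\<^sub>2 (t, s))) \<partial>lborel)\<^sup>2"
      by (rule power_mono) simp
    also have "\<dots> \<le> (\<integral>\<^sup>+t. (ennreal (\<rho>\<^sub>1 t))\<^sup>2 \<partial>lborel) * (\<integral>\<^sup>+t. (ennreal (norm (g\<^sub>2 (t, s))))\<^sup>2 \<partial>lborel)"
      by (rule Cauchy_Schwarz_nn_integral) auto
    also have "\<dots> \<le> ennreal (M / h) * ?\<Gamma> s"
      unfolding ennreal_norm_square by (intro mult_right_mono \<rho>sq) auto
    finally show ?thesis .
  qed
  have m2_out: "m2 s = 0" if "s \<notin> {a\<^sub>2<..<a\<^sub>2 + h}" for s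
    using that outside unfolding m2_def by auto
  have pt: "ennreal ((norm (W2 y))\<^sup>2) \<le> ennreal M * (\<integral>\<^sup>+p. ennreal ((norm (g\<^sub>2 p))\<^sup>2) \<partial>lborel)" for y
  proof -
    have "ennreal (norm (W2 y)) \<le> (\<integral>\<^sup>+t. ennreal (norm (m2 t * of_real (kern \<rho>\<^sub>2 y t))) \<partial>lborel)"
      unfolding W2_def norm_minus_cancel by (rule norm_integral_le_nn_integral)
    also have "\<dots> \<le> (\<integral>\<^sup>+t. ennreal (norm (m2 t)) \<partial>lborel)"
      by (intro nn_integral_mono ennreal_leI kern_norm_bound)
    finally have "(ennreal (norm (W2 y)))\<^sup>2 \<le> (\<integral>\<^sup>+t. ennreal (norm (m2 t)) \<partial>lborel)\<^sup>2"
      by (rule power_mono) simp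
    also have "\<dots> \<le> ennreal h * (\<integral>\<^sup>+t. (ennreal (norm (m2 t)))\<^sup>2 \<partial>lborel)"
      by (rule Cauchy_Schwarz_indicator[of _ "a\<^sub>2"]) (use m2_out X.h in auto)
    also have "\<dots> \<le> ennreal h * (\<integral>\<^sup>+s. ennreal (M / h) * ?\<Gamma> s \<partial>lborel)"
      by (intro mult_left_mono nn_integral_mono m2) auto
    also have "\<dots> = ennreal h * ennreal (M / h) * (\<integral>\<^sup>+s. ?\<Gamma> s \<partial>lborel)"
      by (simp add: nn_integral_cmult mult.assoc)
    also have "ennreal h * ennreal (M / h) = ennreal M"
      using X.h M by (simp flip: ennreal_mult)
    also have "(\<integral>\<^sup>+y. ?\<Gamma> y \<partial>lborel) = (\<integral>\<^sup>+p. ennreal ((norm (g\<^sub>2 p))\<^sup>2) \<partial>lborel)"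
      using lborel_pair.nn_integral_snd[of "\<lambda>p. ennreal ((norm (g\<^sub>2 p))\<^sup>2)"] by (simp add: lborel_prod)
    finally show ?thesis by (simp add: ennreal_norm_square)
  qed
  let ?I = "\<integral>\<^sup>+p. ennreal ((norm (g\<^sub>2 p))\<^sup>2) \<partial>lborel"
  have "(\<integral>\<^sup>+p. indicator cell p * ennreal ((norm (W2 (snd p)))\<^sup>2) \<partial>lborel)
     \<le> (\<integral>\<^sup>+p. indicator cell p * (ennreal M * ?I) \<partial>lborel)"
    by (intro nn_integral_mono mult_left_mono pt) auto
  also have "\<dots> = emeasure (lborel \<Otimes>\<^sub>M lborel) cell * (ennreal M * ?I)"
    unfolding lborel_prod by (simp add: nn_integral_multc)
  also have "emeasure (lborel \<Otimes>\<^sub>M lborel) cell = ennreal h * ennreal h"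
    using X.h by (subst lborel.emeasure_pair_measure_Times) auto
  finally show ?thesis using X.h M by (simp add: power2_eq_square ennreal_mult mult_ac)
qed

lemma poincare:
  "(\<integral>\<^sup>+p. ennreal ((norm (u p))\<^sup>2) \<partial>lborel) \<le>
     ennreal (2 * h\<^sup>2) * (\<integral>\<^sup>+p. ennreal ((norm (g\<^sub>1 p))\<^sup>2) \<partial>lborel)
   + ennreal (2 * M * h\<^sup>2) * (\<integral>\<^sup>+p. ennreal ((norm (g\<^sub>2 p))\<^sup>2) \<partial>lborel)"
proof -
  have M: "M \<ge> 0" using order_trans[OF X.\<rho>_nonneg[of 0] X.bound[of 0]] X.h by (simp add: zero_le_divide_iff)
  have "(\<integral>\<^sup>+p. ennreal ((norm (u p))\<^sup>2) \<partial>lborel) \<le>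
     (\<integral>\<^sup>+p. 2 * (indicator cell p * ennreal ((norm (W1 (fst p) (snd p)))\<^sup>2)) + 2 * (indicator cell p * ennreal ((norm (W2 (snd p)))\<^sup>2)) \<partial>lborel)"
  proof (rule nn_integral_mono_AE)
    show "AE p in lborel. ennreal ((norm (u p))\<^sup>2) \<le>
      2 * (indicator cell p * ennreal ((norm (W1 (fst p) (snd p)))\<^sup>2)) + 2 * (indicator cell p * ennreal ((norm (W2 (snd p)))\<^sup>2))"
      using representation
    proof eventually_elim
      case (elim p)
      show ?case
      proof (cases "p \<in> cell")
        case True
        have "(norm (u p))\<^sup>2 \<le> (norm (W1 (fst p) (snd p)) + norm (W2 (snd p)))\<^sup>2"
          using elim True by (intro power_mono) (auto intro: norm_triangle_ineq)
        also have "\<dots> \<le> 2 * (norm (W1 (fst p) (snd p)))\<^sup>2 + 2 * (norm (W2 (snd p)))\<^sup>2"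
          using sum_squares_bound[of "norm (W1 (fst p) (snd p))" "norm (W2 (snd p))"]
          by (simp add: power2_sum)
        finally have "ennreal ((norm (u p))\<^sup>2) \<le> ennreal (2 * (norm (W1 (fst p) (snd p)))\<^sup>2 + 2 * (norm (W2 (snd p)))\<^sup>2)"
          by (rule ennreal_leI)
        with True show ?thesis by (simp add: ennreal_mult)
      next
        case False
        then show ?thesis using outside[of "fst p" "snd p"] by (cases p) auto
      qed
    qed
  qed
  also have "\<dots> = 2 * (\<integral>\<^sup>+p. indicator cell p * ennreal ((norm (W1 (fst p) (snd p)))\<^sup>2) \<partial>lborel)
     + 2 * (\<integral>\<^sup>+p. indicator cell p * ennreal ((norm (W2 (snd p)))\<^sup>2) \<partial>lborel)"
    by (simp add: nn_integral_add nn_integral_cmult)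
  also have "\<dots> \<le> 2 * (ennreal (h\<^sup>2) * (\<integral>\<^sup>+p. ennreal ((norm (g\<^sub>1 p))\<^sup>2) \<partial>lborel))
     + 2 * (ennreal (M * h\<^sup>2) * (\<integral>\<^sup>+p. ennreal ((norm (g\<^sub>2 p))\<^sup>2) \<partial>lborel))"
    by (intro add_mono mult_left_mono W1_norm W2_norm) auto
  finally show ?thesis using M by (simp add: ennreal_mult mult.assoc)
qed

end

subsection \<open>Weak derivatives and the energy space\<close>

lemma ae_eq_rep: "ae_eq (rep_aefun u) (rep_aefun u)"
  using Quotient3_rep_reflp[OF Quotient3_aefun] .

lemma rep_measurable [measurable]: "rep_aefun u \<in> borel_measurable borel"
  using ae_eq_rep[of u] by (simp add: ae_eq_def)

lemma rep_abs_aefun: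
  "f \<in> borel_measurable borel \<Longrightarrow> AE p in lborel. rep_aefun (abs_aefun f) p = f p"
  using Quotient3_rep_abs[OF Quotient3_aefun, of f] by (simp add: ae_eq_def)

lemma aefun_eqI: "(AE p in lborel. rep_aefun u p = rep_aefun v p) \<Longrightarrow> u = v"
  by (subst Quotient3_rel_rep[OF Quotient3_aefun, symmetric]) (simp add: ae_eq_def)

text \<open>Classes form only a real vector space, but the rotation of \<psi> by the imaginary unit
  needs complex coefficients. A single two-term operation covers sums, real multiples, zero and this
  rotation; for a multiple, the second coefficient is 0.\<close>

definition lincomb :: "complex \<Rightarrow> aefun \<Rightarrow> complex \<Rightarrow> aefun \<Rightarrow> aefun" where
  "lincomb \<alpha> u \<beta> v = abs_aefun (\<lambda>p. \<alpha> * rep_aefun u p + \<beta> * rep_aefun v p)"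

lemma rep_lincomb:
  "AE p in lborel. rep_aefun (lincomb \<alpha> u \<beta> v) p = \<alpha> * rep_aefun u p + \<beta> * rep_aefun v p"
  unfolding lincomb_def by (rule rep_abs_aefun) measurable

lemma rep_zero: "AE p in lborel. rep_aefun 0 p = 0"
  unfolding zero_aefun_def by (rule rep_abs_aefun) simp

lemma plus_aefun_eq: "u + v = lincomb 1 u 1 v"
  by (simp add: plus_aefun_def lincomb_def)

lemma scaleR_aefun_eq: "r *\<^sub>R u = lincomb (of_real r) u 0 u"
  by (simp add: scaleR_aefun_def lincomb_def scaleR_conv_of_real)

lemma zero_aefun_eq: "0 = lincomb 0 u 0 u"
  by (simp add: zero_aefun_def lincomb_def)

lemma square_sets [measurable]: "square d \<in> sets borel"
  unfolding square_def by (intro borel_Times) auto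

lemma integrable_square_const: "set_integrable lborel (square d) (\<lambda>_. c :: real)"
proof -
  have "bounded (square d)"
    unfolding square_def by (intro bounded_Times) auto
  then have "integrable lborel (\<lambda>p. indicat_real (square d) p * c)"
    by (intro integrable_mult_left integrable_real_indicator emeasure_bounded_finite) auto
  then show ?thesis unfolding set_integrable_def by simp
qed

lemma lives_on_square_lincomb:
  assumes "lives_on_square d u" "lives_on_square d v"
  shows "lives_on_square d (lincomb \<alpha> u \<beta> v)"
  using assms rep_lincomb[of \<alpha> u \<beta> v] unfolding lives_on_square_def
  by eventually_elim auto

lemma integral_lincomb:
  assumes "set_integrable lborel A (\<lambda>p. rep_aefun u p * f p)" "set_integrable lborel A (\<lambda>p. rep_aefun v p * f p)"
    and [measurable]: "A \<in> sets borel" "f \<in> borel_measurable borel"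
  shows "set_integrable lborel A (\<lambda>p. rep_aefun (lincomb \<alpha> u \<beta> v) p * f p)"
    and "(LINT p:A|lborel. rep_aefun (lincomb \<alpha> u \<beta> v) p * f p) =
      \<alpha> * (LINT p:A|lborel. rep_aefun u p * f p) + \<beta> * (LINT p:A|lborel. rep_aefun v p * f p)"
proof -
  let ?w = "\<lambda>p. \<alpha> * (rep_aefun u p * f p) + \<beta> * (rep_aefun v p * f p)"
  have AE: "AE p in lborel. rep_aefun (lincomb \<alpha> u \<beta> v) p * f p = ?w p"
    using rep_lincomb[of \<alpha> u \<beta> v] by eventually_elim (auto simp: algebra_simps)
  have i: "set_integrable lborel A (\<lambda>p. \<alpha> * (rep_aefun u p * f p))" "set_integrable lborel A (\<lambda>p. \<beta> * (rep_aefun v p * f p))"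
    using assms(1,2) by auto
  have "set_integrable lborel A ?w \<longleftrightarrow> set_integrable lborel A (\<lambda>p. rep_aefun (lincomb \<alpha> u \<beta> v) p * f p)"
    unfolding set_integrable_def by (rule integrable_cong_AE) (use AE in auto)
  then show "set_integrable lborel A (\<lambda>p. rep_aefun (lincomb \<alpha> u \<beta> v) p * f p)"
    using set_integral_add(1)[OF i] by simp
  have "(LINT p:A|lborel. rep_aefun (lincomb \<alpha> u \<beta> v) p * f p) = (LINT p:A|lborel. ?w p)"
    unfolding set_lebesgue_integral_def by (rule integral_cong_AE) (use AE in auto)
  then show "(LINT p:A|lborel. rep_aefun (lincomb \<alpha> u \<beta> v) p * f p) =
      \<alpha> * (LINT p:A|lborel. rep_aefun u p * f p) + \<beta> * (LINT p:A|lborel. rep_aefun v p * f p)"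
    using set_integral_add(2)[OF i] by simp
qed

lemma test_function_continuous:
  assumes "test_function d f"
  obtains K where "compact K" "K \<subseteq> square d" "\<forall>p. p \<notin> K \<longrightarrow> f p = 0"
    "continuous_on UNIV f" "continuous_on UNIV (\<lambda>p. frechet_derivative f (at p) e)"
    "\<forall>p. p \<notin> K \<longrightarrow> frechet_derivative f (at p) e = 0"
proof -
  obtain K where K: "compact K" "K \<subseteq> square d" "\<forall>p. p \<notin> K \<longrightarrow> f p = 0" and Ck: "\<And>k. Ck k f"
    using assms unfolding test_function_def by blast
  obtain f1 f2 where f: "Ck 0 f1" "Ck 0 f2" "\<And>p. (f has_derivative (\<lambda>h. f1 p * fst h + f2 p * snd h)) (at p)"
    using Ck[of "Suc 0"] by auto
  have D: "frechet_derivative f (at p) = (\<lambda>h. f1 p * fst h + f2 p * snd h)" for p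
    using frechet_derivative_at[OF f(3)] by simp
  have "frechet_derivative f (at p) e = 0" if "p \<notin> K" for p
  proof -
    have "open (- K)" using K(1) by (simp add: compact_imp_closed open_Compl)
    have "(f has_derivative (\<lambda>_. 0)) (at p)"
      by (rule has_derivative_transform_within_open[OF has_derivative_const \<open>open (- K)\<close>, of _ 0])
        (use that K(3) in auto)
    from frechet_derivative_at[OF this] show ?thesis by (metis)
  qed
  moreover have "continuous_on UNIV (\<lambda>p. frechet_derivative f (at p) e)"
    unfolding D using f(1,2) by (auto intro!: continuous_intros)
  moreover have "continuous_on UNIV f" using Ck[of 0] by simp
  ultimately show ?thesis using K that by blast
qed

lemma locally_integrable_times:
  assumes "locally_integrable d u" "compact K" "K \<subseteq> square d" "\<forall>p. p \<notin> K \<longrightarrow> f p = 0"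
    "continuous_on UNIV f"
  shows "set_integrable lborel (square d) (\<lambda>p. rep_aefun u p * of_real (f p))"
proof -
  have [measurable]: "f \<in> borel_measurable borel" using assms(5) by (rule borel_measurable_continuous_onI)
  have "compact (f ` K)" using assms by (intro compact_continuous_image continuous_on_subset[OF assms(5)]) auto
  then obtain C where C: "\<And>p. p \<in> K \<Longrightarrow> \<bar>f p\<bar> \<le> C"
    using compact_imp_bounded[of "f ` K"] by (auto simp: bounded_iff)
  have "set_integrable lborel K (rep_aefun u)" using assms unfolding locally_integrable_def by blast
  then have "integrable lborel (\<lambda>p. C * norm (indicat_real K p *\<^sub>R rep_aefun u p))"
    unfolding set_integrable_def by (intro integrable_mult_right integrable_norm)
  then show ?thesis unfolding set_integrable_def
  proof (rule Bochner_Integration.integrable_bound)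
    show "AE p in lborel. norm (indicat_real (square d) p *\<^sub>R (rep_aefun u p * of_real (f p)))
       \<le> norm (C * norm (indicat_real K p *\<^sub>R rep_aefun u p))"
    proof (rule AE_I2)
      fix p
      show "norm (indicat_real (square d) p *\<^sub>R (rep_aefun u p * of_real (f p)))
       \<le> norm (C * norm (indicat_real K p *\<^sub>R rep_aefun u p))"
      proof (cases "p \<in> K")
        case True
        then show ?thesis
          using mult_right_mono[OF order_trans[OF C[OF True] abs_ge_self], of "norm (rep_aefun u p)"] assms(3)
          by (auto simp: norm_mult mult.commute abs_mult)
      next
        case False
        then have "f p = 0" using assms(4) by blast
        then show ?thesis by simp
      qed
    qed
  qed measurable
qed

lemma has_weak_deriv_integrable:
  assumes "has_weak_deriv d e u g" "test_function d f"
  shows "set_integrable lborel (square d) (\<lambda>p. rep_aefun u p * of_real (frechet_derivative f (at p) e))"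
    "set_integrable lborel (square d) (\<lambda>p. rep_aefun g p * of_real (f p))"
    "(\<lambda>p. complex_of_real (frechet_derivative f (at p) e)) \<in> borel_measurable borel"
    "(\<lambda>p. complex_of_real (f p)) \<in> borel_measurable borel"
proof -
  obtain K where K: "compact K" "K \<subseteq> square d" "\<forall>p. p \<notin> K \<longrightarrow> f p = 0"
    "continuous_on UNIV f" "continuous_on UNIV (\<lambda>p. frechet_derivative f (at p) e)"
    "\<forall>p. p \<notin> K \<longrightarrow> frechet_derivative f (at p) e = 0"
    using test_function_continuous[OF assms(2), of e] by metis
  have "locally_integrable d u" "locally_integrable d g" using assms(1) unfolding has_weak_deriv_def by auto
  then show "set_integrable lborel (square d) (\<lambda>p. rep_aefun u p * of_real (frechet_derivative f (at p) e))"
    "set_integrable lborel (square d) (\<lambda>p. rep_aefun g p * of_real (f p))"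
    using K by (auto intro!: locally_integrable_times)
  show "(\<lambda>p. complex_of_real (frechet_derivative f (at p) e)) \<in> borel_measurable borel"
    "(\<lambda>p. complex_of_real (f p)) \<in> borel_measurable borel"
    using K(4,5) by (auto intro!: borel_measurable_continuous_onI continuous_intros)
qed

lemma has_weak_deriv_lincomb:
  assumes u: "has_weak_deriv d e u g" and v: "has_weak_deriv d e v k"
  shows "has_weak_deriv d e (lincomb \<alpha> u \<beta> v) (lincomb \<alpha> g \<beta> k)"
proof -
  have loc: "locally_integrable d (lincomb \<alpha> x \<beta> y)" if "locally_integrable d x" "locally_integrable d y" for x y
    unfolding locally_integrable_def
  proof safe
    fix K assume K: "compact K" "K \<subseteq> square d"
    have [measurable]: "K \<in> sets borel" using K(1) by (simp add: borel_compact)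
    show "set_integrable lborel K (rep_aefun (lincomb \<alpha> x \<beta> y))"
      using integral_lincomb(1)[of K x "\<lambda>_. 1" y \<alpha> \<beta>] that K unfolding locally_integrable_def by simp
  qed
  show ?thesis
    unfolding has_weak_deriv_def
  proof (intro conjI allI impI)
    fix f assume f: "test_function d f"
    note iu = has_weak_deriv_integrable[OF u f] and iv = has_weak_deriv_integrable[OF v f]
    have eu: "(LINT p:square d|lborel. rep_aefun u p * of_real (frechet_derivative f (at p) e))
        = - (LINT p:square d|lborel. rep_aefun g p * of_real (f p))"
      and ev: "(LINT p:square d|lborel. rep_aefun v p * of_real (frechet_derivative f (at p) e))
        = - (LINT p:square d|lborel. rep_aefun k p * of_real (f p))"
      using u v f unfolding has_weak_deriv_def by auto
    show "(LINT p:square d|lborel. rep_aefun (lincomb \<alpha> u \<beta> v) p * of_real (frechet_derivative f (at p) e))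
        = - (LINT p:square d|lborel. rep_aefun (lincomb \<alpha> g \<beta> k) p * of_real (f p))"
      unfolding integral_lincomb(2)[OF iu(1) iv(1) square_sets iu(3)]
        integral_lincomb(2)[OF iu(2) iv(2) square_sets iu(4)] eu ev by simp
  qed (use u v in \<open>auto simp: has_weak_deriv_def intro!: loc lives_on_square_lincomb\<close>)
qed

lemma set_integral_square_eq:
  assumes "smooth_bump_on l1 r1 b" "smooth_bump_on l2 r2 k" "{l1<..<r1} \<times> {l2<..<r2} \<subseteq> square d"
  shows "(LINT p:square d|lborel. f p * complex_of_real (b (fst p) * k (snd p)))
     = (\<integral>p. f p * complex_of_real (b (fst p) * k (snd p)) \<partial>lborel)"
  unfolding set_lebesgue_integral_def
proof (rule Bochner_Integration.integral_cong[OF refl])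
  fix p :: "real \<times> real"
  show "indicat_real (square d) p *\<^sub>R (f p * complex_of_real (b (fst p) * k (snd p))) = f p * complex_of_real (b (fst p) * k (snd p))"
  proof (cases "p \<in> square d")
    case False
    then have "fst p \<notin> {l1<..<r1} \<or> snd p \<notin> {l2<..<r2}" using assms(3) by (metis mem_Times_iff subsetD)
    then show ?thesis using smooth_bump_on_outside[OF assms(1)] smooth_bump_on_outside[OF assms(2)] by auto
  qed simp
qed

text \<open>This gives \<open>THE\<close> in \<open>weak_deriv\<close> its meaning. The difference
  of two candidates is a weak derivative of a function that is zero almost everywhere, so it
  annihilates all tensor bumps on the square; outside the square both candidates vanish.\<close>

lemma has_weak_deriv_unique:
  assumes g: "has_weak_deriv d e u g" and k: "has_weak_deriv d e u k"
  shows "g = k"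
proof -
  have z: "has_weak_deriv d e (lincomb 1 u (- 1) u) (lincomb 1 g (- 1) k)" (is "has_weak_deriv d e ?u ?g")
    using g k by (rule has_weak_deriv_lincomb)
  then have zl: "locally_integrable d ?g" by (simp add: has_weak_deriv_def)
  have u0: "AE p in lborel. rep_aefun ?u p = 0" using rep_lincomb[of 1 u "- 1" u] by eventually_elim simp
  have "AE p in lborel. p \<in> {- d / 2<..<d / 2} \<times> {- d / 2<..<d / 2} \<longrightarrow> rep_aefun ?g p = 0"
  proof (rule fundamental_lemma_rectangle[OF rep_measurable])
    fix l1 r1 l2 r2 assume *: "- d / 2 < l1" "r1 < d / 2" "- d / 2 < l2" "r2 < d / 2"
    have "{l1..r1} \<times> {l2..r2} \<subseteq> square d" using * by (auto simp: square_def)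
    then show "set_integrable lborel ({l1..r1} \<times> {l2..r2}) (rep_aefun ?g)"
      using zl compact_Times[OF compact_Icc compact_Icc, of l1 r1 l2 r2] by (simp add: locally_integrable_def)
  next
    fix b c assume b: "smooth_bump_on (- d / 2) (d / 2) b" and c: "smooth_bump_on (- d / 2) (d / 2) c"
    let ?f = "\<lambda>p. b (fst p) * c (snd p)"
    have f: "test_function d ?f" using b c by (rule test_function_tensor) (simp add: square_def)
    have "(LINT p:square d|lborel. rep_aefun ?g p * of_real (?f p)) =
       - (LINT p:square d|lborel. rep_aefun ?u p * of_real (frechet_derivative ?f (at p) e))"
      using z f unfolding has_weak_deriv_def by auto
    also have "(LINT p:square d|lborel. rep_aefun ?u p * of_real (frechet_derivative ?f (at p) e)) = 0"
      unfolding set_lebesgue_integral_def by (rule integral_eq_zero_AE) (use u0 in \<open>eventually_elim, simp\<close>)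
    finally show "(\<integral>p. rep_aefun ?g p * of_real (?f p) \<partial>lborel) = 0"
      using set_integral_square_eq[OF b c] by (simp add: square_def)
  qed
  then have "AE p in lborel. rep_aefun ?g p = 0"
    using z unfolding has_weak_deriv_def lives_on_square_def square_def by (auto elim: eventually_elim2)
  then have "AE p in lborel. rep_aefun g p = rep_aefun k p"
    using rep_lincomb[of 1 g "- 1" k] by eventually_elim simp
  then show ?thesis by (rule aefun_eqI)
qed

lemma weak_deriv_eq: "has_weak_deriv d e u g \<Longrightarrow> weak_deriv d e u = g"
  unfolding weak_deriv_def using has_weak_deriv_unique by blast

lemma weakly_differentiableD:
  assumes "weakly_differentiable d u"
  shows "has_weak_deriv d (1, 0) u (weak_deriv d (1, 0) u)" "has_weak_deriv d (0, 1) u (weak_deriv d (0, 1) u)"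
  using assms weak_deriv_eq unfolding weakly_differentiable_def by metis+

lemma weakly_differentiable_lincomb:
  assumes "weakly_differentiable d u" "weakly_differentiable d v"
  shows "weakly_differentiable d (lincomb \<alpha> u \<beta> v)"
    and "weak_deriv d (1, 0) (lincomb \<alpha> u \<beta> v) = lincomb \<alpha> (weak_deriv d (1, 0) u) \<beta> (weak_deriv d (1, 0) v)"
    and "weak_deriv d (0, 1) (lincomb \<alpha> u \<beta> v) = lincomb \<alpha> (weak_deriv d (0, 1) u) \<beta> (weak_deriv d (0, 1) v)"
proof -
  note * = has_weak_deriv_lincomb[OF weakly_differentiableD(1)[OF assms(1)] weakly_differentiableD(1)[OF assms(2)]]
    has_weak_deriv_lincomb[OF weakly_differentiableD(2)[OF assms(1)] weakly_differentiableD(2)[OF assms(2)]]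
  show "weakly_differentiable d (lincomb \<alpha> u \<beta> v)"
    using * unfolding weakly_differentiable_def by blast
  show "weak_deriv d (1, 0) (lincomb \<alpha> u \<beta> v) = lincomb \<alpha> (weak_deriv d (1, 0) u) \<beta> (weak_deriv d (1, 0) v)"
    "weak_deriv d (0, 1) (lincomb \<alpha> u \<beta> v) = lincomb \<alpha> (weak_deriv d (0, 1) u) \<beta> (weak_deriv d (0, 1) v)"
    by (intro weak_deriv_eq *)+
qed

section \<open>Square integrability and products\<close>

definition sq_integrable :: "real \<Rightarrow> (real \<times> real \<Rightarrow> complex) \<Rightarrow> bool" where
  "sq_integrable d f \<longleftrightarrow> f \<in> borel_measurable borel \<and> set_integrable lborel (square d) (\<lambda>p. (cmod (f p))\<^sup>2)"

lemma sq_integrable_measurable: "sq_integrable d f \<Longrightarrow> f \<in> borel_measurable borel"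
  by (simp add: sq_integrable_def)

lemma set_integrable_bound_square:
  fixes f :: "real \<times> real \<Rightarrow> real" and g :: "real \<times> real \<Rightarrow> 'b::{banach, second_countable_topology}"
  assumes "set_integrable lborel (square d) f" "g \<in> borel_measurable borel"
    "\<And>p. p \<in> square d \<Longrightarrow> norm (g p) \<le> f p"
  shows "set_integrable lborel (square d) g"
proof (rule set_integrable_bound[OF assms(1)])
  show "set_borel_measurable lborel (square d) g"
    using assms(2) unfolding set_borel_measurable_def by measurable
  show "AE x in lborel. x \<in> square d \<longrightarrow> norm (g x) \<le> norm (f x)"
    using assms(3) by (intro AE_I2) (auto intro: order_trans[OF _ abs_ge_self])
qed

lemma sq_integrable_mult:
  assumes "sq_integrable d f" "sq_integrable d g"
  shows "set_integrable lborel (square d) (\<lambda>p. f p * g p)"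
proof (rule set_integrable_bound_square)
  show "set_integrable lborel (square d) (\<lambda>p. (cmod (f p))\<^sup>2 + (cmod (g p))\<^sup>2)"
    using assms unfolding sq_integrable_def by (intro set_integral_add) auto
  show "(\<lambda>p. f p * g p) \<in> borel_measurable borel"
    using assms unfolding sq_integrable_def by (intro borel_measurable_times) auto
  show "norm (f p * g p) \<le> (cmod (f p))\<^sup>2 + (cmod (g p))\<^sup>2" for p
    using sum_squares_bound[of "cmod (f p)" "cmod (g p)"] mult_nonneg_nonneg[OF norm_ge_zero norm_ge_zero, of "f p" "g p"]
    unfolding norm_mult by linarith
qed

lemma sq_integrable_cnj: "sq_integrable d f \<Longrightarrow> sq_integrable d (\<lambda>p. cnj (f p))"
  unfolding sq_integrable_def
  by (auto intro: borel_measurable_continuous_on[OF continuous_on_cnj[OF continuous_on_id]])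

lemma sq_integrable_add:
  assumes "sq_integrable d f" "sq_integrable d g"
  shows "sq_integrable d (\<lambda>p. f p + g p)"
  unfolding sq_integrable_def
proof
  show [measurable]: "(\<lambda>p. f p + g p) \<in> borel_measurable borel"
    using assms unfolding sq_integrable_def by auto
  show "set_integrable lborel (square d) (\<lambda>p. (cmod (f p + g p))\<^sup>2)"
  proof (rule set_integrable_bound_square)
    show "set_integrable lborel (square d) (\<lambda>p. 2 * (cmod (f p))\<^sup>2 + 2 * (cmod (g p))\<^sup>2)"
      using assms unfolding sq_integrable_def by (intro set_integral_add) auto
    show "norm ((cmod (f p + g p))\<^sup>2) \<le> 2 * (cmod (f p))\<^sup>2 + 2 * (cmod (g p))\<^sup>2" for p
      using power_mono[OF norm_triangle_ineq[of "f p" "g p"], of 2] sum_squares_bound[of "cmod (f p)" "cmod (g p)"]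
      by (simp add: power2_sum)
  qed measurable
qed

lemma sq_integrable_bounded_mult:
  assumes f: "sq_integrable d f" and [measurable]: "c \<in> borel_measurable borel"
    and "\<And>p. p \<in> square d \<Longrightarrow> cmod (c p) \<le> C"
  shows "sq_integrable d (\<lambda>p. c p * f p)"
  unfolding sq_integrable_def
proof
  have [measurable]: "f \<in> borel_measurable borel" using f by (rule sq_integrable_measurable)
  show "(\<lambda>p. c p * f p) \<in> borel_measurable borel" by measurable
  show "set_integrable lborel (square d) (\<lambda>p. (cmod (c p * f p))\<^sup>2)"
  proof (rule set_integrable_bound_square)
    show "set_integrable lborel (square d) (\<lambda>p. C\<^sup>2 * (cmod (f p))\<^sup>2)"
      using f unfolding sq_integrable_def by auto
    show "norm ((cmod (c p * f p))\<^sup>2) \<le> C\<^sup>2 * (cmod (f p))\<^sup>2" if "p \<in> square d" for p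
      using power_mono[OF assms(3)[OF that], of 2] by (simp add: norm_mult power_mult_distrib mult_right_mono)
  qed measurable
qed

lemma sq_integrable_cmult: "sq_integrable d f \<Longrightarrow> sq_integrable d (\<lambda>p. c * f p)"
  using sq_integrable_bounded_mult[of d f "\<lambda>_. c" "cmod c"] by simp

lemma sq_integrable_cong_AE:
  assumes "sq_integrable d f" "AE p in lborel. g p = f p" "g \<in> borel_measurable borel"
  shows "sq_integrable d g"
  unfolding sq_integrable_def
proof
  have [measurable]: "f \<in> borel_measurable borel" "g \<in> borel_measurable borel"
    using assms sq_integrable_measurable by auto
  have "set_integrable lborel (square d) (\<lambda>p. (cmod (f p))\<^sup>2) \<longleftrightarrow> set_integrable lborel (square d) (\<lambda>p. (cmod (g p))\<^sup>2)"
    unfolding set_integrable_def by (rule integrable_cong_AE) (use assms(2) in auto)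
  then show "set_integrable lborel (square d) (\<lambda>p. (cmod (g p))\<^sup>2)"
    using assms(1) unfolding sq_integrable_def by simp
qed (use assms in auto)

lemma sq_integrable_rep_lincomb:
  assumes "sq_integrable d (rep_aefun u)" "sq_integrable d (rep_aefun v)"
  shows "sq_integrable d (rep_aefun (lincomb \<alpha> u \<beta> v))"
  by (rule sq_integrable_cong_AE[OF sq_integrable_add[OF sq_integrable_cmult sq_integrable_cmult] rep_lincomb])
    (use assms in auto)

text \<open>Square integrability of the square of f is membership in L4; two L4 factors have a
  product in L2.\<close>

lemma sq_integrable_product:
  assumes "sq_integrable d (\<lambda>p. (f p)\<^sup>2)" "sq_integrable d (\<lambda>p. (g p)\<^sup>2)"
    and [measurable]: "f \<in> borel_measurable borel" "g \<in> borel_measurable borel"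
  shows "sq_integrable d (\<lambda>p. f p * g p)"
  unfolding sq_integrable_def
proof
  show "(\<lambda>p. f p * g p) \<in> borel_measurable borel" by measurable
  show "set_integrable lborel (square d) (\<lambda>p. (cmod (f p * g p))\<^sup>2)"
  proof (rule set_integrable_bound_square)
    show "set_integrable lborel (square d) (\<lambda>p. (cmod ((f p)\<^sup>2))\<^sup>2 + (cmod ((g p)\<^sup>2))\<^sup>2)"
      using assms(1,2) unfolding sq_integrable_def by (intro set_integral_add) auto
    show "norm ((cmod (f p * g p))\<^sup>2) \<le> (cmod ((f p)\<^sup>2))\<^sup>2 + (cmod ((g p)\<^sup>2))\<^sup>2" for p
    proof -
      have "(cmod (f p))\<^sup>2 * (cmod (g p))\<^sup>2 \<le> ((cmod (f p))\<^sup>2)\<^sup>2 + ((cmod (g p))\<^sup>2)\<^sup>2"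
        using sum_squares_bound[of "(cmod (f p))\<^sup>2" "(cmod (g p))\<^sup>2"]
          mult_nonneg_nonneg[OF zero_le_power2 zero_le_power2, of "cmod (f p)" "cmod (g p)"] by linarith
      then show ?thesis by (simp add: norm_mult norm_power power_mult_distrib)
    qed
  qed measurable
qed

section \<open>The covariant gradient and the structure of the energy space\<close>

definition cov1 :: "real \<Rightarrow> real \<Rightarrow> aefun \<Rightarrow> real \<times> real \<Rightarrow> complex" where
  "cov1 d \<mu> u p = fst (cov_grad d \<mu> u p)"

definition cov2 :: "real \<Rightarrow> real \<Rightarrow> aefun \<Rightarrow> real \<times> real \<Rightarrow> complex" where
  "cov2 d \<mu> u p = snd (cov_grad d \<mu> u p)"

lemma norm_cov_grad: "(norm (cov_grad d \<mu> u p))\<^sup>2 = (cmod (cov1 d \<mu> u p))\<^sup>2 + (cmod (cov2 d \<mu> u p))\<^sup>2"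
  by (simp add: cov1_def cov2_def norm_prod_def)

lemma vector_potential_measurable [measurable]:
  "(\<lambda>p. fst (vector_potential \<mu> p)) \<in> borel_measurable borel"
  "(\<lambda>p. snd (vector_potential \<mu> p)) \<in> borel_measurable borel"
  by (simp_all add: vector_potential_def)

lemma cov_measurable [measurable]:
  "cov1 d \<mu> u \<in> borel_measurable borel" "cov2 d \<mu> u \<in> borel_measurable borel"
  unfolding cov1_def[abs_def] cov2_def[abs_def] cov_grad_def by simp_all

lemma vector_potential_bound:
  assumes "p \<in> square d"
  shows "cmod (complex_of_real (fst (vector_potential \<mu> p))) \<le> \<bar>\<mu>\<bar> * d"
    "cmod (complex_of_real (snd (vector_potential \<mu> p))) \<le> \<bar>\<mu>\<bar> * d"
proof -
  have "\<bar>fst p\<bar> / 2 \<le> d" "\<bar>snd p\<bar> / 2 \<le> d" using assms by (cases p; auto simp: square_def)+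
  from this[THEN mult_left_mono, of "\<bar>\<mu>\<bar>"]
  show "cmod (complex_of_real (fst (vector_potential \<mu> p))) \<le> \<bar>\<mu>\<bar> * d"
    "cmod (complex_of_real (snd (vector_potential \<mu> p))) \<le> \<bar>\<mu>\<bar> * d"
    unfolding norm_of_real by (simp_all add: vector_potential_def abs_mult)
qed

lemma sq_integrable_cov:
  assumes "sq_integrable d (rep_aefun u)"
    "sq_integrable d (rep_aefun (weak_deriv d (1, 0) u))" "sq_integrable d (rep_aefun (weak_deriv d (0, 1) u))"
  shows "sq_integrable d (cov1 d \<mu> u)" "sq_integrable d (cov2 d \<mu> u)"
proof -
  have 1: "sq_integrable d (\<lambda>p. - \<i> * rep_aefun (weak_deriv d (1, 0) u) p + (- 1) * (of_real (fst (vector_potential \<mu> p)) * rep_aefun u p))"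
    by (intro sq_integrable_add sq_integrable_cmult assms sq_integrable_bounded_mult[of _ _ _ "\<bar>\<mu>\<bar> * d"] vector_potential_bound) auto
  have 2: "sq_integrable d (\<lambda>p. - \<i> * rep_aefun (weak_deriv d (0, 1) u) p + (- 1) * (of_real (snd (vector_potential \<mu> p)) * rep_aefun u p))"
    by (intro sq_integrable_add sq_integrable_cmult assms sq_integrable_bounded_mult[of _ _ _ "\<bar>\<mu>\<bar> * d"] vector_potential_bound) auto
  show "sq_integrable d (cov1 d \<mu> u)" "sq_integrable d (cov2 d \<mu> u)"
    using 1 2 by (simp_all add: cov1_def[abs_def] cov2_def[abs_def] cov_grad_def)
qed

text \<open>The working form of the energy space: \<open>u\<close> in L2 and in L4, gradient in L2.
  From left to right the bounds are read off at \<mu> = 0, where the covariant gradient is the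
  gradient up to a factor of modulus one; the converse for every \<mu> uses that the vector
  potential is bounded on the square.\<close>

lemma energy_space_iff:
  "u \<in> energy_space d \<longleftrightarrow> lives_on_square d u \<and> weakly_differentiable d u
     \<and> sq_integrable d (rep_aefun u) \<and> sq_integrable d (\<lambda>p. (rep_aefun u p)\<^sup>2)
     \<and> sq_integrable d (rep_aefun (weak_deriv d (1, 0) u)) \<and> sq_integrable d (rep_aefun (weak_deriv d (0, 1) u))"
  (is "?L \<longleftrightarrow> ?R")
proof
  assume ?R
  then have sq: "sq_integrable d (rep_aefun u)" "sq_integrable d (\<lambda>p. (rep_aefun u p)\<^sup>2)"
    "sq_integrable d (cov1 d \<mu> u)" "sq_integrable d (cov2 d \<mu> u)" for \<mu>
    using sq_integrable_cov[of d u \<mu>] by auto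
  have "set_integrable lborel (square d) (gibbs_density d \<mu> u)" for \<mu>
  proof -
    have "set_integrable lborel (square d) (\<lambda>p. (- 1) * (cmod (rep_aefun u p))\<^sup>2 + ((1/2) * (cmod ((rep_aefun u p)\<^sup>2))\<^sup>2
       + ((cmod (cov1 d \<mu> u p))\<^sup>2 + (cmod (cov2 d \<mu> u p))\<^sup>2)))"
      using sq(1,2) sq(3,4)[of \<mu>] unfolding sq_integrable_def by (intro set_integral_add set_integrable_mult_right) auto
    moreover have "gibbs_density d \<mu> u = (\<lambda>p. (- 1) * (cmod (rep_aefun u p))\<^sup>2 + ((1/2) * (cmod ((rep_aefun u p)\<^sup>2))\<^sup>2
       + ((cmod (cov1 d \<mu> u p))\<^sup>2 + (cmod (cov2 d \<mu> u p))\<^sup>2)))"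
      by (rule ext) (simp add: gibbs_density_def norm_cov_grad norm_power flip: power_mult)
    ultimately show ?thesis by simp
  qed
  with \<open>?R\<close> show ?L by (auto simp: energy_space_def)
next
  assume ?L
  \<comment> \<open>With t = |u|^2 and squared gradient g, the dominating function is t^2 + (t -
    2)^2 + 4 g, which equals 2 (t - 1)^2 + 2 + 4 g. It therefore bounds t, t^2 and both parts of g
    at once.\<close>
  then have G: "set_integrable lborel (square d) (\<lambda>p. 4 * gibbs_density d 0 u p + 4)"
    by (intro set_integral_add integrable_square_const) (auto simp: energy_space_def)
  have le: "\<bar>(cmod (rep_aefun u p))\<^sup>2\<bar> \<le> 4 * gibbs_density d 0 u p + 4"
    "\<bar>(cmod ((rep_aefun u p)\<^sup>2))\<^sup>2\<bar> \<le> 4 * gibbs_density d 0 u p + 4"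
    "\<bar>(cmod (rep_aefun (weak_deriv d (1, 0) u) p))\<^sup>2\<bar> \<le> 4 * gibbs_density d 0 u p + 4"
    "\<bar>(cmod (rep_aefun (weak_deriv d (0, 1) u) p))\<^sup>2\<bar> \<le> 4 * gibbs_density d 0 u p + 4" for p
  proof -
    define t a b where "t = (cmod (rep_aefun u p))\<^sup>2" and "a = (cmod (rep_aefun (weak_deriv d (1, 0) u) p))\<^sup>2"
      and "b = (cmod (rep_aefun (weak_deriv d (0, 1) u) p))\<^sup>2"
    have "(cmod ((rep_aefun u p)\<^sup>2))\<^sup>2 = t\<^sup>2" "(cmod (rep_aefun u p))^4 = t\<^sup>2"
      by (simp_all add: t_def norm_power flip: power_mult)
    moreover have "(norm (cov_grad d 0 u p))\<^sup>2 = a + b"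
      by (simp add: a_def b_def cov_grad_def vector_potential_def norm_mult norm_prod_def)
    moreover have "0 \<le> (t - 1)\<^sup>2" "0 \<le> (t - 2)\<^sup>2" "a \<ge> 0" "b \<ge> 0" "t \<ge> 0" by (auto simp: t_def a_def b_def)
    moreover have "(t - 1)\<^sup>2 = t\<^sup>2 - 2 * t + 1" "(t - 2)\<^sup>2 = t\<^sup>2 - 4 * t + 4"
      by (simp_all add: power2_eq_square algebra_simps)
    moreover have "0 \<le> t\<^sup>2" by simp
    moreover have "gibbs_density d 0 u p = - t + (cmod (rep_aefun u p))^4 / 2 + (norm (cov_grad d 0 u p))\<^sup>2"
      by (simp add: gibbs_density_def t_def)
    ultimately have "\<bar>t\<bar> \<le> 4 * gibbs_density d 0 u p + 4 \<and> \<bar>(cmod ((rep_aefun u p)\<^sup>2))\<^sup>2\<bar> \<le> 4 * gibbs_density d 0 u p + 4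
      \<and> \<bar>a\<bar> \<le> 4 * gibbs_density d 0 u p + 4 \<and> \<bar>b\<bar> \<le> 4 * gibbs_density d 0 u p + 4"
      by (smt (verit) divide_less_eq_1 field_sum_of_halves)
    then show "\<bar>(cmod (rep_aefun u p))\<^sup>2\<bar> \<le> 4 * gibbs_density d 0 u p + 4"
    "\<bar>(cmod ((rep_aefun u p)\<^sup>2))\<^sup>2\<bar> \<le> 4 * gibbs_density d 0 u p + 4"
    "\<bar>(cmod (rep_aefun (weak_deriv d (1, 0) u) p))\<^sup>2\<bar> \<le> 4 * gibbs_density d 0 u p + 4"
    "\<bar>(cmod (rep_aefun (weak_deriv d (0, 1) u) p))\<^sup>2\<bar> \<le> 4 * gibbs_density d 0 u p + 4"
      by (auto simp: t_def a_def b_def)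
  qed
  show ?R
    using \<open>?L\<close> unfolding sq_integrable_def
    by (intro conjI set_integrable_bound_square[OF G]) (use le in \<open>auto simp: energy_space_def\<close>)
qed

lemma energy_spaceD:
  assumes "u \<in> energy_space d"
  shows "lives_on_square d u" "weakly_differentiable d u"
    "sq_integrable d (rep_aefun u)" "sq_integrable d (\<lambda>p. (rep_aefun u p)\<^sup>2)"
    "sq_integrable d (rep_aefun (weak_deriv d (1, 0) u))" "sq_integrable d (rep_aefun (weak_deriv d (0, 1) u))"
    "sq_integrable d (cov1 d \<mu> u)" "sq_integrable d (cov2 d \<mu> u)"
  using assms sq_integrable_cov[of d u \<mu>] unfolding energy_space_iff by auto

lemma energy_space_lincomb:
  assumes u: "u \<in> energy_space d" and v: "v \<in> energy_space d"
  shows "lincomb \<alpha> u \<beta> v \<in> energy_space d"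
proof -
  note U = energy_spaceD[OF u] and V = energy_spaceD[OF v]
  have "sq_integrable d (\<lambda>p. (rep_aefun (lincomb \<alpha> u \<beta> v) p)\<^sup>2)"
  proof (rule sq_integrable_cong_AE)
    show "sq_integrable d (\<lambda>p. \<alpha>\<^sup>2 * (rep_aefun u p)\<^sup>2 + (\<beta>\<^sup>2 * (rep_aefun v p)\<^sup>2 + (2 * \<alpha> * \<beta>) * (rep_aefun u p * rep_aefun v p)))"
      by (intro sq_integrable_add sq_integrable_cmult sq_integrable_product U V rep_measurable)
    show "AE p in lborel. (rep_aefun (lincomb \<alpha> u \<beta> v) p)\<^sup>2 =
       \<alpha>\<^sup>2 * (rep_aefun u p)\<^sup>2 + (\<beta>\<^sup>2 * (rep_aefun v p)\<^sup>2 + (2 * \<alpha> * \<beta>) * (rep_aefun u p * rep_aefun v p))"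
      using rep_lincomb[of \<alpha> u \<beta> v] by eventually_elim (simp add: power2_eq_square algebra_simps)
  qed measurable
  then show ?thesis
    unfolding energy_space_iff
    using U V weakly_differentiable_lincomb[OF U(2) V(2)] lives_on_square_lincomb[OF U(1) V(1)]
    by (auto intro!: sq_integrable_rep_lincomb)
qed

lemma cov_lincomb:
  assumes u: "u \<in> energy_space d" and v: "v \<in> energy_space d"
  shows "AE p in lborel. cov1 d \<mu> (lincomb \<alpha> u \<beta> v) p = \<alpha> * cov1 d \<mu> u p + \<beta> * cov1 d \<mu> v p
     \<and> cov2 d \<mu> (lincomb \<alpha> u \<beta> v) p = \<alpha> * cov2 d \<mu> u p + \<beta> * cov2 d \<mu> v p"
  unfolding cov1_def cov2_def cov_grad_def
    weakly_differentiable_lincomb(2,3)[OF energy_spaceD(2)[OF u] energy_spaceD(2)[OF v]]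
  using rep_lincomb[of \<alpha> u \<beta> v] rep_lincomb[of \<alpha> "weak_deriv d (1, 0) u" \<beta> "weak_deriv d (1, 0) v"]
    rep_lincomb[of \<alpha> "weak_deriv d (0, 1) u" \<beta> "weak_deriv d (0, 1) v"]
  by eventually_elim (simp add: algebra_simps)

subsection \<open>Finitely many functionals control the L2 norm\<close>

text \<open>The zero set of one functional has codimension at most one in \<open>V\<close>, so each
  functional costs at most one spanning vector. Linearity is asked on \<open>V\<close> alone, since
  integrals with a default value are additive only where they converge.\<close>

lemma finite_span_if_functionals_separate:
  fixes V :: "'a::real_vector set" and F :: "('a \<Rightarrow> real) set"
  assumes "finite F" "subspace V"
    and "\<And>f u v. f \<in> F \<Longrightarrow> u \<in> V \<Longrightarrow> v \<in> V \<Longrightarrow> f (u + v) = f u + f v"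
    and "\<And>f u r. f \<in> F \<Longrightarrow> u \<in> V \<Longrightarrow> f (r *\<^sub>R u) = r * f u"
    and "\<And>u. u \<in> V \<Longrightarrow> \<forall>f\<in>F. f u = 0 \<Longrightarrow> u = 0"
  shows "\<exists>B. finite B \<and> V \<subseteq> span B"
  using assms
proof (induction F arbitrary: V rule: finite_induct)
  case empty
  then show ?case by (intro exI[of _ "{0}"]) (auto simp: span_zero)
next
  case (insert f F)
  let ?V = "{u \<in> V. f u = 0}"
  have f0: "f 0 = 0" using insert.prems(3)[of f 0 0] subspace_0[OF insert.prems(1)] by simp
  have "subspace ?V"
    unfolding subspace_def
    using insert.prems(1) insert.prems(2,3)[of f] f0
    by (auto simp: subspace_0 subspace_add subspace_scale)
  moreover have "u = 0" if "u \<in> ?V" "\<forall>f\<in>F. f u = 0" for u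
    using that insert.prems(4)[of u] by auto
  ultimately obtain B where B: "finite B" "?V \<subseteq> span B"
    using insert.IH[of ?V] insert.prems(2,3) by auto
  show ?case
  proof (cases "\<forall>v\<in>V. f v = 0")
    case True
    then show ?thesis using B by auto
  next
    case False
    then obtain v where v: "v \<in> V" "f v \<noteq> 0" by auto
    have "V \<subseteq> span (insert v B)"
    proof
      fix u assume u: "u \<in> V"
      let ?w = "u + (- (f u / f v)) *\<^sub>R v"
      have vV: "(- (f u / f v)) *\<^sub>R v \<in> V" using subspace_scale[OF insert.prems(1) v(1)] .
      have "?w \<in> V" using subspace_add[OF insert.prems(1) u vV] .
      moreover have "f ?w = 0"
      proof -
        have "f ?w = f u + f ((- (f u / f v)) *\<^sub>R v)" by (rule insert.prems(2)[OF _ u vV]) simp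
        also have "f ((- (f u / f v)) *\<^sub>R v) = - (f u / f v) * f v" by (rule insert.prems(3)[OF _ v(1)]) simp
        finally show ?thesis using v(2) by simp
      qed
      ultimately have "?w \<in> span (insert v B)" using B(2) span_mono[of B "insert v B"] by auto
      moreover have "(f u / f v) *\<^sub>R v \<in> span (insert v B)" by (intro span_scale span_base) simp
      ultimately have "?w + (f u / f v) *\<^sub>R v \<in> span (insert v B)" by (rule span_add)
      then show "u \<in> span (insert v B)" by simp
    qed
    with B(1) show ?thesis by blast
  qed
qed

text \<open>A basis of K' stays independent when x is added and still fits into K. The map f
  transports the smaller space into another type, here the product with the real line. Finite
  dimension of K is essential: a proper subspace of an infinite-dimensional space may have the same
  \<open>edim\<close>.\<close>

lemma edim_less:
  fixes f :: "'a::real_vector \<Rightarrow> 'b::real_vector"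
  assumes K: "subspace K" "finite B0" "K \<subseteq> span B0" and K': "subspace K'" "K' \<subseteq> K"
    and x: "x \<in> K" "x \<notin> K'" and f: "linear f" "inj f"
  shows "edim (f ` K') < edim K"
proof -
  obtain B where B: "B \<subseteq> K'" "independent B" "K' \<subseteq> span B" "card B = dim K'"
    using basis_exists by blast
  have finB: "finite B" using independent_span_bound[OF K(2) B(2)] B(1) K'(2) K(3) by blast
  obtain C where C: "C \<subseteq> K" "independent C" "K \<subseteq> span C" "card C = dim K"
    using basis_exists by blast
  have finC: "finite C" using independent_span_bound[OF K(2) C(2)] C(1) K(3) by blast
  have "span B \<subseteq> K'" using B(1) K'(1) by (rule span_minimal)
  then have x: "x \<notin> span B" using x(2) by blast
  then have "independent (insert x B)" using B(2) by (simp add: independent_insertI)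
  moreover have "insert x B \<subseteq> span C" using assms(6) B(1) K'(2) C(3) by blast
  ultimately have "card (insert x B) \<le> card C" using independent_span_bound[OF finC] by blast
  moreover have "x \<notin> B" using x span_base by blast
  ultimately have "card B < card C" using finB by simp
  moreover have "dim (f ` K') = card (f ` B)"
  proof (rule dim_unique)
    show "f ` B \<subseteq> f ` K'" using B(1) by blast
    show "f ` K' \<subseteq> span (f ` B)" using B(3) by (auto simp: linear_span_image[OF f(1)])
    show "independent (f ` B)"
      using B(2) f by (intro linear_independent_injective_image) (auto intro: inj_on_subset)
  qed simp
  moreover have "card (f ` B) = card B" using f(2) by (intro card_image) (auto intro: inj_on_subset)
  moreover have "f ` K' \<subseteq> span (f ` B)" using B(3) by (auto simp: linear_span_image[OF f(1)])
  then have "edim (f ` K') = enat (dim (f ` K'))" using finB unfolding edim_def by auto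
  moreover have "edim K = enat (dim K)" using K unfolding edim_def by auto
  ultimately show ?thesis using C(4) by simp
qed

text \<open>Disjointness of the open pieces gives the bound everywhere; equality can fail only at
  grid points, which form a null set.\<close>

lemma sum_indicator_subintervals:
  fixes a h x :: real
  assumes "h > 0"
  shows "(\<Sum>i<N. indicator {a + real i * h<..<a + real i * h + h} x) \<le> (indicator {a<..<a + real N * h} x :: ennreal)"
    and "x \<notin> (\<lambda>i. a + real i * h) ` {..N} \<Longrightarrow>
      (\<Sum>i<N. indicator {a + real i * h<..<a + real i * h + h} x) = (indicator {a<..<a + real N * h} x :: ennreal)"
proof -
  have e: "a + real (Suc N) * h = a + real N * h + h" for N by (simp add: algebra_simps)
  have le: "0 \<le> real N * h" for N using assms by simp
  have le_step: "(indicator {a<..<a + t} x + indicator {a + t<..<a + t + h} x :: ennreal) \<le> indicator {a<..<a + t + h} x"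
    if "0 \<le> t" for t using that assms by (auto simp: indicator_def)
  have eq_step: "(indicator {a<..<a + t} x + indicator {a + t<..<a + t + h} x :: ennreal) = indicator {a<..<a + t + h} x"
    if "0 \<le> t" "x \<noteq> a + t" for t using that assms by (auto simp: indicator_def)
  show "(\<Sum>i<N. indicator {a + real i * h<..<a + real i * h + h} x) \<le> (indicator {a<..<a + real N * h} x :: ennreal)"
  proof (induction N)
    case (Suc N)
    have "(\<Sum>i<Suc N. indicator {a + real i * h<..<a + real i * h + h} x)
        \<le> (indicator {a<..<a + real N * h} x + indicator {a + real N * h<..<a + real N * h + h} x :: ennreal)"
      using Suc by (simp add: add_right_mono)
    also have "\<dots> \<le> indicator {a<..<a + real (Suc N) * h} x"
      unfolding e by (rule le_step[OF le])
    finally show ?case .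
  qed simp
  show "(\<Sum>i<N. indicator {a + real i * h<..<a + real i * h + h} x) = (indicator {a<..<a + real N * h} x :: ennreal)"
    if "x \<notin> (\<lambda>i. a + real i * h) ` {..N}"
    using that
  proof (induction N)
    case (Suc N)
    then have "x \<noteq> a + real N * h" "x \<notin> (\<lambda>i. a + real i * h) ` {..N}" by auto
    then have "(\<Sum>i<Suc N. indicator {a + real i * h<..<a + real i * h + h} x)
        = (indicator {a<..<a + real N * h} x + indicator {a + real N * h<..<a + real N * h + h} x :: ennreal)"
      using Suc.IH by simp
    also have "\<dots> = indicator {a<..<a + real (Suc N) * h} x"
      unfolding e by (rule eq_step[OF le \<open>x \<noteq> a + real N * h\<close>])
    finally show ?case .
  qed simp
qed

text \<open>One fixed bump of mass m on the unit interval is moved and rescaled. As it is at most 1,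
  the rescaled weight is at most 1 / (m h), so M = 1 / m serves every cell of every size.\<close>

lemma cell_bump_exists:
  "\<exists>M \<ge> 0. \<forall>a h. h > 0 \<longrightarrow> (\<exists>\<rho>. cell_bump a h M \<rho>)"
proof -
  let ?b = "bump 1 (1/4) (3/4)"
  define m where "m = integral\<^sup>L lborel ?b"
  have sb: "smooth_bump_on 0 1 ?b" by (rule bump_smooth) auto
  have ib: "integrable lborel ?b" using sb by (rule smooth_bump_on_integrable)
  have "m \<noteq> 0"
  proof
    assume "m = 0"
    then have "AE x in lborel. ?b x = 0"
      using integral_nonneg_eq_0_iff_AE[OF ib] bump_nonneg unfolding m_def by simp
    then have "AE x in lborel. x \<notin> {1/4<..<3/4::real}"
    proof eventually_elim
      case (elim x)
      then show ?case using bump_pos[of 1 "1/4" x "3/4"] by auto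
    qed
    then have "emeasure lborel {1/4<..<3/4::real} = 0"
      by (subst (asm) AE_iff_measurable[of "{1/4<..<3/4}"]) auto
    then show False by simp
  qed
  moreover have "m \<ge> 0" unfolding m_def by (intro integral_nonneg_AE) (simp add: bump_nonneg)
  ultimately have m: "m > 0" by simp
  have "cell_bump a h (1 / m) (\<lambda>x. ?b ((x - a) / h) / (m * h))" if h: "h > 0" for a h
  proof
    let ?\<rho> = "\<lambda>x. ?b ((x - a) / h) / (m * h)"
    show "smooth_bump_on a (a + h) ?\<rho>"
    proof (rule smooth_bump_onI)
      have "smooth_upto n (\<lambda>x. ?b ((1 / h) * x + (- a / h)) * (1 / (m * h)))" for n
      proof (rule smooth_upto_mult[OF smooth_upto_affine smooth_upto_const])
        show "smooth_upto n ?b" using sb unfolding smooth_bump_on_def by simp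
      qed
      then show "smooth_upto n ?\<rho>" for n by (simp add: diff_divide_distrib)
      show "a < a + h / 4" "a + 3 * h / 4 < a + h" using h by auto
      show "?\<rho> x = 0" if "x \<notin> {a + h / 4..a + 3 * h / 4}" for x
      proof -
        have "(x - a) / h \<notin> {1/4..3/4}"
          using that h by (auto simp: pos_le_divide_eq pos_divide_le_eq)
        then show ?thesis by (simp add: bump_outside)
      qed
    qed
    show "?\<rho> x \<ge> 0" for x using m h by (simp add: bump_nonneg)
    show "?\<rho> x \<le> 1 / m / h" for x using m h by (simp add: bump_le_1 divide_right_mono)
    have m_eq: "m = \<bar>1 / h\<bar> *\<^sub>R (\<integral>x. ?b (- a / h + (1 / h) * x) \<partial>lborel)"
      unfolding m_def by (rule lborel_integral_real_affine) (use h in simp)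
    have "- a / h + (1 / h) * x = (x - a) / h" for x by (simp add: diff_divide_distrib)
    then have mh: "(\<integral>x. ?b ((x - a) / h) \<partial>lborel) = m * h" using m_eq h by simp
    have "integral\<^sup>L lborel ?\<rho> = (\<integral>x. ?b ((x - a) / h) \<partial>lborel) / (m * h)" by simp
    also have "\<dots> = 1" unfolding mh using m h by simp
    finally show "integral\<^sup>L lborel ?\<rho> = 1" .
  qed (use h in simp)
  then show ?thesis using m by (intro exI[of _ "1 / m"]) auto
qed

lemma sq_integrable_integrable:
  assumes "sq_integrable d f"
  shows "set_integrable lborel (square d) f"
proof (rule set_integrable_bound_square)
  show "set_integrable lborel (square d) (\<lambda>p. (cmod (f p))\<^sup>2 + 1)"
    using assms unfolding sq_integrable_def by (intro set_integral_add integrable_square_const) auto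
  show "norm (f p) \<le> (cmod (f p))\<^sup>2 + 1" for p
  proof -
    have "(cmod (f p) - 1)\<^sup>2 = (cmod (f p))\<^sup>2 - 2 * cmod (f p) + 1"
      by (simp add: power2_eq_square algebra_simps)
    then show ?thesis using zero_le_power2[of "cmod (f p) - 1"] norm_ge_zero[of "f p"] by linarith
  qed
qed (use assms in \<open>auto simp: sq_integrable_def\<close>)

text \<open>Bumps and their derivatives vanish outside the rectangle, so the integrals over the
  square can be cut off to it. This puts \<open>has_weak_deriv\<close> into the form required by
  \<open>poincare_cell\<close>.\<close>

lemma weak_identity_tensor:
  assumes w: "has_weak_deriv d e u g" and e: "e = (1, 0) \<or> e = (0, 1)"
    and b: "smooth_bump_on l1 r1 b" and b': "\<And>x. (b has_real_derivative b' x) (at x)"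
    and k: "smooth_bump_on l2 r2 k" and k': "\<And>x. (k has_real_derivative k' x) (at x)"
    and sub: "{l1<..<r1} \<times> {l2<..<r2} \<subseteq> square d"
  shows "(\<integral>p. (indicat_real ({l1<..<r1} \<times> {l2<..<r2}) p *\<^sub>R rep_aefun u p) * of_real (if e = (1, 0) then b' (fst p) * k (snd p) else b (fst p) * k' (snd p)) \<partial>lborel)
    = - (\<integral>p. (indicat_real ({l1<..<r1} \<times> {l2<..<r2}) p *\<^sub>R rep_aefun g p) * of_real (b (fst p) * k (snd p)) \<partial>lborel)"
proof -
  \<comment> \<open>The derivatives are given only as functions; uniqueness identifies them with
    those of \<open>smooth_bump_on_deriv\<close>, so they too are supported in the
    rectangle.\<close>
  have sb': "smooth_bump_on l1 r1 b'" and sk': "smooth_bump_on l2 r2 k'"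
  proof -
    obtain b2 where "smooth_bump_on l1 r1 b2" "\<And>x. (b has_real_derivative b2 x) (at x)"
      using smooth_bump_on_deriv[OF b] by metis
    moreover have "b2 = b'" using DERIV_unique[OF calculation(2) b'] by (rule ext)
    ultimately show "smooth_bump_on l1 r1 b'" by simp
    obtain k2 where "smooth_bump_on l2 r2 k2" "\<And>x. (k has_real_derivative k2 x) (at x)"
      using smooth_bump_on_deriv[OF k] by metis
    moreover have "k2 = k'" using DERIV_unique[OF calculation(2) k'] by (rule ext)
    ultimately show "smooth_bump_on l2 r2 k'" by simp
  qed
  have cut: "(LINT p:square d|lborel. f p * complex_of_real (c (fst p) * c' (snd p)))
    = (\<integral>p. (indicat_real ({l1<..<r1} \<times> {l2<..<r2}) p *\<^sub>R f p) * complex_of_real (c (fst p) * c' (snd p)) \<partial>lborel)"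
    if c: "smooth_bump_on l1 r1 c" and c': "smooth_bump_on l2 r2 c'" for c c' f
    unfolding set_integral_square_eq[OF c c' sub]
    by (intro Bochner_Integration.integral_cong)
      (auto simp: indicator_def mem_Times_iff smooth_bump_on_outside[OF c] smooth_bump_on_outside[OF c'])
  have t: "test_function d (\<lambda>p. b (fst p) * k (snd p))" using b k sub by (rule test_function_tensor)
  have "(LINT p:square d|lborel. rep_aefun u p * of_real (frechet_derivative (\<lambda>p. b (fst p) * k (snd p)) (at p) e))
        = - (LINT p:square d|lborel. rep_aefun g p * of_real (b (fst p) * k (snd p)))"
    using w t unfolding has_weak_deriv_def by auto
  moreover have "frechet_derivative (\<lambda>p. b (fst p) * k (snd p)) (at p) e =
      (if e = (1, 0) then b' (fst p) * k (snd p) else b (fst p) * k' (snd p))" for p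
    using e by (auto simp: frechet_derivative_tensor[OF b' k'])
  ultimately show ?thesis
    using cut[OF b k] cut[OF sb' k] cut[OF b sk'] e by auto
qed

text \<open>For weights \<open>r\<close>, \<open>s\<close> of two grid intervals this is the
  weighted mean over their cell, the weights being zero elsewhere in the square.\<close>

definition cell_functional :: "real \<Rightarrow> (real \<Rightarrow> real) \<Rightarrow> (real \<Rightarrow> real) \<Rightarrow> aefun \<Rightarrow> complex" where
  "cell_functional d r s u = (LINT p:square d|lborel. rep_aefun u p * of_real (r (fst p) * s (snd p)))"

lemma poincare_on_cell:
  assumes u: "u \<in> energy_space d" and r: "cell_bump a1 h M r" and s: "cell_bump a2 h M s"
    and sub: "{a1<..<a1 + h} \<times> {a2<..<a2 + h} \<subseteq> square d"
    and z: "cell_functional d r s u = 0" and M: "M \<ge> 0"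
  defines "g1 \<equiv> rep_aefun (weak_deriv d (1, 0) u)" and "g2 \<equiv> rep_aefun (weak_deriv d (0, 1) u)"
    and "Q \<equiv> {a1<..<a1 + h} \<times> {a2<..<a2 + h}"
  shows "(\<integral>\<^sup>+p. indicator Q p * ennreal ((cmod (rep_aefun u p))\<^sup>2) \<partial>lborel) \<le>
     ennreal (2 * (M + 1) * h\<^sup>2) * (\<integral>\<^sup>+p. indicator Q p * ennreal ((cmod (g1 p))\<^sup>2 + (cmod (g2 p))\<^sup>2) \<partial>lborel)"
proof -
  interpret R: cell_bump a1 h M r by (rule r)
  interpret S: cell_bump a2 h M s by (rule s)
  note U = energy_spaceD[OF u]
  have Q[measurable]: "Q \<in> sets borel" unfolding Q_def by (intro borel_Times) auto
  have [measurable]: "g1 \<in> borel_measurable borel" "g2 \<in> borel_measurable borel"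
    unfolding g1_def g2_def by measurable
  have int: "integrable lborel (\<lambda>p. indicat_real Q p *\<^sub>R f p)" if "sq_integrable d f" for f
    using set_integrable_subset[OF sq_integrable_integrable[OF that], of Q] sub Q
    unfolding set_integrable_def Q_def by auto
  interpret poincare_cell a1 a2 h M r s "\<lambda>p. indicat_real Q p *\<^sub>R rep_aefun u p"
    "\<lambda>p. indicat_real Q p *\<^sub>R g1 p" "\<lambda>p. indicat_real Q p *\<^sub>R g2 p"
  proof
    show "integrable lborel (\<lambda>p. indicat_real Q p *\<^sub>R rep_aefun u p)"
      "integrable lborel (\<lambda>p. indicat_real Q p *\<^sub>R g1 p)" "integrable lborel (\<lambda>p. indicat_real Q p *\<^sub>R g2 p)"
      unfolding g1_def g2_def by (intro int U)+
    show "indicat_real Q (x, y) *\<^sub>R rep_aefun u (x, y) = 0 \<and> indicat_real Q (x, y) *\<^sub>R g1 (x, y) = 0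
       \<and> indicat_real Q (x, y) *\<^sub>R g2 (x, y) = 0" if "\<not> (a1 < x \<and> x < a1 + h \<and> a2 < y \<and> y < a2 + h)" for x y
      using that by (auto simp: Q_def indicator_def)
    show "(\<integral>p. indicat_real Q p *\<^sub>R rep_aefun u p * of_real (b' (fst p) * k (snd p)) \<partial>lborel)
       = - (\<integral>p. indicat_real Q p *\<^sub>R g1 p * of_real (b (fst p) * k (snd p)) \<partial>lborel)"
      if b: "smooth_bump_on a1 (a1 + h) b" "\<And>x. (b has_real_derivative b' x) (at x)"
        and k: "smooth_bump_on a2 (a2 + h) k" for b b' k
    proof -
      obtain k' where "\<And>x. (k has_real_derivative k' x) (at x)" using smooth_bump_on_deriv[OF k] by metis
      from weak_identity_tensor[OF weakly_differentiableD(1)[OF U(2)] _ b k this sub]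
      show ?thesis by (simp add: Q_def g1_def)
    qed
    show "(\<integral>p. indicat_real Q p *\<^sub>R rep_aefun u p * of_real (b (fst p) * k' (snd p)) \<partial>lborel)
       = - (\<integral>p. indicat_real Q p *\<^sub>R g2 p * of_real (b (fst p) * k (snd p)) \<partial>lborel)"
      if b: "smooth_bump_on a1 (a1 + h) b"
        and k: "smooth_bump_on a2 (a2 + h) k" "\<And>x. (k has_real_derivative k' x) (at x)" for b k k'
    proof -
      obtain b' where "\<And>x. (b has_real_derivative b' x) (at x)" using smooth_bump_on_deriv[OF b] by metis
      from weak_identity_tensor[OF weakly_differentiableD(2)[OF U(2)] _ b this k sub]
      show ?thesis by (simp add: Q_def g2_def)
    qed
    have "(\<integral>p. indicat_real Q p *\<^sub>R rep_aefun u p * of_real (r (fst p) * s (snd p)) \<partial>lborel)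
       = (\<integral>p. rep_aefun u p * of_real (r (fst p) * s (snd p)) \<partial>lborel)"
      by (intro Bochner_Integration.integral_cong)
        (auto simp: indicator_def Q_def mem_Times_iff smooth_bump_on_outside[OF R.\<rho>] smooth_bump_on_outside[OF S.\<rho>])
    then show "(\<integral>p. indicat_real Q p *\<^sub>R rep_aefun u p * of_real (r (fst p) * s (snd p)) \<partial>lborel) = 0"
      using z set_integral_square_eq[OF R.\<rho> S.\<rho> sub] by (simp add: cell_functional_def)
  qed
  have norm: "ennreal ((norm (indicat_real Q p *\<^sub>R z))\<^sup>2) = indicator Q p * ennreal ((cmod z)\<^sup>2)" for p z
    by (auto simp: indicator_def)
  have "(\<integral>\<^sup>+p. indicator Q p * ennreal ((cmod (rep_aefun u p))\<^sup>2) \<partial>lborel) \<le>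
     ennreal (2 * h\<^sup>2) * (\<integral>\<^sup>+p. indicator Q p * ennreal ((cmod (g1 p))\<^sup>2) \<partial>lborel)
   + ennreal (2 * M * h\<^sup>2) * (\<integral>\<^sup>+p. indicator Q p * ennreal ((cmod (g2 p))\<^sup>2) \<partial>lborel)"
    using poincare unfolding norm .
  \<comment> \<open>M + 1 dominates both 1 and M, which merges the two constants of
    \<open>poincare\<close>.\<close>
  also have "\<dots> \<le> ennreal (2 * (M + 1) * h\<^sup>2) * (\<integral>\<^sup>+p. indicator Q p * ennreal ((cmod (g1 p))\<^sup>2) \<partial>lborel)
   + ennreal (2 * (M + 1) * h\<^sup>2) * (\<integral>\<^sup>+p. indicator Q p * ennreal ((cmod (g2 p))\<^sup>2) \<partial>lborel)"
    using M by (intro add_mono mult_right_mono ennreal_leI) auto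
  also have "\<dots> = ennreal (2 * (M + 1) * h\<^sup>2) *
     ((\<integral>\<^sup>+p. indicator Q p * ennreal ((cmod (g1 p))\<^sup>2) \<partial>lborel) + (\<integral>\<^sup>+p. indicator Q p * ennreal ((cmod (g2 p))\<^sup>2) \<partial>lborel))"
    by (simp add: distrib_left)
  also have "(\<integral>\<^sup>+p. indicator Q p * ennreal ((cmod (g1 p))\<^sup>2) \<partial>lborel) + (\<integral>\<^sup>+p. indicator Q p * ennreal ((cmod (g2 p))\<^sup>2) \<partial>lborel)
     = (\<integral>\<^sup>+p. indicator Q p * ennreal ((cmod (g1 p))\<^sup>2 + (cmod (g2 p))\<^sup>2) \<partial>lborel)"
    by (subst nn_integral_add[symmetric]) (auto simp: distrib_left)
  finally show ?thesis .
qed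

text \<open>The cell estimates are added up. On the left the cells must fill the square up to a null
  set; on the right it suffices that they are disjoint and contained in it.\<close>

lemma poincare_on_square:
  assumes "d > 0" "N > 0" and u: "u \<in> energy_space d" and M: "M \<ge> 0"
  defines "h \<equiv> d / real N" and "a \<equiv> \<lambda>i. - d / 2 + real i * (d / real N)"
  assumes r: "\<And>i. i < N \<Longrightarrow> cell_bump (a i) h M (r i)"
    and z: "\<And>i j. i < N \<Longrightarrow> j < N \<Longrightarrow> cell_functional d (r i) (r j) u = 0"
  defines "g1 \<equiv> rep_aefun (weak_deriv d (1, 0) u)" and "g2 \<equiv> rep_aefun (weak_deriv d (0, 1) u)"
  shows "(\<integral>\<^sup>+p. indicator (square d) p * ennreal ((cmod (rep_aefun u p))\<^sup>2) \<partial>lborel) \<le>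
     ennreal (2 * (M + 1) * h\<^sup>2) * (\<integral>\<^sup>+p. indicator (square d) p * ennreal ((cmod (g1 p))\<^sup>2 + (cmod (g2 p))\<^sup>2) \<partial>lborel)"
proof -
  have h: "h > 0" using assms(1,2) by (simp add: h_def)
  have Nh: "- d / 2 + real N * h = d / 2" using assms(2) by (simp add: h_def field_simps)
  let ?I = "\<lambda>i. {a i<..<a i + h}"
  let ?Q = "\<lambda>i j. ?I i \<times> ?I j"
  have Q[measurable]: "?Q i j \<in> sets borel" for i j by (intro borel_Times) auto
  have [measurable]: "g1 \<in> borel_measurable borel" "g2 \<in> borel_measurable borel"
    unfolding g1_def g2_def by measurable
  have sum_eq: "(\<Sum>i<N. \<Sum>j<N. indicator (?Q i j) p :: ennreal) = (\<Sum>i<N. indicator (?I i) (fst p)) * (\<Sum>j<N. indicator (?I j) (snd p))" for p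
    unfolding sum_product by (intro sum.cong refl) (auto simp: indicator_def mem_Times_iff)
  have sq_eq: "indicator (square d) p = (indicator {- d / 2<..<d / 2} (fst p) * indicator {- d / 2<..<d / 2} (snd p) :: ennreal)" for p
    by (auto simp: square_def indicator_def mem_Times_iff)
  have le: "(\<Sum>i<N. \<Sum>j<N. indicator (?Q i j) p) \<le> (indicator (square d) p :: ennreal)" for p
    unfolding sum_eq sq_eq
    using sum_indicator_subintervals(1)[OF h, of "- d / 2" _ N, unfolded Nh]
    by (intro mult_mono) (auto simp: a_def h_def)
  have ge: "AE p in lborel. (\<Sum>i<N. \<Sum>j<N. indicator (?Q i j) p) = (indicator (square d) p :: ennreal)"
  proof -
    let ?G = "(\<lambda>i. - d / 2 + real i * h) ` {..N}"
    have "AE x in lborel. x \<notin> ?G"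
      by (rule AE_not_in) (simp add: finite_imp_null_set_lborel)
    from AE_lborel_fst[OF this] AE_lborel_snd[OF this] show ?thesis
    proof eventually_elim
      case (elim p)
      then show ?case
        unfolding sum_eq sq_eq
        using sum_indicator_subintervals(2)[OF h, of _ "- d / 2" N, unfolded Nh]
        by (simp add: a_def h_def)
    qed
  qed
  have sub: "?Q i j \<subseteq> square d" if "i < N" "j < N" for i j
  proof
    fix p assume p: "p \<in> ?Q i j"
    \<comment> \<open>Containment of a cell is read off from \<open>le\<close>: a point of the cell
      already contributes 1 to the double sum.\<close>
    have "(1::ennreal) = indicator (?Q i j) p" using p by simp
    also have "\<dots> \<le> (\<Sum>j<N. indicator (?Q i j) p)" by (rule member_le_sum) (use that in auto)
    also have "\<dots> \<le> (\<Sum>i<N. \<Sum>j<N. indicator (?Q i j) p)"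
      by (rule member_le_sum[of i "{..<N}" "\<lambda>i. \<Sum>j<N. indicator (?Q i j) p"]) (use that in auto)
    also have "\<dots> \<le> indicator (square d) p" by (rule le)
    finally show "p \<in> square d" by (cases "p \<in> square d") auto
  qed
  let ?C = "ennreal (2 * (M + 1) * h\<^sup>2)" and ?g = "\<lambda>p. ennreal ((cmod (g1 p))\<^sup>2 + (cmod (g2 p))\<^sup>2)"
  have nn_sum: "(\<integral>\<^sup>+p. (\<Sum>i<N. \<Sum>j<N. indicator (?Q i j) p * f p) \<partial>lborel)
     = (\<Sum>i<N. \<Sum>j<N. (\<integral>\<^sup>+p. indicator (?Q i j) p * f p \<partial>lborel))" if [measurable]: "f \<in> borel_measurable borel" for f
  proof -
    have meas: "(\<lambda>p. indicator (?Q i j) p * f p) \<in> borel_measurable lborel" for i j by measurable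
    show ?thesis
      by (subst nn_integral_sum, intro borel_measurable_sum meas, intro sum.cong refl nn_integral_sum meas)
  qed
  have "(\<integral>\<^sup>+p. indicator (square d) p * ennreal ((cmod (rep_aefun u p))\<^sup>2) \<partial>lborel)
     = (\<integral>\<^sup>+p. (\<Sum>i<N. \<Sum>j<N. indicator (?Q i j) p * ennreal ((cmod (rep_aefun u p))\<^sup>2)) \<partial>lborel)"
    by (rule nn_integral_cong_AE) (use ge in \<open>eventually_elim, simp only: sum_distrib_right[symmetric]\<close>)
  also have "\<dots> = (\<Sum>i<N. \<Sum>j<N. (\<integral>\<^sup>+p. indicator (?Q i j) p * ennreal ((cmod (rep_aefun u p))\<^sup>2) \<partial>lborel))"
    by (rule nn_sum) measurable
  also have "\<dots> \<le> (\<Sum>i<N. \<Sum>j<N. ?C * (\<integral>\<^sup>+p. indicator (?Q i j) p * ?g p \<partial>lborel))"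
    unfolding g1_def g2_def
    by (intro sum_mono poincare_on_cell[OF u r r sub z M]) auto
  also have "\<dots> = ?C * (\<integral>\<^sup>+p. (\<Sum>i<N. \<Sum>j<N. indicator (?Q i j) p * ?g p) \<partial>lborel)"
    unfolding sum_distrib_left[symmetric] by (subst nn_sum) auto
  also have "\<dots> \<le> ?C * (\<integral>\<^sup>+p. indicator (square d) p * ?g p \<partial>lborel)"
    unfolding sum_distrib_right[symmetric] by (intro mult_left_mono nn_integral_mono mult_right_mono le) auto
  finally show ?thesis .
qed

subsection \<open>The Jacobian and its kernel\<close>

text \<open>Collecting everything in one integrand reduces linearity, symmetry and coercivity of the
  Jacobian to pointwise identities and inequalities.\<close>

definition jac_density ::
  "real \<Rightarrow> real \<Rightarrow> aefun \<Rightarrow> aefun \<Rightarrow> aefun \<Rightarrow> real \<times> real \<Rightarrow> complex" where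
  "jac_density d \<mu> \<psi> \<phi> \<xi> p =
     cnj (cov1 d \<mu> \<xi> p) * cov1 d \<mu> \<phi> p + cnj (cov2 d \<mu> \<xi> p) * cov2 d \<mu> \<phi> p
     + cnj (rep_aefun \<xi> p) * ((- 1 + 2 * of_real ((cmod (rep_aefun \<psi> p))\<^sup>2)) * rep_aefun \<phi> p
           + (rep_aefun \<psi> p)\<^sup>2 * cnj (rep_aefun \<phi> p))"

lemma cnj_measurable [measurable]: "cnj \<in> borel_measurable borel"
  by (intro borel_measurable_continuous_onI continuous_intros)

lemma set_integrable_magnetic:
  assumes "\<phi> \<in> energy_space d" "\<xi> \<in> energy_space d"
  shows "set_integrable lborel (square d) (\<lambda>p. cnj (cov1 d \<mu> \<xi> p) * cov1 d \<mu> \<phi> p + cnj (cov2 d \<mu> \<xi> p) * cov2 d \<mu> \<phi> p)"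
  by (intro set_integral_add sq_integrable_mult sq_integrable_cnj energy_spaceD assms)

lemma set_integrable_pairing:
  assumes "u \<in> energy_space d" "v \<in> energy_space d"
  shows "set_integrable lborel (square d) (\<lambda>p. cnj (rep_aefun u p) * rep_aefun v p)"
  by (intro sq_integrable_mult sq_integrable_cnj energy_spaceD assms)

text \<open>Four L4 factors, grouped into two products that lie in L2.\<close>

lemma set_integrable_quartic:
  assumes "u \<in> energy_space d" "v \<in> energy_space d" "\<psi> \<in> energy_space d"
  shows "set_integrable lborel (square d) (\<lambda>p. cnj (rep_aefun u p) * (of_real ((cmod (rep_aefun \<psi> p))\<^sup>2) * rep_aefun v p))"
    and "set_integrable lborel (square d) (\<lambda>p. cnj (rep_aefun u p) * ((rep_aefun \<psi> p)\<^sup>2 * cnj (rep_aefun v p)))"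
proof -
  note U = energy_spaceD[OF assms(1)] and V = energy_spaceD[OF assms(2)] and P = energy_spaceD[OF assms(3)]
  have "set_integrable lborel (square d) (\<lambda>p. cnj (rep_aefun u p * rep_aefun \<psi> p) * (rep_aefun \<psi> p * rep_aefun v p))"
    by (intro sq_integrable_mult sq_integrable_cnj sq_integrable_product U V P rep_measurable)
  moreover have eq: "cnj (rep_aefun u p * rep_aefun \<psi> p) * (rep_aefun \<psi> p * rep_aefun v p)
     = cnj (rep_aefun u p) * (of_real ((cmod (rep_aefun \<psi> p))\<^sup>2) * rep_aefun v p)" for p
    by (simp add: complex_norm_square mult_ac del: of_real_power)
  ultimately show "set_integrable lborel (square d) (\<lambda>p. cnj (rep_aefun u p) * (of_real ((cmod (rep_aefun \<psi> p))\<^sup>2) * rep_aefun v p))"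
    unfolding eq by blast
  have "set_integrable lborel (square d) (\<lambda>p. cnj (rep_aefun u p * rep_aefun v p) * (rep_aefun \<psi> p)\<^sup>2)"
    by (intro sq_integrable_mult sq_integrable_cnj sq_integrable_product U V P rep_measurable)
  moreover have eq: "cnj (rep_aefun u p * rep_aefun v p) * (rep_aefun \<psi> p)\<^sup>2
      = cnj (rep_aefun u p) * ((rep_aefun \<psi> p)\<^sup>2 * cnj (rep_aefun v p))" for p
    by (simp add: mult_ac)
  ultimately show "set_integrable lborel (square d) (\<lambda>p. cnj (rep_aefun u p) * ((rep_aefun \<psi> p)\<^sup>2 * cnj (rep_aefun v p)))"
    unfolding eq by blast
qed

lemma Jac_eq:
  assumes "\<psi> \<in> energy_space d" "\<phi> \<in> energy_space d" "\<xi> \<in> energy_space d"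
  shows "set_integrable lborel (square d) (jac_density d \<mu> \<psi> \<phi> \<xi>)"
    and "Jac d \<psi> \<mu> \<phi> \<xi> = (LINT p:square d|lborel. jac_density d \<mu> \<psi> \<phi> \<xi> p)"
proof -
  let ?pot = "\<lambda>p. cnj (rep_aefun \<xi> p) * ((- 1 + 2 * of_real ((cmod (rep_aefun \<psi> p))\<^sup>2)) * rep_aefun \<phi> p
           + (rep_aefun \<psi> p)\<^sup>2 * cnj (rep_aefun \<phi> p))"
  have "set_integrable lborel (square d) (\<lambda>p. (- 1) * (cnj (rep_aefun \<xi> p) * rep_aefun \<phi> p)
     + (2 * (cnj (rep_aefun \<xi> p) * (of_real ((cmod (rep_aefun \<psi> p))\<^sup>2) * rep_aefun \<phi> p))
     + cnj (rep_aefun \<xi> p) * ((rep_aefun \<psi> p)\<^sup>2 * cnj (rep_aefun \<phi> p))))"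
    by (intro set_integral_add set_integrable_mult_right set_integrable_pairing set_integrable_quartic assms)
  moreover have "(- 1) * (cnj (rep_aefun \<xi> p) * rep_aefun \<phi> p)
     + (2 * (cnj (rep_aefun \<xi> p) * (of_real ((cmod (rep_aefun \<psi> p))\<^sup>2) * rep_aefun \<phi> p))
     + cnj (rep_aefun \<xi> p) * ((rep_aefun \<psi> p)\<^sup>2 * cnj (rep_aefun \<phi> p))) = ?pot p" for p
    by (simp add: algebra_simps)
  ultimately have pot: "set_integrable lborel (square d) ?pot" by simp
  show "set_integrable lborel (square d) (jac_density d \<mu> \<psi> \<phi> \<xi>)"
    unfolding jac_density_def[abs_def]
    by (intro set_integral_add(1) set_integrable_magnetic assms pot)
  show "Jac d \<psi> \<mu> \<phi> \<xi> = (LINT p:square d|lborel. jac_density d \<mu> \<psi> \<phi> \<xi> p)"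
    unfolding jac_density_def[abs_def]
    using set_integral_add(2)[OF set_integrable_magnetic[OF assms(2,3)] pot] assms(3)
    by (simp add: Jac_def magnetic_form_def cov1_def cov2_def)
qed

lemma set_integral_Re:
  assumes "set_integrable lborel A (f :: _ \<Rightarrow> complex)"
  shows "set_integrable lborel A (\<lambda>p. Re (f p))" "Re (LINT p:A|lborel. f p) = (LINT p:A|lborel. Re (f p))"
  using assms integral_Re[of lborel "\<lambda>x. indicat_real A x *\<^sub>R f x"] integrable_Re[of lborel "\<lambda>x. indicat_real A x *\<^sub>R f x"]
  unfolding set_integrable_def set_lebesgue_integral_def by simp_all

lemma set_integral_cong_AE_simple:
  assumes "AE p in lborel. f p = g p" "f \<in> borel_measurable borel" "g \<in> borel_measurable borel"
    and [measurable]: "A \<in> sets borel"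
  shows "(LINT p:A|lborel. f p) = (LINT p:A|lborel. (g p :: 'b::{banach, second_countable_topology}))"
  using assms by (intro set_lebesgue_integral_cong_AE) auto

lemma jac_density_measurable [measurable]: "jac_density d \<mu> \<psi> \<phi> \<xi> \<in> borel_measurable borel"
  unfolding jac_density_def[abs_def] by measurable

text \<open>The coefficients are real because the term with \<open>cnj (rep_aefun \<phi> p)\<close>
  is antilinear in \<phi>.\<close>

lemma Jac_lincomb:
  fixes a b :: real
  assumes "\<psi> \<in> energy_space d" "u \<in> energy_space d" "v \<in> energy_space d" "\<xi> \<in> energy_space d"
  shows "Jac d \<psi> \<mu> (lincomb (of_real a) u (of_real b) v) \<xi> = of_real a * Jac d \<psi> \<mu> u \<xi> + of_real b * Jac d \<psi> \<mu> v \<xi>"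
proof -
  let ?w = "lincomb (of_real a) u (of_real b) v"
  have w: "?w \<in> energy_space d" using assms by (intro energy_space_lincomb)
  have "AE p in lborel. jac_density d \<mu> \<psi> ?w \<xi> p = of_real a * jac_density d \<mu> \<psi> u \<xi> p + of_real b * jac_density d \<mu> \<psi> v \<xi> p"
    using cov_lincomb[OF assms(2,3), of \<mu> "of_real a" "of_real b"] rep_lincomb[of "of_real a" u "of_real b" v]
    by eventually_elim (simp add: jac_density_def algebra_simps)
  then have "Jac d \<psi> \<mu> ?w \<xi> = (LINT p:square d|lborel. of_real a * jac_density d \<mu> \<psi> u \<xi> p + of_real b * jac_density d \<mu> \<psi> v \<xi> p)"
    unfolding Jac_eq(2)[OF assms(1) w assms(4)] by (rule set_integral_cong_AE_simple) measurable
  also have "\<dots> = of_real a * Jac d \<psi> \<mu> u \<xi> + of_real b * Jac d \<psi> \<mu> v \<xi>"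
    using Jac_eq[OF assms(1,2,4)] Jac_eq[OF assms(1,3,4)]
    by (subst set_integral_add(2)) (auto simp: set_integral_mult_right)
  finally show ?thesis .
qed

text \<open>Swapping the arguments conjugates the Hermitian terms and fixes the remaining one, which
  is symmetric in the two conjugated factors, so real parts agree pointwise.\<close>

lemma Jac_symmetric:
  assumes "\<psi> \<in> energy_space d" "\<phi> \<in> energy_space d" "\<xi> \<in> energy_space d"
  shows "Re (Jac d \<psi> \<mu> \<phi> \<xi>) = Re (Jac d \<psi> \<mu> \<xi> \<phi>)"
proof -
  have "Re (jac_density d \<mu> \<psi> \<phi> \<xi> p) = Re (jac_density d \<mu> \<psi> \<xi> \<phi> p)" for p
    by (simp add: jac_density_def algebra_simps)
  then show ?thesis
    unfolding Jac_eq(2)[OF assms] Jac_eq(2)[OF assms(1,3,2)]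
      set_integral_Re(2)[OF Jac_eq(1)[OF assms]] set_integral_Re(2)[OF Jac_eq(1)[OF assms(1,3,2)]]
    by simp
qed

section \<open>The kernel as a real subspace, its rotation vector and its gradient bound\<close>

lemma ker_Jac_iff:
  "\<phi> \<in> ker_Jac d \<psi> \<mu> \<longleftrightarrow> \<phi> \<in> energy_space d \<and> (\<forall>\<xi>\<in>energy_space d. Jac d \<psi> \<mu> \<phi> \<xi> = 0)"
  by (auto simp: ker_Jac_def dual_zero_def Jac_def fun_eq_iff restrict_def)

lemma ker_Jac_lincomb:
  assumes "\<psi> \<in> energy_space d" "u \<in> ker_Jac d \<psi> \<mu>" "v \<in> ker_Jac d \<psi> \<mu>"
  shows "lincomb (of_real a) u (of_real b) v \<in> ker_Jac d \<psi> \<mu>"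
  using assms Jac_lincomb[OF assms(1)] by (auto simp: ker_Jac_iff energy_space_lincomb)

lemma zero_in_ker_Jac:
  assumes "\<psi> \<in> energy_space d"
  shows "0 \<in> ker_Jac d \<psi> \<mu>"
  unfolding zero_aefun_eq[of \<psi>] ker_Jac_iff
  using Jac_lincomb[OF assms assms assms, of _ \<mu> 0 0] energy_space_lincomb[OF assms assms] by simp

lemma subspace_ker_Jac:
  assumes "\<psi> \<in> energy_space d"
  shows "subspace (ker_Jac d \<psi> \<mu>)"
  unfolding subspace_def
proof (intro conjI ballI allI)
  show "0 \<in> ker_Jac d \<psi> \<mu>" using assms by (rule zero_in_ker_Jac)
  show "u + v \<in> ker_Jac d \<psi> \<mu>" if "u \<in> ker_Jac d \<psi> \<mu>" "v \<in> ker_Jac d \<psi> \<mu>" for u v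
    using ker_Jac_lincomb[OF assms that, of 1 1] by (simp add: plus_aefun_eq)
  show "r *\<^sub>R u \<in> ker_Jac d \<psi> \<mu>" if "u \<in> ker_Jac d \<psi> \<mu>" for r u
    using ker_Jac_lincomb[OF assms that that, of r 0] by (simp add: scaleR_aefun_eq)
qed

text \<open>Pointwise, 2 |\<psi>|^2 (\<i> \<psi>) + \<psi>^2 cnj (\<i> \<psi>) = \<i> |\<psi>|^2
  \<psi>, so the integrand of the Jacobian at the rotated \<psi> is \<i> times that of
  \<open>GL\<close>.\<close>

lemma rotation_in_ker_Jac:
  assumes \<psi>: "\<psi> \<in> energy_space d" and GL: "GL d \<psi> \<mu> = dual_zero d"
  shows "lincomb \<i> \<psi> 0 \<psi> \<in> ker_Jac d \<psi> \<mu>"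
  unfolding ker_Jac_iff
proof (intro conjI ballI)
  let ?w = "lincomb \<i> \<psi> 0 \<psi>"
  show w: "?w \<in> energy_space d" using \<psi> \<psi> by (rule energy_space_lincomb)
  fix \<xi> assume \<xi>: "\<xi> \<in> energy_space d"
  let ?mag = "\<lambda>p. cnj (cov1 d \<mu> \<xi> p) * cov1 d \<mu> \<psi> p + cnj (cov2 d \<mu> \<xi> p) * cov2 d \<mu> \<psi> p"
  let ?pot = "\<lambda>p. cnj (rep_aefun \<xi> p) * (rep_aefun \<psi> p * (1 - of_real ((cmod (rep_aefun \<psi> p))\<^sup>2)))"
  have "set_integrable lborel (square d) (\<lambda>p. cnj (rep_aefun \<xi> p) * rep_aefun \<psi> p
     + (- 1) * (cnj (rep_aefun \<xi> p) * (of_real ((cmod (rep_aefun \<psi> p))\<^sup>2) * rep_aefun \<psi> p)))"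
    by (intro set_integral_add set_integrable_mult_right set_integrable_pairing set_integrable_quartic \<psi> \<xi>)
  moreover have "cnj (rep_aefun \<xi> p) * rep_aefun \<psi> p
     + (- 1) * (cnj (rep_aefun \<xi> p) * (of_real ((cmod (rep_aefun \<psi> p))\<^sup>2) * rep_aefun \<psi> p)) = ?pot p" for p
    by (simp add: algebra_simps)
  ultimately have pot: "set_integrable lborel (square d) ?pot" by simp
  have "AE p in lborel. jac_density d \<mu> \<psi> ?w \<xi> p = \<i> * (?mag p - ?pot p)"
    using cov_lincomb[OF \<psi> \<psi>, of \<mu> \<i> 0] rep_lincomb[of \<i> \<psi> 0 \<psi>]
    by eventually_elim (simp add: jac_density_def complex_norm_square power2_eq_square[of "rep_aefun \<psi> _"]
        algebra_simps del: of_real_power)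
  then have "Jac d \<psi> \<mu> ?w \<xi> = (LINT p:square d|lborel. \<i> * (?mag p - ?pot p))"
    unfolding Jac_eq(2)[OF \<psi> w \<xi>] by (rule set_integral_cong_AE_simple) measurable
  also have "\<dots> = \<i> * ((LINT p:square d|lborel. ?mag p) - (LINT p:square d|lborel. ?pot p))"
    using set_integral_diff(2)[OF set_integrable_magnetic[OF \<psi> \<xi>] pot] by (simp add: set_integral_mult_right)
  also have "(LINT p:square d|lborel. ?mag p) - (LINT p:square d|lborel. ?pot p) = GL d \<psi> \<mu> \<xi>"
    using \<xi> by (simp add: GL_def magnetic_form_def cov1_def cov2_def)
  also have "GL d \<psi> \<mu> \<xi> = 0" using GL \<xi> by (simp add: dual_zero_def)
  finally show "Jac d \<psi> \<mu> ?w \<xi> = 0" by simp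
qed

lemma ker_Jac_energy_bound:
  assumes \<psi>: "\<psi> \<in> energy_space d" and \<phi>: "\<phi> \<in> ker_Jac d \<psi> \<mu>"
  shows "(LINT p:square d|lborel. (cmod (cov1 d \<mu> \<phi> p))\<^sup>2 + (cmod (cov2 d \<mu> \<phi> p))\<^sup>2)
     \<le> (LINT p:square d|lborel. (cmod (rep_aefun \<phi> p))\<^sup>2)"
proof -
  have \<phi>': "\<phi> \<in> energy_space d" and J: "Jac d \<psi> \<mu> \<phi> \<phi> = 0" using \<phi> by (auto simp: ker_Jac_iff)
  have i: "set_integrable lborel (square d) (\<lambda>p. (cmod (rep_aefun \<phi> p))\<^sup>2)"
    "set_integrable lborel (square d) (\<lambda>p. (cmod (cov1 d \<mu> \<phi> p))\<^sup>2 + (cmod (cov2 d \<mu> \<phi> p))\<^sup>2)"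
    using energy_spaceD(3,5,6)[OF \<phi>'] energy_spaceD(7,8)[OF \<phi>', of \<mu>] unfolding sq_integrable_def by (auto intro: set_integral_add)
  note jac = Jac_eq[OF \<psi> \<phi>' \<phi>', of \<mu>]
  have "(cmod (cov1 d \<mu> \<phi> p))\<^sup>2 + (cmod (cov2 d \<mu> \<phi> p))\<^sup>2 - (cmod (rep_aefun \<phi> p))\<^sup>2
     \<le> Re (jac_density d \<mu> \<psi> \<phi> \<phi> p)" for p
  proof -
    define s f where "s = rep_aefun \<psi> p" and "f = rep_aefun \<phi> p"
    have "- (cmod s * cmod f)\<^sup>2 \<le> Re ((cnj f * s)\<^sup>2)"
      using abs_Re_le_cmod[of "(cnj f * s)\<^sup>2"] by (simp add: norm_mult norm_power power_mult_distrib mult.commute)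
    moreover have "0 \<le> (cmod s * cmod f)\<^sup>2" by simp
    moreover have "Re (jac_density d \<mu> \<psi> \<phi> \<phi> p) = (cmod (cov1 d \<mu> \<phi> p))\<^sup>2 + (cmod (cov2 d \<mu> \<phi> p))\<^sup>2
       - (cmod f)\<^sup>2 + 2 * (cmod s * cmod f)\<^sup>2 + Re ((cnj f * s)\<^sup>2)"
    proof -
      have "jac_density d \<mu> \<psi> \<phi> \<phi> p = cov1 d \<mu> \<phi> p * cnj (cov1 d \<mu> \<phi> p) + cov2 d \<mu> \<phi> p * cnj (cov2 d \<mu> \<phi> p)
         - f * cnj f + 2 * (of_real ((cmod s)\<^sup>2) * (f * cnj f)) + (cnj f * s)\<^sup>2"
        unfolding jac_density_def s_def[symmetric] f_def[symmetric]
        by (simp add: power2_eq_square algebra_simps)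
      also have "\<dots> = of_real ((cmod (cov1 d \<mu> \<phi> p))\<^sup>2 + (cmod (cov2 d \<mu> \<phi> p))\<^sup>2 - (cmod f)\<^sup>2 + 2 * (cmod s * cmod f)\<^sup>2) + (cnj f * s)\<^sup>2"
        unfolding complex_norm_square[symmetric] by (simp add: power_mult_distrib)
      finally show ?thesis by (simp only: plus_complex.sel Re_complex_of_real)
    qed
    ultimately show ?thesis unfolding f_def by linarith
  qed
  then have "(LINT p:square d|lborel. ((cmod (cov1 d \<mu> \<phi> p))\<^sup>2 + (cmod (cov2 d \<mu> \<phi> p))\<^sup>2) - (cmod (rep_aefun \<phi> p))\<^sup>2)
     \<le> (LINT p:square d|lborel. Re (jac_density d \<mu> \<psi> \<phi> \<phi> p))"
    by (intro set_integral_mono set_integral_diff i set_integral_Re jac) 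
  also have "\<dots> = 0" using J jac set_integral_Re(2)[OF jac(1)] by simp
  finally show ?thesis using set_integral_diff(2)[OF i(2,1)] by simp
qed

text \<open>The Poincare estimate speaks of the plain gradient, the energy bound of the covariant
  one. They differ by at most |\<mu>| d |\<phi>| in each component; squaring costs a factor 2, and
  the two components together give 2 + 4 (\<mu> d)^2.\<close>

lemma ker_Jac_gradient_bound:
  assumes \<psi>: "\<psi> \<in> energy_space d" and \<phi>: "\<phi> \<in> ker_Jac d \<psi> \<mu>"
  shows "(LINT p:square d|lborel. (cmod (rep_aefun (weak_deriv d (1, 0) \<phi>) p))\<^sup>2 + (cmod (rep_aefun (weak_deriv d (0, 1) \<phi>) p))\<^sup>2)
     \<le> (2 + 4 * (\<mu> * d)\<^sup>2) * (LINT p:square d|lborel. (cmod (rep_aefun \<phi> p))\<^sup>2)"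
proof -
  have \<phi>': "\<phi> \<in> energy_space d" using \<phi> by (auto simp: ker_Jac_iff)
  let ?f = "\<lambda>p. (cmod (rep_aefun \<phi> p))\<^sup>2" and ?c = "\<lambda>p. (cmod (cov1 d \<mu> \<phi> p))\<^sup>2 + (cmod (cov2 d \<mu> \<phi> p))\<^sup>2"
  let ?g = "\<lambda>p. (cmod (rep_aefun (weak_deriv d (1, 0) \<phi>) p))\<^sup>2 + (cmod (rep_aefun (weak_deriv d (0, 1) \<phi>) p))\<^sup>2"
  have i: "set_integrable lborel (square d) ?f" "set_integrable lborel (square d) ?c" "set_integrable lborel (square d) ?g"
    using energy_spaceD(3,5,6)[OF \<phi>'] energy_spaceD(7,8)[OF \<phi>', of \<mu>] unfolding sq_integrable_def by (auto intro: set_integral_add)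
  have sq: "(cmod x)\<^sup>2 \<le> 2 * (cmod z)\<^sup>2 + 2 * (\<mu> * d)\<^sup>2 * (cmod f)\<^sup>2"
    if "z = - \<i> * x - of_real A * f" "cmod (complex_of_real A) \<le> \<bar>\<mu>\<bar> * d" for x z f A
  proof -
    have "\<i> * x = - (z + of_real A * f)" using that(1) by simp
    then have "cmod x = cmod (z + of_real A * f)" by (metis norm_ii norm_minus_cancel norm_mult mult_1)
    also have "\<dots> \<le> cmod z + cmod (complex_of_real A) * cmod f"
      using norm_triangle_ineq[of z "of_real A * f"] by (simp add: norm_mult)
    also have "\<dots> \<le> cmod z + \<bar>\<mu>\<bar> * d * cmod f"
      using that(2) by (intro add_left_mono mult_right_mono) auto
    finally have "(cmod x)\<^sup>2 \<le> (cmod z + \<bar>\<mu>\<bar> * d * cmod f)\<^sup>2" by (rule power_mono) simp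
    also have "\<dots> \<le> 2 * (cmod z)\<^sup>2 + 2 * (\<bar>\<mu>\<bar> * d * cmod f)\<^sup>2"
      using sum_squares_bound[of "cmod z" "\<bar>\<mu>\<bar> * d * cmod f"] by (simp only: power2_sum)
    finally show ?thesis by (simp add: power_mult_distrib)
  qed
  have "?g p \<le> 2 * ?c p + 4 * (\<mu> * d)\<^sup>2 * ?f p" if p: "p \<in> square d" for p
    using sq[OF _ vector_potential_bound(1)[OF p], of "cov1 d \<mu> \<phi> p" "rep_aefun (weak_deriv d (1, 0) \<phi>) p" "rep_aefun \<phi> p"]
      sq[OF _ vector_potential_bound(2)[OF p], of "cov2 d \<mu> \<phi> p" "rep_aefun (weak_deriv d (0, 1) \<phi>) p" "rep_aefun \<phi> p"]
    by (simp add: cov1_def cov2_def cov_grad_def algebra_simps)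
  then have "(LINT p:square d|lborel. ?g p) \<le> (LINT p:square d|lborel. 2 * ?c p + 4 * (\<mu> * d)\<^sup>2 * ?f p)"
    by (intro set_integral_mono[OF i(3) set_integral_add(1)[OF set_integrable_mult_right[OF i(2)] set_integrable_mult_right[OF i(1)]]])
  also have "\<dots> = 2 * (LINT p:square d|lborel. ?c p) + 4 * (\<mu> * d)\<^sup>2 * (LINT p:square d|lborel. ?f p)"
    using set_integral_add(2)[OF set_integrable_mult_right[OF i(2)] set_integrable_mult_right[OF i(1)], of 2 "4 * (\<mu> * d)\<^sup>2"]
    by (simp only: set_integral_mult_right)
  also have "\<dots> \<le> (2 + 4 * (\<mu> * d)\<^sup>2) * (LINT p:square d|lborel. ?f p)"
    using ker_Jac_energy_bound[OF \<psi> \<phi>] by (simp add: algebra_simps)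
  finally show ?thesis .
qed

section \<open>Finite dimension of the kernel\<close>

lemma nn_integral_square:
  assumes "set_integrable lborel (square d) f" "\<And>p. f p \<ge> 0"
  shows "(\<integral>\<^sup>+p. indicator (square d) p * ennreal (f p) \<partial>lborel) = ennreal (LINT p:square d|lborel. f p)"
    and "(LINT p:square d|lborel. f p) \<ge> 0"
proof -
  have "(\<integral>\<^sup>+p. indicator (square d) p * ennreal (f p) \<partial>lborel) = (\<integral>\<^sup>+p. ennreal (indicat_real (square d) p *\<^sub>R f p) \<partial>lborel)"
    by (intro nn_integral_cong) (auto simp: indicator_def)
  also have "\<dots> = ennreal (LINT p:square d|lborel. f p)"
    using assms unfolding set_integrable_def set_lebesgue_integral_def
    by (intro nn_integral_eq_integral) auto
  finally show "(\<integral>\<^sup>+p. indicator (square d) p * ennreal (f p) \<partial>lborel) = ennreal (LINT p:square d|lborel. f p)" .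
  show "(LINT p:square d|lborel. f p) \<ge> 0"
    unfolding set_lebesgue_integral_def using assms(2) by (intro integral_nonneg_AE) auto
qed

lemma zero_if_L2_norm_zero:
  assumes u: "u \<in> energy_space d" and "(LINT p:square d|lborel. (cmod (rep_aefun u p))\<^sup>2) = 0"
  shows "u = 0"
proof -
  have i: "set_integrable lborel (square d) (\<lambda>p. (cmod (rep_aefun u p))\<^sup>2)"
    using energy_spaceD(3)[OF u] by (simp add: sq_integrable_def)
  have "(\<integral>\<^sup>+p. indicator (square d) p * ennreal ((cmod (rep_aefun u p))\<^sup>2) \<partial>lborel) = 0"
    using nn_integral_square(1)[OF i] assms(2) by simp
  then have "AE p in lborel. indicator (square d) p * ennreal ((cmod (rep_aefun u p))\<^sup>2) = 0"
    by (subst (asm) nn_integral_0_iff_AE) auto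
  then have "AE p in lborel. rep_aefun u p = rep_aefun 0 p"
    using rep_zero energy_spaceD(1)[OF u, unfolded lives_on_square_def]
    by eventually_elim (auto simp: indicator_def split: if_splits)
  then show ?thesis by (rule aefun_eqI)
qed

lemma finite_dim_ker_Jac:
  assumes "d > 0" and \<psi>: "\<psi> \<in> energy_space d"
  shows "\<exists>B. finite B \<and> ker_Jac d \<psi> \<mu> \<subseteq> span B"
proof -
  obtain M where M: "M \<ge> 0" and bump: "\<And>a h. h > 0 \<Longrightarrow> \<exists>\<rho>. cell_bump a h M \<rho>"
    using cell_bump_exists by auto
  \<comment> \<open>L / N^2 is the Poincare constant for mesh d / N times the constant of the
    gradient bound. Taking N > L + 1 ensures N >= 1 and L / N^2 < 1.\<close>
  define L where "L = 2 * (M + 1) * (2 + 4 * (\<mu> * d)\<^sup>2) * d\<^sup>2"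
  have L: "L \<ge> 0" using M by (simp add: L_def)
  obtain N :: nat where N: "real N > L + 1" using reals_Archimedean2 by blast
  have N0: "N > 0" using N L by (cases N) auto
  have small: "2 * (M + 1) * (d / real N)\<^sup>2 * (2 + 4 * (\<mu> * d)\<^sup>2) < 1"
  proof -
    have "L < real N * 1" using N by simp
    also have "\<dots> \<le> real N * real N" using N L by (intro mult_left_mono) auto
    finally have "L / (real N * real N) < 1" using N0 by simp
    then show ?thesis by (simp add: L_def power2_eq_square field_simps)
  qed
  define a where "a i = - d / 2 + real i * (d / real N)" for i
  have hN: "d / real N > 0" using assms(1) N0 by simp
  obtain r where r: "\<And>i. cell_bump (a i) (d / real N) M (r i)" by (rule that[of "\<lambda>i. SOME \<rho>. cell_bump (a i) (d / real N) M \<rho>"]) (rule someI_ex[OF bump[OF hN]])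
  \<comment> \<open>Dimensions are real while the cell means are complex, so real and imaginary
    parts are separate functionals.\<close>
  define F where "F = (\<lambda>(i, j) u. Re (cell_functional d (r i) (r j) u)) ` ({..<N} \<times> {..<N})
     \<union> (\<lambda>(i, j) u. Im (cell_functional d (r i) (r j) u)) ` ({..<N} \<times> {..<N})"
  have lin: "cell_functional d (r i) (r j) (lincomb \<alpha> u \<beta> v)
      = \<alpha> * cell_functional d (r i) (r j) u + \<beta> * cell_functional d (r i) (r j) v"
    if u: "u \<in> energy_space d" and v: "v \<in> energy_space d" for i j \<alpha> u \<beta> v
  proof -
    interpret I: cell_bump "a i" "d / real N" M "r i" by (rule r)
    interpret J: cell_bump "a j" "d / real N" M "r j" by (rule r)
    have i: "set_integrable lborel (square d) (\<lambda>p. rep_aefun w p * of_real (r i (fst p) * r j (snd p)))"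
      if "w \<in> energy_space d" for w
    proof -
      have "sq_integrable d (\<lambda>p. of_real (r i (fst p) * r j (snd p)) * rep_aefun w p)"
      proof (rule sq_integrable_bounded_mult)
        have bd: "\<bar>r i x\<bar> \<le> M / (d / real N)" "\<bar>r j x\<bar> \<le> M / (d / real N)" for x
          by (simp_all only: abs_of_nonneg I.\<rho>_nonneg J.\<rho>_nonneg I.bound J.bound)
        show "cmod (complex_of_real (r i (fst p) * r j (snd p))) \<le> (M / (d / real N)) * (M / (d / real N))" for p
          unfolding norm_of_real abs_mult
          by (intro mult_mono bd abs_ge_zero divide_nonneg_pos M hN)
      qed (use energy_spaceD(3)[OF that] in auto)
      from sq_integrable_integrable[OF this] show ?thesis by (simp add: mult.commute)
    qed
    show ?thesis unfolding cell_functional_def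
      by (rule integral_lincomb(2)[OF i[OF u] i[OF v]]) auto
  qed
  have K: "u \<in> energy_space d" if "u \<in> ker_Jac d \<psi> \<mu>" for u using that by (simp add: ker_Jac_iff)
  show ?thesis
  proof (rule finite_span_if_functionals_separate[of F])
    show "finite F" by (auto simp: F_def)
    show "subspace (ker_Jac d \<psi> \<mu>)" using \<psi> by (rule subspace_ker_Jac)
    show "f (u + v) = f u + f v" if "f \<in> F" "u \<in> ker_Jac d \<psi> \<mu>" "v \<in> ker_Jac d \<psi> \<mu>" for f u v
      using that(1) lin[OF K K, OF that(2,3)] by (auto simp: F_def plus_aefun_eq)
    show "f (t *\<^sub>R u) = t * f u" if "f \<in> F" "u \<in> ker_Jac d \<psi> \<mu>" for f u t
      using that(1) lin[OF K K, OF that(2,2)] by (auto simp: F_def scaleR_aefun_eq)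
    fix u assume u: "u \<in> ker_Jac d \<psi> \<mu>" and z: "\<forall>f\<in>F. f u = 0"
    have z': "cell_functional d (r i) (r j) u = 0" if "i < N" "j < N" for i j
    proof (rule complex_eqI)
      have "(\<lambda>u. Re (cell_functional d (r i) (r j) u)) \<in> F" "(\<lambda>u. Im (cell_functional d (r i) (r j) u)) \<in> F"
        using that by (force simp: F_def)+
      then show "Re (cell_functional d (r i) (r j) u) = Re 0" "Im (cell_functional d (r i) (r j) u) = Im 0"
        using z by force+
    qed
    let ?f = "\<lambda>p. (cmod (rep_aefun u p))\<^sup>2"
    let ?g = "\<lambda>p. (cmod (rep_aefun (weak_deriv d (1, 0) u) p))\<^sup>2 + (cmod (rep_aefun (weak_deriv d (0, 1) u) p))\<^sup>2"
    have i: "set_integrable lborel (square d) ?f" "set_integrable lborel (square d) ?g"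
      using energy_spaceD(3,5,6)[OF K[OF u]] unfolding sq_integrable_def by (auto intro: set_integral_add)
    define S G where "S = (LINT p:square d|lborel. ?f p)" and "G = (LINT p:square d|lborel. ?g p)"
    have S0: "S \<ge> 0" and G0: "G \<ge> 0" unfolding S_def G_def by (intro nn_integral_square i; simp)+
    have S_nn: "(\<integral>\<^sup>+p. indicator (square d) p * ennreal (?f p) \<partial>lborel) = ennreal S"
      unfolding S_def by (rule nn_integral_square(1)[OF i(1)]) simp
    have G_nn: "(\<integral>\<^sup>+p. indicator (square d) p * ennreal (?g p) \<partial>lborel) = ennreal G"
      unfolding G_def by (rule nn_integral_square(1)[OF i(2)]) simp
    have "ennreal S \<le> ennreal (2 * (M + 1) * (d / real N)\<^sup>2) * ennreal G"
      using poincare_on_square[OF assms(1) N0 K[OF u] M r[unfolded a_def] z'] unfolding S_nn G_nn .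
    then have "S \<le> 2 * (M + 1) * (d / real N)\<^sup>2 * G"
      using M G0 by (simp flip: ennreal_mult)
    also have "\<dots> \<le> 2 * (M + 1) * (d / real N)\<^sup>2 * ((2 + 4 * (\<mu> * d)\<^sup>2) * S)"
      unfolding S_def G_def using M by (intro mult_left_mono ker_Jac_gradient_bound[OF \<psi> u]) auto
    finally have le: "S \<le> (2 * (M + 1) * (d / real N)\<^sup>2 * (2 + 4 * (\<mu> * d)\<^sup>2)) * S" by (simp add: mult.assoc)
    have "S = 0"
    proof (rule ccontr)
      assume "S \<noteq> 0"
      with S0 have "S > 0" by simp
      from mult_strict_right_mono[OF small this] le show False by simp
    qed
    then show "u = 0" using zero_if_L2_norm_zero[OF K[OF u]] by (simp add: S_def)
  qed
qed

section \<open>The extended kernel\<close>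

lemma L2_inner_lincomb:
  assumes f: "sq_integrable d (rep_aefun f)" and u: "u \<in> energy_space d" and v: "v \<in> energy_space d"
  shows "L2_inner d f (lincomb \<alpha> u \<beta> v) = \<alpha> * L2_inner d f u + \<beta> * L2_inner d f v"
proof -
  have i: "set_integrable lborel (square d) (\<lambda>p. rep_aefun w p * cnj (rep_aefun f p))"
    if "w \<in> energy_space d" for w
    by (intro sq_integrable_mult sq_integrable_cnj f energy_spaceD(3)[OF that])
  show ?thesis
    using integral_lincomb(2)[OF i[OF u] i[OF v], of \<alpha> \<beta>] by (simp add: L2_inner_def mult.commute)
qed

lemma ker_Jac_ext_eq:
  assumes \<psi>: "\<psi> \<in> energy_space d" and GL: "GL d \<psi> \<mu> = dual_zero d" and nz: "\<psi> \<noteq> 0"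
  shows "ker_Jac_ext d \<psi>\<^sub>0 \<psi> 0 \<mu> = (\<lambda>\<phi>. (\<phi>, 0)) ` {\<phi> \<in> ker_Jac d \<psi> \<mu>. Im (L2_inner d \<psi>\<^sub>0 \<phi>) = 0}"
proof -
  let ?w = "lincomb \<i> \<psi> 0 \<psi>"
  have w: "?w \<in> ker_Jac d \<psi> \<mu>" using \<psi> GL by (rule rotation_in_ker_Jac)
  then have w': "?w \<in> energy_space d" by (simp add: ker_Jac_iff)
  have iff: "(\<phi>, \<nu>) \<in> ker_Jac_ext d \<psi>\<^sub>0 \<psi> 0 \<mu> \<longleftrightarrow> \<phi> \<in> energy_space d \<and>
     (\<forall>\<xi>\<in>energy_space d. Jac d \<psi> \<mu> \<phi> \<xi> = \<i> * of_real \<nu> * L2_inner d \<xi> \<psi>) \<and> Im (L2_inner d \<psi>\<^sub>0 \<phi>) = 0" for \<phi> \<nu>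
    by (auto simp: ker_Jac_ext_def Jac_ext_def dual_zero_def fun_eq_iff restrict_def)
  have nu: "\<nu> = 0" if \<phi>: "\<phi> \<in> energy_space d"
    and eq: "\<forall>\<xi>\<in>energy_space d. Jac d \<psi> \<mu> \<phi> \<xi> = \<i> * of_real \<nu> * L2_inner d \<xi> \<psi>" for \<phi> \<nu>
  proof -
    define S where "S = (LINT p:square d|lborel. (cmod (rep_aefun \<psi> p))\<^sup>2)"
    have "L2_inner d ?w \<psi> = (LINT p:square d|lborel. - \<i> * of_real ((cmod (rep_aefun \<psi> p))\<^sup>2))"
      unfolding L2_inner_def
    proof (rule set_integral_cong_AE_simple)
      show "AE p in lborel. cnj (rep_aefun ?w p) * rep_aefun \<psi> p = - \<i> * of_real ((cmod (rep_aefun \<psi> p))\<^sup>2)"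
        using rep_lincomb[of \<i> \<psi> 0 \<psi>] by eventually_elim (simp add: complex_norm_square mult_ac del: of_real_power)
    qed measurable
    also have "\<dots> = - \<i> * of_real S"
      unfolding S_def set_integral_mult_right by (simp add: set_integral_complex_of_real del: of_real_power)
    finally have inner: "L2_inner d ?w \<psi> = - \<i> * of_real S" .
    \<comment> \<open>The inner product is antilinear in its first slot, so rotating that slot gives
      - \<i> S; the two imaginary units cancel and the real number \<nu> S remains.\<close>
    have "\<i> * of_real \<nu> * L2_inner d ?w \<psi> = of_real (\<nu> * S)"
      unfolding inner by (rule complex_eqI) simp_all
    then have "\<nu> * S = Re (Jac d \<psi> \<mu> \<phi> ?w)" using eq w' by (metis Re_complex_of_real)
    also have "\<dots> = Re (Jac d \<psi> \<mu> ?w \<phi>)" using \<psi> \<phi> w' by (rule Jac_symmetric)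
    also have "\<dots> = 0" using w \<phi> by (simp add: ker_Jac_iff)
    finally show "\<nu> = 0" using zero_if_L2_norm_zero[OF \<psi>] nz by (auto simp: S_def)
  qed
  show ?thesis
  proof (rule set_eqI, rule iffI)
    fix z :: "aefun \<times> real" assume z: "z \<in> ker_Jac_ext d \<psi>\<^sub>0 \<psi> 0 \<mu>"
    obtain \<phi> \<nu> where zp: "z = (\<phi>, \<nu>)" by (rule prod.exhaust)
    note * = z[unfolded zp iff]
    have "\<nu> = 0" by (rule nu) (use * in blast)+
    with * show "z \<in> (\<lambda>\<phi>. (\<phi>, 0)) ` {\<phi> \<in> ker_Jac d \<psi> \<mu>. Im (L2_inner d \<psi>\<^sub>0 \<phi>) = 0}"
      by (simp add: zp ker_Jac_iff)
  next
    fix z :: "aefun \<times> real" assume "z \<in> (\<lambda>\<phi>. (\<phi>, 0)) ` {\<phi> \<in> ker_Jac d \<psi> \<mu>. Im (L2_inner d \<psi>\<^sub>0 \<phi>) = 0}"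
    then obtain \<phi> where "z = (\<phi>, 0)" "\<phi> \<in> ker_Jac d \<psi> \<mu>" "Im (L2_inner d \<psi>\<^sub>0 \<phi>) = 0" by blast
    then show "z \<in> ker_Jac_ext d \<psi>\<^sub>0 \<psi> 0 \<mu>" unfolding ker_Jac_iff by (simp add: iff)
  qed
qed

text \<open>The real part enters because the imaginary part of the inner product of \<psi>0 with the
  rotated solution is the real part of that with the solution itself. If it vanished, the rotated
  solution would stay in the extended kernel. Solutions of the extended problem have an inner
  product with zero imaginary part, so for them the hypothesis says that it is nonzero.\<close>

theorem corollary4p1:
  fixes d \<mu>\<^sub>s :: real and \<psi>\<^sub>s \<psi>\<^sub>0 :: aefun
  assumes "d > 0"
    and "\<psi>\<^sub>s \<in> energy_space d"
    and "GL d \<psi>\<^sub>s \<mu>\<^sub>s = dual_zero d"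
    and "\<psi>\<^sub>s \<noteq> 0"
    and "\<psi>\<^sub>0 \<in> L2_space d"
    and "Re (L2_inner d \<psi>\<^sub>0 \<psi>\<^sub>s) \<noteq> 0"
  shows "edim (ker_Jac_ext d \<psi>\<^sub>0 \<psi>\<^sub>s 0 \<mu>\<^sub>s) < edim (ker_Jac d \<psi>\<^sub>s \<mu>\<^sub>s)"
proof -
  let ?K = "ker_Jac d \<psi>\<^sub>s \<mu>\<^sub>s" and ?w = "lincomb \<i> \<psi>\<^sub>s 0 \<psi>\<^sub>s"
  let ?K' = "{\<phi> \<in> ?K. Im (L2_inner d \<psi>\<^sub>0 \<phi>) = 0}"
  have K: "subspace ?K" using assms(2) by (rule subspace_ker_Jac)
  have energy: "\<phi> \<in> energy_space d" if "\<phi> \<in> ?K" for \<phi> using that by (simp add: ker_Jac_iff)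
  have \<psi>0: "sq_integrable d (rep_aefun \<psi>\<^sub>0)" using assms(5) by (simp add: L2_space_def sq_integrable_def)
  note lin = L2_inner_lincomb[OF \<psi>0 energy energy]
  have K': "subspace ?K'"
    unfolding subspace_def
  proof (intro conjI ballI allI)
    have "Im (L2_inner d \<psi>\<^sub>0 0) = 0"
      using lin[OF subspace_0[OF K] subspace_0[OF K], of 0 0] by (simp flip: zero_aefun_eq)
    then show "0 \<in> ?K'" using subspace_0[OF K] by simp
    show "u + v \<in> ?K'" if "u \<in> ?K'" "v \<in> ?K'" for u v
      using that subspace_add[OF K, of u v] lin[of u v 1 1] by (simp add: plus_aefun_eq)
    show "c *\<^sub>R u \<in> ?K'" if "u \<in> ?K'" for c u
      using that subspace_scale[OF K, of u c] lin[of u u "of_real c" 0] by (simp add: scaleR_aefun_eq)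
  qed
  obtain B where B: "finite B" "?K \<subseteq> span B" using finite_dim_ker_Jac[OF assms(1,2)] by blast
  have w: "?w \<in> ?K" using assms(2,3) by (rule rotation_in_ker_Jac)
  have "Im (L2_inner d \<psi>\<^sub>0 ?w) = Re (L2_inner d \<psi>\<^sub>0 \<psi>\<^sub>s)"
    using L2_inner_lincomb[OF \<psi>0 assms(2,2), of \<i> 0] by simp
  then have "?w \<notin> ?K'" using assms(6) by simp
  moreover have "linear (\<lambda>\<phi>::aefun. (\<phi>, 0::real))" by (auto intro!: linearI)
  moreover have "inj (\<lambda>\<phi>::aefun. (\<phi>, 0::real))" by (auto intro: injI)
  ultimately show ?thesis
    unfolding ker_Jac_ext_eq[OF assms(2,3,4)] by (intro edim_less[OF K B K' _ w]) auto
qed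

end
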